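(* Let $n,d\geq 2$ and let $\mathbb{F}$ be an infinite field of characteristic $p>\frac{n}{2}$. Then $$C_{n,d}<n^{\log_2(3d+2)+1}.$$
   Context: Let $\mathbb{F}$ be an infinite field of characteristic $p\geq 0$. Let $\mathcal{M}=\mathcal{M}(x_1,\ldots,x_d)$ be the free semigroup (without unity) generated by letters $x_1,\ldots,x_d$, and let $\mathcal{M}_{\mathbb{F}}$ be the vector space over $\mathbb{F}$ with basis $\mathcal{M}$, i.e. the free associative non-unital $\mathbb{F}$-algebra on $x_1,\ldots,x_d$. For $n\geq 1$ let $N_{n,d}=\mathcal{M}_{\mathbb{F}}/I_n$, where $I_n$ is the two-sided ideal of $\mathcal{M}_{\mathbb{F}}$ generated by all $f^n$, $f\in\mathcal{M}_{\mathbb{F}}$ (the relatively free algebra with identity $x^n=0$). The nilpotency degree is $C_{n,d}=\min\{c>0 \mid a_1\cdots a_c=0 \text{ for all } a_1,\ldots,a_c\in N_{n,d}\}$. It depends only on $n$, $d$ and $p$. *)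

theory Defs
  imports
    Complex_Main
    "HOL-Library.Extended_Real"
    "HOL-Library.Poly_Mapping"
begin

text \<open>
  Words under concatenation, written additively because the convolution product
  of \<^theory>\<open>HOL-Library.Poly_Mapping\<close> is stated for the class \<^class>\<open>monoid_add\<close>.
  Thus \<open>'x fword \<Rightarrow>\<^sub>0 'a\<close> is the unital free associative algebra over \<open>'a\<close>;
  the non-unital one is carved out of it by \<open>free_alg\<close> below.
\<close>

datatype 'x fword = Word (letters: "'x list")

instantiation fword :: (type) monoid_add
begin

definition zero_fword :: "'a fword" where
  "0 = Word []"

definition plus_fword :: "'a fword \<Rightarrow> 'a fword \<Rightarrow> 'a fword" where
  "u + v = Word (letters u @ letters v)"

instance
  by standard (simp_all add: zero_fword_def plus_fword_def)

end

text \<open>The letter \<open>x\<^sub>i\<close> is the number \<open>i\<close>.\<close>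

definition free_semigroup :: "nat \<Rightarrow> nat fword set" where
  "free_semigroup d = {w. letters w \<noteq> [] \<and> set (letters w) \<subseteq> {1..d}}"

definition free_alg :: "nat \<Rightarrow> (nat fword \<Rightarrow>\<^sub>0 'a::field) set" where
  "free_alg d = {f. Poly_Mapping.keys f \<subseteq> free_semigroup d}"

text \<open>
  Two-sided ideals of a possibly non-unital subalgebra \<open>A\<close>. The scalar multiple
  of \<open>f\<close> by \<open>c\<close> is the product with \<open>c\<close> times the empty word. Closure under it
  is required separately, since \<open>A\<close> need not contain the scalars.
\<close>

definition alg_ideal ::
  "(nat fword \<Rightarrow>\<^sub>0 'a::field) set \<Rightarrow> (nat fword \<Rightarrow>\<^sub>0 'a) set \<Rightarrow> bool" where
  "alg_ideal A I \<longleftrightarrow> I \<subseteq> A \<and> 0 \<in> I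
     \<and> (\<forall>f\<in>I. \<forall>g\<in>I. f + g \<in> I)
     \<and> (\<forall>c. \<forall>f\<in>I. Poly_Mapping.single 0 c * f \<in> I)
     \<and> (\<forall>a\<in>A. \<forall>f\<in>I. a * f \<in> I \<and> f * a \<in> I)"

definition nil_ideal :: "nat \<Rightarrow> nat \<Rightarrow> (nat fword \<Rightarrow>\<^sub>0 'a::field) set" where
  "nil_ideal n d = alg_ideal (free_alg d) hull {f ^ n | f. f \<in> free_alg d}"

definition nil_rel ::
  "nat \<Rightarrow> nat \<Rightarrow> ((nat fword \<Rightarrow>\<^sub>0 'a::field) \<times> (nat fword \<Rightarrow>\<^sub>0 'a)) set" where
  "nil_rel n d = {(f, g). f \<in> free_alg d \<and> g \<in> free_alg d \<and> f - g \<in> nil_ideal n d}"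

text \<open>
  \<open>N\<^sub>n\<^sub>,\<^sub>d\<close> consists of residue classes. The union of classes taken in \<open>nil_mult\<close>
  is the single class of the product (lemma \<open>nil_mult_class\<close>).
\<close>

definition nil_alg :: "nat \<Rightarrow> nat \<Rightarrow> (nat fword \<Rightarrow>\<^sub>0 'a::field) set set" where
  "nil_alg n d = free_alg d // nil_rel n d"

definition nil_zero :: "nat \<Rightarrow> nat \<Rightarrow> (nat fword \<Rightarrow>\<^sub>0 'a::field) set" where
  "nil_zero n d = nil_rel n d `` {0}"

definition nil_mult ::
  "nat \<Rightarrow> nat \<Rightarrow> (nat fword \<Rightarrow>\<^sub>0 'a::field) set \<Rightarrow> (nat fword \<Rightarrow>\<^sub>0 'a) set
     \<Rightarrow> (nat fword \<Rightarrow>\<^sub>0 'a) set" where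
  "nil_mult n d X Y = nil_rel n d `` {f * g | f g. f \<in> X \<and> g \<in> Y}"

text \<open>
  The infimum in \<^typ>\<open>enat\<close> is the minimum when some such \<open>c\<close> exists and \<open>\<infinity>\<close> when none
  does, so an upper bound on it includes nilpotency. The product
  \<open>a\<^sub>1 \<cdots> a\<^sub>c\<close> is that of a nonempty list, as the algebra has no unit.
\<close>

definition nilpotency_degree :: "'a::field itself \<Rightarrow> nat \<Rightarrow> nat \<Rightarrow> enat" where
  "nilpotency_degree _ n d = Inf (enat ` {c. c > 0 \<and>
     (\<forall>as. length as = c \<and> set as \<subseteq> (nil_alg n d :: (nat fword \<Rightarrow>\<^sub>0 'a) set set)
        \<longrightarrow> foldl (nil_mult n d) (hd as) (tl as) = nil_zero n d)})"


lemma free_alg_add: "f \<in> free_alg d \<Longrightarrow> g \<in> free_alg d \<Longrightarrow> f + g \<in> free_alg d"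
  using Poly_Mapping.keys_add[of f g] by (auto simp: free_alg_def)

lemma free_alg_diff: "f \<in> free_alg d \<Longrightarrow> g \<in> free_alg d \<Longrightarrow> f - g \<in> free_alg d"
  using keys_diff[of f g] by (auto simp: free_alg_def)

lemma free_alg_mult:
  assumes "f \<in> free_alg d" "g \<in> free_alg d"
  shows "f * g \<in> free_alg d"
proof -
  have "a + b \<in> free_semigroup d" if "a \<in> Poly_Mapping.keys f" "b \<in> Poly_Mapping.keys g" for a b
    using that assms by (fastforce simp: free_alg_def free_semigroup_def plus_fword_def)
  then show ?thesis
    using keys_mult[of f g] by (fastforce simp: free_alg_def)
qed

lemma free_alg_power:
  assumes "f \<in> free_alg d" "n > 0"
  shows "f ^ n \<in> free_alg d"
  using \<open>n > 0\<close>
proof (induction n rule: nat_induct_non_zero)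
  case (Suc n)
  then show ?case using assms(1) free_alg_mult by simp
qed (use assms(1) in simp)

lemma free_alg_scale:
  assumes "f \<in> free_alg d"
  shows "Poly_Mapping.single 0 c * f \<in> free_alg d"
  using assms keys_mult[of "Poly_Mapping.single 0 c" f]
  by (fastforce simp: free_alg_def split: if_splits)

lemma alg_ideal_free_alg: "alg_ideal (free_alg d) (free_alg d)"
  by (simp add: alg_ideal_def free_alg_add free_alg_mult free_alg_scale)
     (simp add: free_alg_def)

lemma alg_ideal_nil_ideal:
  assumes "n > 0"
  shows "alg_ideal (free_alg d) (nil_ideal n d)"
proof -
  have "\<Inter>{I. alg_ideal (free_alg d) I \<and> {f ^ n | f. f \<in> free_alg d} \<subseteq> I} \<subseteq> free_alg d"
    by (rule Inter_lower) (use assms in \<open>auto simp: alg_ideal_free_alg free_alg_power\<close>)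
  then show ?thesis
    unfolding nil_ideal_def hull_def by (subst alg_ideal_def) (auto simp: alg_ideal_def)
qed

lemma nil_ideal_uminus:
  assumes "n > 0" "f \<in> nil_ideal n d"
  shows "- f \<in> nil_ideal n d"
proof -
  have "Poly_Mapping.single 0 (-1) * f \<in> nil_ideal n d"
    using assms alg_ideal_nil_ideal[of n d] by (auto simp: alg_ideal_def)
  moreover have "Poly_Mapping.single 0 (-1) * f = - f"
    by (simp add: single_uminus)
  ultimately show ?thesis by simp
qed

lemma equiv_nil_rel:
  assumes "n > 0"
  shows "equiv (free_alg d) (nil_rel n d)"
proof (rule equivI)
  note I = alg_ideal_nil_ideal[OF assms, of d, unfolded alg_ideal_def]
  show "nil_rel n d \<subseteq> free_alg d \<times> free_alg d"
    by (auto simp: nil_rel_def)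
  show "refl_on (free_alg d) (nil_rel n d)"
    using I by (auto simp: refl_on_def nil_rel_def)
  show "sym (nil_rel n d)"
    using nil_ideal_uminus[OF assms] by (fastforce simp: sym_def nil_rel_def)
  show "trans (nil_rel n d)"
  proof (rule transI)
    fix f g h assume *: "(f, g) \<in> nil_rel n d" "(g, h) \<in> nil_rel n d"
    then have "f - g \<in> nil_ideal n d" "g - h \<in> nil_ideal n d" by (simp_all add: nil_rel_def)
    then have "(f - g) + (g - h) \<in> nil_ideal n d" using I by blast
    then show "(f, h) \<in> nil_rel n d" using * by (simp add: nil_rel_def)
  qed
qed

lemma nil_mult_class:
  assumes "n > 0" "f \<in> free_alg d" "g \<in> free_alg d"
  shows "nil_mult n d (nil_rel n d `` {f}) (nil_rel n d `` {g}) = nil_rel n d `` {f * g}"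
proof -
  note I = alg_ideal_nil_ideal[OF assms(1), of d, unfolded alg_ideal_def]
  note E = equiv_nil_rel[OF assms(1), of d]
  have *: "nil_rel n d `` {f' * g'} = nil_rel n d `` {f * g}"
    if "(f, f') \<in> nil_rel n d" "(g, g') \<in> nil_rel n d" for f' g'
  proof -
    have "f' \<in> free_alg d" "f - f' \<in> nil_ideal n d" "g - g' \<in> nil_ideal n d"
      using that by (simp_all add: nil_rel_def)
    then have "(f - f') * g \<in> nil_ideal n d" "f' * (g - g') \<in> nil_ideal n d"
      using I assms(3) by blast+
    then have "(f - f') * g + f' * (g - g') \<in> nil_ideal n d" using I by blast
    then have "f * g - f' * g' \<in> nil_ideal n d" by (simp add: algebra_simps)
    then have "(f * g, f' * g') \<in> nil_rel n d"
      using that by (auto simp: nil_rel_def free_alg_mult)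
    then show ?thesis using equiv_class_eq[OF E] by metis
  qed
  have refl: "(f, f) \<in> nil_rel n d" "(g, g) \<in> nil_rel n d"
    using E assms by (auto simp: equiv_def refl_on_def)
  have "nil_mult n d (nil_rel n d `` {f}) (nil_rel n d `` {g})
      = (\<Union>(f', g') \<in> nil_rel n d `` {f} \<times> nil_rel n d `` {g}. nil_rel n d `` {f' * g'})"
    unfolding nil_mult_def by blast
  also have "\<dots> = nil_rel n d `` {f * g}"
    using * refl by fast
  finally show ?thesis .
qed

end

(* If p > k, Higman's argument bounds the nilpotency index of nil algebras of index k by 2^k - 1,
   and if p > 2k, an argument in the style of Razmyslov bounds it by k^2: functions on a symmetric group
   that are killed by all symmetrizers and all antisymmetrizers on k + 1 points vanish when the group
   has degree greater than k^2.

   Fix a letter x and a word that does not vanish modulo x^n = 0. If the word is extremal for the sum of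
   the squares of the lengths of its blocks of x, then the words between the blocks of length i - 1
   satisfy the linearised identity of degree n div i. As n div i <= n/2 < p for i >= 2, Higman's bound
   limits the number of these blocks, hence the number of occurrences of x. Pigeonholing over the d
   letters suffices when n < 42.

   For n >= 42 one has p > 3, and modulo the cubes of O(d^5) elements f the words of length 8 vanish,
   because an algebra of nil index 3 is nilpotent. A long word is therefore a sum of words with many
   factors f^3 for a single f. All blocks of f in such a word have length at least 3, so that only
   the degrees n div i <= n/4 < p/2 matter, and the quadratic bound gives a polynomial estimate. *)

theory Submission
  imports Defs "HOL-Combinatorics.Cycles" "HOL-Combinatorics.Multiset_Permutations" "HOL-Computational_Algebra.Primes"
begin

subsection \<open>Linearised identities and Higman's bound\<close>

text \<open>As \<open>p\<close> may lie below \<open>n\<close>, nothing can be divided by n!. The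
  identity x^n = 0 is therefore split over the infinite field into its multihomogeneous components,
  which keep repeated arguments; integers are inverted only in degrees n div i < p and in degree 3.
  Likewise the symmetric group behind the quadratic bound has degree about k^2, possibly above
  \<open>p\<close>, so its group algebra need not be semisimple. The argument used instead divides
  only by (k + 1)! and by integers at most 2k.

  Functionals on words in the gaps between blocks do not come from homomorphisms of algebras. Hence
  identities are stated for arbitrary functions on words, with values modulo an additive group that
  is closed under division by integers prime to \<open>p\<close>.

  The target equals n (3d + 2)^(log_2 n), which is n^4 for d = 2; Higman's exponential bound stays
  below this only for n < 42. The quadratic bound cannot be used for the letters themselves: for i =
  2, 3 the number 2 (n div i) may reach \<open>p\<close>. Cubes avoid these two degrees at the price
  of a factor of order d^5, which (3d + 2)^(log_2 n) absorbs because n > 32 = 2^5.\<close>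

locale coprime_subgroup =
  fixes I :: "'b::ring_1 set" and p :: nat
  assumes prime_p: "prime p"
    and zero_mem: "0 \<in> I"
    and diff_mem: "a \<in> I \<Longrightarrow> b \<in> I \<Longrightarrow> a - b \<in> I"
    and cancel: "\<not> p dvd q \<Longrightarrow> of_nat q * a \<in> I \<Longrightarrow> a \<in> I"
begin

lemma uminus_mem: "a \<in> I \<Longrightarrow> - a \<in> I"
  using diff_mem[OF zero_mem, of a] by simp

lemma add_mem: "a \<in> I \<Longrightarrow> b \<in> I \<Longrightarrow> a + b \<in> I"
  using diff_mem[of a "- b"] uminus_mem[of b] by simp

lemma sum_mem: "(\<And>x. x \<in> A \<Longrightarrow> f x \<in> I) \<Longrightarrow> sum f A \<in> I"
  by (induction A rule: infinite_finite_induct) (auto simp: zero_mem add_mem)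

lemma add_mem_cancel: "a + b \<in> I \<Longrightarrow> a \<in> I \<Longrightarrow> b \<in> I"
  using diff_mem[of "a + b" a] by simp

text \<open>A function \<open>\<Phi>\<close> on words stands for a linear functional on the free algebra with values modulo \<open>I\<close>.
  It satisfies \<open>sym_identity k\<close> if it kills the ideal generated by the full linearisations of \<open>x\<^sup>k\<close>.\<close>

definition sym_identity :: "nat \<Rightarrow> ('l list \<Rightarrow> 'b) \<Rightarrow> bool" where
  "sym_identity k \<Phi> \<longleftrightarrow> (\<forall>J lab P Q. finite J \<and> card J = k \<and> (\<forall>j\<in>J. lab j \<noteq> []) \<longrightarrow>
     (\<Sum>l\<in>permutations_of_set (J :: nat set). \<Phi> (P @ concat (map lab l) @ Q)) \<in> I)"

text \<open>A nilpotency bound in functional form. Natural numbers suffice as letters because the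
  gaps between blocks are numbered.\<close>

definition annihilates :: "nat \<Rightarrow> nat \<Rightarrow> bool" where
  "annihilates k c \<longleftrightarrow> (\<forall>(\<Phi> :: nat list \<Rightarrow> 'b) u. sym_identity k \<Phi> \<longrightarrow> length u \<ge> c \<longrightarrow> \<Phi> u \<in> I)"

lemma sym_identityD:
  "sym_identity k \<Phi> \<Longrightarrow> finite J \<Longrightarrow> card J = k \<Longrightarrow> (\<And>j. j \<in> J \<Longrightarrow> lab j \<noteq> []) \<Longrightarrow>
    (\<Sum>l\<in>permutations_of_set (J :: nat set). \<Phi> (P @ concat (map lab l) @ Q)) \<in> I"
  by (simp add: sym_identity_def)

end

lemma sum_swap_inner:
  "(\<Sum>i\<in>C. \<Sum>l\<in>A. \<Sum>l'\<in>B. f i l l') = (\<Sum>l\<in>A. \<Sum>l'\<in>B. \<Sum>i\<in>C. f i l l')"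
proof -
  have "(\<Sum>i\<in>C. \<Sum>l\<in>A. \<Sum>l'\<in>B. f i l l') = (\<Sum>l\<in>A. \<Sum>i\<in>C. \<Sum>l'\<in>B. f i l l')"
    by (rule sum.swap)
  also have "\<dots> = (\<Sum>l\<in>A. \<Sum>l'\<in>B. \<Sum>i\<in>C. f i l l')"
    by (intro sum.cong refl sum.swap)
  finally show ?thesis .
qed

text \<open>An ordering of \<open>insert u J\<close> is an ordering of \<open>J\<close> together
  with the position of \<open>u\<close>.\<close>

lemma sum_permutations_of_set_insert:
  assumes "finite J" "u \<notin> J"
  shows "(\<Sum>l\<in>permutations_of_set (insert u J). f l)
       = (\<Sum>l\<in>permutations_of_set J. \<Sum>i\<le>card J. f (take i l @ u # drop i l))"
proof -
  have "(\<Sum>l\<in>permutations_of_set J. \<Sum>i\<le>card J. f (take i l @ u # drop i l))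
      = (\<Sum>(l, i)\<in>permutations_of_set J \<times> {..card J}. f (take i l @ u # drop i l))"
    by (simp add: sum.cartesian_product)
  also have "\<dots> = (\<Sum>l\<in>permutations_of_set (insert u J). f l)"
  proof (rule sum.reindex_bij_witness[where
        j = "\<lambda>(l, i). take i l @ u # drop i l" and
        i = "\<lambda>l. (remove1 u l, length (takeWhile (\<lambda>y. y \<noteq> u) l))"])
    fix a assume "a \<in> permutations_of_set J \<times> {..card J}"
    then obtain l i where a: "a = (l, i)" "set l = J" "distinct l" "i \<le> card J"
      by (auto dest: permutations_of_setD)
    then have len: "length l = card J" using distinct_card by metis
    have u: "u \<notin> set (take i l)" "u \<notin> set (drop i l)"
      using a assms set_take_subset[of i l] set_drop_subset[of i l] by auto
    have "set (take i l) \<inter> set (drop i l) = {}"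
      using a(3) by (metis append_take_drop_id distinct_append)
    moreover have "set (take i l) \<union> set (drop i l) = J"
      using a(2) by (metis append_take_drop_id set_append)
    ultimately show "(case a of (l, i) \<Rightarrow> take i l @ u # drop i l) \<in> permutations_of_set (insert u J)"
      using a(1,3) u by (auto intro!: permutations_of_setI)
    have "takeWhile (\<lambda>y. y \<noteq> u) (take i l @ u # drop i l) = take i l"
      using u by (subst takeWhile_append2) auto
    then show "(remove1 u (case a of (l, i) \<Rightarrow> take i l @ u # drop i l),
        length (takeWhile (\<lambda>y. y \<noteq> u) (case a of (l, i) \<Rightarrow> take i l @ u # drop i l))) = a"
      using a u len by (simp add: remove1_append)
  next
    fix l assume "l \<in> permutations_of_set (insert u J)"
    then have l: "set l = insert u J" "distinct l" by (auto dest: permutations_of_setD)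
    obtain xs ys where xy: "l = xs @ u # ys" using split_list[of u l] l(1) by blast
    have u: "u \<notin> set xs" "u \<notin> set ys" and d: "distinct (xs @ ys)" using l xy by auto
    have tw: "takeWhile (\<lambda>y. y \<noteq> u) l = xs" unfolding xy
      using u by (subst takeWhile_append2) auto
    have rm: "remove1 u l = xs @ ys" using xy u by (simp add: remove1_append)
    have J: "set (xs @ ys) = J" using l u assms unfolding xy by auto
    then have "length (xs @ ys) = card J" using d distinct_card by metis
    then show "(remove1 u l, length (takeWhile (\<lambda>y. y \<noteq> u) l)) \<in> permutations_of_set J \<times> {..card J}"
      using J d by (auto simp: rm tw intro!: permutations_of_setI)
    show "(case (remove1 u l, length (takeWhile (\<lambda>y. y \<noteq> u) l)) of (l, i) \<Rightarrow> take i l @ u # drop i l) = l"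
      by (simp add: rm tw) (simp add: xy)
  qed auto
  finally show ?thesis by simp
qed

context coprime_subgroup
begin

text \<open>Degree \<open>k + 1\<close> with one argument singled out: the others run through all
  orders and \<open>v\<close> through all gaps between them. Higman's identity is derived from this
  form.\<close>

lemma sym_identity_insert:
  assumes "sym_identity (Suc k) \<Phi>" "finite J" "card J = k" "\<And>j. j \<in> J \<Longrightarrow> lab j \<noteq> []" "v \<noteq> []"
  shows "(\<Sum>l\<in>permutations_of_set (J :: nat set). \<Sum>i\<le>k.
           \<Phi> (P @ concat (map lab (take i l)) @ v @ concat (map lab (drop i l)) @ Q)) \<in> I"
proof -
  obtain u where u: "u \<notin> J" using ex_new_if_finite[OF infinite_UNIV_nat assms(2)] by auto
  have "(\<Sum>l\<in>permutations_of_set (insert u J). \<Phi> (P @ concat (map (lab(u := v)) l) @ Q)) \<in> I"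
    by (rule sym_identityD[OF assms(1)]) (use assms u in auto)
  also have "(\<Sum>l\<in>permutations_of_set (insert u J). \<Phi> (P @ concat (map (lab(u := v)) l) @ Q))
    = (\<Sum>l\<in>permutations_of_set J. \<Sum>i\<le>k.
           \<Phi> (P @ concat (map lab (take i l)) @ v @ concat (map lab (drop i l)) @ Q))"
  proof (subst sum_permutations_of_set_insert[OF assms(2) u], unfold assms(3), intro sum.cong refl)
    fix l i assume l: "l \<in> permutations_of_set J"
    then have "u \<notin> set (take i l)" "u \<notin> set (drop i l)"
      using u set_take_subset[of i l] set_drop_subset[of i l] by (auto dest: permutations_of_setD)
    then show "\<Phi> (P @ concat (map (lab(u := v)) (take i l @ u # drop i l)) @ Q) =
      \<Phi> (P @ concat (map lab (take i l)) @ v @ concat (map lab (drop i l)) @ Q)" by simp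
  qed
  finally show ?thesis .
qed

text \<open>Linearised form of Higman's identity \<open>k x\<^sup>k\<^sup>-\<^sup>1 z y\<^sup>k\<^sup>-\<^sup>1 = 0\<close>: sum \<open>x\<^sup>i z y\<^sup>j x\<^sup>k\<^sup>-\<^sup>1\<^sup>-\<^sup>i y\<^sup>k\<^sup>-\<^sup>1\<^sup>-\<^sup>j\<close>
  first over \<open>i\<close> and then over \<open>j\<close>.\<close>

lemma higman_gap:
  assumes H: "sym_identity (Suc k) \<Phi>" and k: "Suc k < p"
    and J: "finite J" "card J = k" "\<And>j. j \<in> J \<Longrightarrow> lab j \<noteq> []"
    and J': "finite J'" "card J' = k" "\<And>j. j \<in> J' \<Longrightarrow> lab' j \<noteq> []"
    and z: "z \<noteq> []"
  shows "(\<Sum>l\<in>permutations_of_set (J :: nat set). \<Sum>l'\<in>permutations_of_set (J' :: nat set).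
           \<Phi> (P @ concat (map lab l) @ z @ concat (map lab' l') @ Q)) \<in> I" (is "?S \<in> I")
proof -
  define D where "D i j = (\<Sum>l\<in>permutations_of_set J. \<Sum>l'\<in>permutations_of_set J'.
     \<Phi> (P @ concat (map lab (take i l)) @ (z @ concat (map lab' (take j l'))) @
          concat (map lab (drop i l)) @ concat (map lab' (drop j l')) @ Q))" for i j
  have len: "length l = k" if "l \<in> permutations_of_set J" for l
    using that J length_finite_permutations_of_set by metis
  have len': "length l = k" if "l \<in> permutations_of_set J'" for l
    using that J' length_finite_permutations_of_set by metis
  have 1: "(\<Sum>i\<le>k. D i j) \<in> I" for j
  proof -
    have "(\<Sum>i\<le>k. D i j) = (\<Sum>l'\<in>permutations_of_set J'. \<Sum>l\<in>permutations_of_set J. \<Sum>i\<le>k.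
     \<Phi> (P @ concat (map lab (take i l)) @ (z @ concat (map lab' (take j l'))) @
          concat (map lab (drop i l)) @ (concat (map lab' (drop j l')) @ Q)))"
      unfolding D_def sum_swap_inner[where C = "{..k}"] by (simp add: sum.swap[of _ "permutations_of_set J'"])
    also have "\<dots> \<in> I"
      by (rule sum_mem, rule sym_identity_insert[OF H J]) (use z in auto)
    finally show ?thesis .
  qed
  have 2: "(\<Sum>j\<le>k. D i j) \<in> I" if "i < k" for i
  proof -
    have "(\<Sum>j\<le>k. D i j) = (\<Sum>l\<in>permutations_of_set J. \<Sum>l'\<in>permutations_of_set J'. \<Sum>j\<le>k.
     \<Phi> ((P @ concat (map lab (take i l)) @ z) @ concat (map lab' (take j l')) @
          concat (map lab (drop i l)) @ concat (map lab' (drop j l')) @ Q))"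
      unfolding D_def sum_swap_inner[where C = "{..k}"] by simp
    also have "\<dots> \<in> I"
    proof (rule sum_mem, rule sym_identity_insert[OF H J'])
      fix l assume l: "l \<in> permutations_of_set J"
      then have "lab (l ! i) \<noteq> []" "drop i l = l ! i # drop (Suc i) l"
        using J(3) len[OF l] that by (auto simp: Cons_nth_drop_Suc dest: permutations_of_setD intro!: J(3))
      then show "concat (map lab (drop i l)) \<noteq> []" by simp
    qed auto
    finally show ?thesis .
  qed
  have "D k j = ?S" if "j \<le> k" for j
    unfolding D_def
  proof (intro sum.cong refl)
    fix l l' assume l: "l \<in> permutations_of_set J" "l' \<in> permutations_of_set J'"
    have "concat (map lab' l') = concat (map lab' (take j l')) @ concat (map lab' (drop j l'))"
      by (metis append_take_drop_id concat_append map_append)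
    then show "\<Phi> (P @ concat (map lab (take k l)) @ (z @ concat (map lab' (take j l'))) @
          concat (map lab (drop k l)) @ concat (map lab' (drop j l')) @ Q) =
          \<Phi> (P @ concat (map lab l) @ z @ concat (map lab' l') @ Q)"
      using len[OF l(1)] by simp
  qed
  then have "of_nat (Suc k) * ?S = (\<Sum>j\<le>k. D k j)" by simp
  also have "\<dots> \<in> I"
  proof -
    have "(\<Sum>j\<le>k. \<Sum>i\<le>k. D i j) \<in> I" by (rule sum_mem) (rule 1)
    also have "(\<Sum>j\<le>k. \<Sum>i\<le>k. D i j) = (\<Sum>i<k. \<Sum>j\<le>k. D i j) + (\<Sum>j\<le>k. D k j)"
      by (subst sum.swap) (simp add: lessThan_Suc_atMost[symmetric] del: sum.lessThan_Suc, simp)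
    finally show ?thesis
      using add_mem_cancel sum_mem[of "{..<k}" "\<lambda>i. \<Sum>j\<le>k. D i j"] 2 by auto
  qed
  finally show ?thesis
    using cancel[of "Suc k" ?S] k by (metis Suc_neq_Zero dvd_imp_le leD not_gr_zero)
qed

text \<open>A word of length at least 2c + 1 is cut into two parts of length at least c around a
  letter z. By \<open>higman_gap\<close> the symmetrised right part, as a function of the left part,
  satisfies the identity of degree k and so vanishes; hence the function of the right part satisfies
  it as well. The recursion c -> 2c + 1 gives \<open>2 ^ k - 1\<close>.\<close>

theorem higman:
  fixes \<Phi> :: "'l list \<Rightarrow> 'b"
  assumes "k < p" "sym_identity k \<Phi>" "length u \<ge> 2 ^ k - 1"
  shows "\<Phi> u \<in> I"
  using assms
proof (induction k arbitrary: \<Phi> u)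
  case 0
  \<comment> \<open>In degree 0 there is only the empty ordering, so the identity itself says that
    the function vanishes.\<close>
  have "(\<Sum>l\<in>permutations_of_set ({} :: nat set). \<Phi> (u @ concat (map (\<lambda>_. []) l) @ [])) \<in> I"
    by (rule sym_identityD[OF 0(2)]) auto
  then show ?case by simp
next
  case (Suc k)
  define c where "c = (2::nat) ^ k - 1"
  have "length u \<ge> Suc (c + c)" 

  proof -
    have "1 \<le> (2::nat) ^ k" by simp
    then show ?thesis using Suc.prems(3) unfolding c_def power_Suc by linarith
  qed
  then have "length (drop c u) > c" by simp
  then obtain z v where zv: "drop c u = z # v" "length v \<ge> c" by (cases "drop c u") auto
  then have u: "u = take c u @ [z] @ v" by (metis append_Cons append_Nil append_take_drop_id)
  have len: "length (take c u) \<ge> c" using \<open>length (drop c u) > c\<close> by simp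
  have k: "k < p" using Suc.prems by simp
  have left: "sym_identity k (\<lambda>w. \<Sum>l'\<in>permutations_of_set J'. \<Phi> (w @ z # P' @ concat (map lab' l') @ Q'))"
    if J': "finite J'" "card J' = k" "\<And>j. j \<in> J' \<Longrightarrow> lab' j \<noteq> []" for J' :: "nat set" and lab' and P' Q' :: "'l list"
    unfolding sym_identity_def
  proof (intro allI impI, elim conjE)
    fix J :: "nat set" and lab :: "nat \<Rightarrow> 'l list" and P Q :: "'l list"
    assume J: "finite J" "card J = k" "\<forall>j\<in>J. lab j \<noteq> []"
    have "(\<Sum>l\<in>permutations_of_set J. \<Sum>l'\<in>permutations_of_set J'.
           \<Phi> (P @ concat (map lab l) @ (Q @ z # P') @ concat (map lab' l') @ Q')) \<in> I"
      by (rule higman_gap[OF Suc.prems(2,1)]) (use J J' in auto)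
    then show "(\<Sum>l\<in>permutations_of_set J. \<Sum>l'\<in>permutations_of_set J'.
         \<Phi> ((P @ concat (map lab l) @ Q) @ z # P' @ concat (map lab' l') @ Q')) \<in> I" by simp
  qed
  have "sym_identity k (\<lambda>w. \<Phi> (take c u @ z # w))"
    unfolding sym_identity_def
  proof (intro allI impI, elim conjE)
    fix J :: "nat set" and lab :: "nat \<Rightarrow> 'l list" and P Q :: "'l list"
    assume J: "finite J" "card J = k" "\<forall>j\<in>J. lab j \<noteq> []"
    show "(\<Sum>l\<in>permutations_of_set J. \<Phi> (take c u @ z # P @ concat (map lab l) @ Q)) \<in> I"
      using Suc.IH[OF k left[of J lab P Q], of "take c u"] J len by (auto simp: c_def)
  qed
  from Suc.IH[OF k this, of v] zv show ?case by (subst u) (simp add: c_def)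
qed

corollary annihilates_higman: "k < p \<Longrightarrow> annihilates k (2 ^ k - 1)"
  using higman by (auto simp: annihilates_def)

end

subsection \<open>Functions killed by symmetrizers and antisymmetrizers\<close>

text \<open>Inversion moves the transposition of the coset decomposition from the left to the
  right.\<close>

lemma sum_permutes_insert_right:
  assumes "finite X" "b \<notin> X"
  shows "(\<Sum>\<sigma> | \<sigma> permutes insert b X. f \<sigma>)
       = (\<Sum>c\<in>insert b X. \<Sum>q | q permutes X. f (q \<circ> transpose b c))"
proof -
  have "(\<Sum>\<sigma> | \<sigma> permutes insert b X. f \<sigma>) = (\<Sum>\<sigma> | \<sigma> permutes insert b X. f (inv \<sigma>))"
    by (rule sum_permutations_inverse)
  also have "\<dots> = (\<Sum>c\<in>insert b X. \<Sum>q | q permutes X. f (inv (transpose b c \<circ> q)))"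
    by (rule sum_over_permutations_insert[OF assms])
  also have "\<dots> = (\<Sum>c\<in>insert b X. \<Sum>q | q permutes X. f (inv q \<circ> transpose b c))"
  proof (intro sum.cong refl)
    fix c q assume "q \<in> {q. q permutes X}"
    then have "bij q" by (auto intro: permutes_bij)
    then show "f (inv (transpose b c \<circ> q)) = f (inv q \<circ> transpose b c)"
      by (simp add: o_inv_distrib)
  qed
  also have "\<dots> = (\<Sum>c\<in>insert b X. \<Sum>q | q permutes X. f (q \<circ> transpose b c))"
    by (intro sum.cong[OF refl] sum_permutations_inverse[symmetric])
  finally show ?thesis .
qed

lemma permutes_conjugate:
  fixes \<rho> :: "'a \<Rightarrow> 'a"
  assumes "bij \<rho>" "\<sigma> permutes X"
  shows "\<rho> \<circ> \<sigma> \<circ> inv \<rho> permutes \<rho> ` X"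
proof -
  have "bij (\<rho> \<circ> \<sigma> \<circ> inv \<rho>)" using assms permutes_bij[OF assms(2)] by (intro bij_comp bij_imp_bij_inv)
  moreover have "(\<rho> \<circ> \<sigma> \<circ> inv \<rho>) x = x" if "x \<notin> \<rho> ` X" for x
  proof -
    have "inv \<rho> x \<notin> X" using that assms(1) by (metis bij_inv_eq_iff image_eqI)
    then show ?thesis using assms by (simp add: permutes_not_in bij_is_surj surj_f_inv_f)
  qed
  ultimately show ?thesis by (simp add: permutes_def bij_iff)
qed

lemma sum_permutes_conjugate:
  fixes \<rho> :: "'a \<Rightarrow> 'a"
  assumes "bij \<rho>"
  shows "(\<Sum>\<sigma> | \<sigma> permutes X. f (\<rho> \<circ> \<sigma>)) = (\<Sum>\<sigma> | \<sigma> permutes \<rho> ` X. f (\<sigma> \<circ> \<rho>))"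
proof (rule sum.reindex_bij_witness[where i = "\<lambda>\<sigma>. inv \<rho> \<circ> \<sigma> \<circ> \<rho>" and j = "\<lambda>\<sigma>. \<rho> \<circ> \<sigma> \<circ> inv \<rho>"])
  have r: "\<rho> \<circ> inv \<rho> = id" "inv \<rho> \<circ> \<rho> = id"
    using assms by (auto simp: bij_is_surj surj_iff[symmetric] bij_is_inj inj_iff[symmetric])
  fix \<sigma>
  show "inv \<rho> \<circ> (\<rho> \<circ> \<sigma> \<circ> inv \<rho>) \<circ> \<rho> = \<sigma>" "\<rho> \<circ> (inv \<rho> \<circ> \<sigma> \<circ> \<rho>) \<circ> inv \<rho> = \<sigma>"
    using assms by (auto simp: fun_eq_iff bij_is_inj bij_is_surj surj_f_inv_f)
  show "f (\<rho> \<circ> \<sigma> \<circ> inv \<rho> \<circ> \<rho>) = f (\<rho> \<circ> \<sigma>)"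
    using r by (simp add: comp_assoc)
next
  fix \<sigma> assume "\<sigma> \<in> {\<sigma>. \<sigma> permutes X}"
  then show "\<rho> \<circ> \<sigma> \<circ> inv \<rho> \<in> {\<sigma>. \<sigma> permutes \<rho> ` X}" using assms permutes_conjugate by auto
next
  fix \<sigma> assume "\<sigma> \<in> {\<sigma>. \<sigma> permutes \<rho> ` X}"
  then have "inv \<rho> \<circ> \<sigma> \<circ> inv (inv \<rho>) permutes inv \<rho> ` \<rho> ` X"
    using assms by (intro permutes_conjugate bij_imp_bij_inv) auto
  then show "inv \<rho> \<circ> \<sigma> \<circ> \<rho> \<in> {\<sigma>. \<sigma> permutes X}"
    using assms by (simp add: inv_inv_eq image_comp bij_is_inj)
qed

lemma sign_conjugate:
  assumes "\<rho> permutes S" "\<sigma> permutes S" "finite S"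
  shows "sign (\<rho> \<circ> \<sigma> \<circ> inv \<rho>) = sign \<sigma>"
proof -
  have "permutation \<rho>" "permutation \<sigma>" "permutation (inv \<rho>)"
    using assms permutes_imp_permutation permutes_inv by blast+
  then have "sign (\<rho> \<circ> \<sigma> \<circ> inv \<rho>) = sign \<sigma> * (sign \<rho> * sign \<rho>)"
    by (simp add: sign_compose sign_inverse permutation_compose)
  then show ?thesis by simp
qed

text \<open>The Young subgroup of the partition of \<open>S\<close> into the fibres of
  \<open>\<beta>\<close>.\<close>

definition colour_perms :: "'a set \<Rightarrow> ('a \<Rightarrow> 'c) \<Rightarrow> ('a \<Rightarrow> 'a) set" where
  "colour_perms S \<beta> = {g. g permutes S \<and> \<beta> \<circ> g = \<beta>}"

lemma colour_perms_comp:
  "g \<in> colour_perms S \<beta> \<Longrightarrow> h \<in> colour_perms S \<beta> \<Longrightarrow> g \<circ> h \<in> colour_perms S \<beta>"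
  by (auto simp: colour_perms_def permutes_compose comp_assoc[symmetric])

lemma colour_perms_inv:
  assumes "g \<in> colour_perms S \<beta>"
  shows "inv g \<in> colour_perms S \<beta>"
proof -
  have "\<beta> \<circ> inv g = (\<beta> \<circ> g) \<circ> inv g" using assms by (simp add: colour_perms_def)
  also have "\<dots> = \<beta> \<circ> (g \<circ> inv g)" by (simp add: comp_assoc)
  also have "g \<circ> inv g = id" using assms by (auto simp: colour_perms_def permutes_inv_o(1))
  finally have "\<beta> \<circ> inv g = \<beta>" by (simp only: comp_id)
  then show ?thesis using assms unfolding colour_perms_def by (simp only: mem_Collect_eq permutes_inv simp_thms)
qed

lemma transpose_colour_perms:
  "x \<in> S \<Longrightarrow> y \<in> S \<Longrightarrow> \<beta> x = \<beta> y \<Longrightarrow> transpose x y \<in> colour_perms S \<beta>"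
  by (auto simp: colour_perms_def permutes_swap_id transpose_def fun_eq_iff)

lemma permutes_colour_perms:
  assumes "\<sigma> permutes X" "X \<subseteq> S" "\<And>x. x \<in> X \<Longrightarrow> \<beta> x = c"
  shows "\<sigma> \<in> colour_perms S \<beta>"
proof -
  have "\<beta> (\<sigma> x) = \<beta> x" for x
    using assms by (cases "x \<in> X") (auto simp: permutes_in_image permutes_not_in)
  then show ?thesis using assms by (auto simp: colour_perms_def permutes_subset)
qed

lemma sum_colour_perms_absorb:
  assumes "t \<in> colour_perms S \<beta>"
  shows "(\<Sum>g\<in>colour_perms S \<beta>. f (t \<circ> g)) = (\<Sum>g\<in>colour_perms S \<beta>. f g)"
proof (rule sum.reindex_bij_witness[where i = "\<lambda>g. inv t \<circ> g" and j = "\<lambda>g. t \<circ> g"])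
  have t: "t \<circ> inv t = id" "inv t \<circ> t = id"
    using assms by (auto simp: colour_perms_def permutes_inv_o)
  fix g
  show "inv t \<circ> (t \<circ> g) = g" "t \<circ> (inv t \<circ> g) = g"
    using t by (metis comp_assoc id_comp)+
qed (auto intro!: colour_perms_comp colour_perms_inv assms)

text \<open>The coset identity behind the Pieri rule: moving \<open>x\<close> into the colour class of \<open>b\<^sub>0\<close>.\<close>

lemma sum_colour_perms_recolour:
  fixes \<beta> :: "'a \<Rightarrow> 'c"
  assumes S: "x \<in> S" "b\<^sub>0 \<in> S" "\<beta> x \<noteq> \<beta> b\<^sub>0"
  defines "B \<equiv> {b \<in> S. \<beta> b = \<beta> b\<^sub>0}" and "C \<equiv> {c \<in> S. \<beta> c = \<beta> x}"
  shows "(\<Sum>b\<in>insert x B. \<Sum>g\<in>colour_perms S \<beta>. f (transpose x b \<circ> g))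
       = (\<Sum>c\<in>C. \<Sum>h\<in>colour_perms S (\<beta>(x := \<beta> b\<^sub>0)). f (h \<circ> transpose x c))"
proof -
  let ?G = "colour_perms S \<beta>" and ?G' = "colour_perms S (\<beta>(x := \<beta> b\<^sub>0))"
  have tt: "transpose u v \<circ> (transpose u v \<circ> h) = h" "h \<circ> transpose u v \<circ> transpose u v = h"
    for u v :: 'a and h :: "'a \<Rightarrow> 'a"
    by (simp_all add: fun_eq_iff)
  have fix_iff: "g \<in> ?G \<longleftrightarrow> g \<in> ?G'" if "g x = x" "g permutes S" for g
  proof -
    have "g y \<noteq> x" if "y \<noteq> x" for y
      using \<open>g x = x\<close> \<open>g permutes S\<close> that by (metis permutes_inverses(2))
    then have "(\<beta> \<circ> g = \<beta>) = (\<beta>(x := \<beta> b\<^sub>0) \<circ> g = \<beta>(x := \<beta> b\<^sub>0))"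
      using that(1) unfolding fun_eq_iff o_def fun_upd_apply by metis
    then show ?thesis using that(2) by (simp add: colour_perms_def)
  qed
  have "(\<Sum>(b, g)\<in>insert x B \<times> ?G. f (transpose x b \<circ> g)) = (\<Sum>(c, h)\<in>C \<times> ?G'. f (h \<circ> transpose x c))"
  proof (rule sum.reindex_bij_witness[where
        j = "\<lambda>(b, g). (inv g x, transpose x b \<circ> g \<circ> transpose x (inv g x))" and
        i = "\<lambda>(c, h). (h x, transpose x (h x) \<circ> h \<circ> transpose x c)"])
    fix a assume "a \<in> insert x B \<times> ?G"
    then obtain b g where a: "a = (b, g)" "b \<in> insert x B" "g \<in> ?G" by auto
    then have g: "g permutes S" by (simp add: colour_perms_def)
    define c where "c = inv g x"
    have gc: "g c = x" using g by (simp add: c_def permutes_inverses)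
    have c: "c \<in> C"
      using colour_perms_inv[OF a(3)] S(1) unfolding C_def c_def colour_perms_def
      by (auto simp: permutes_in_image fun_eq_iff)
    have bS: "b \<in> S" using a(2) S by (auto simp: B_def)
    let ?g0 = "g \<circ> transpose x c"
    have "?g0 \<in> ?G" using a(3) c S(1) by (intro colour_perms_comp transpose_colour_perms) (auto simp: C_def)
    moreover have "?g0 permutes S" using calculation by (simp add: colour_perms_def)
    moreover have "?g0 x = x" by (simp add: gc)
    ultimately have "?g0 \<in> ?G'" using fix_iff by blast
    moreover have "transpose x b \<in> ?G'"
      using a(2) S bS by (intro transpose_colour_perms) (auto simp: B_def)
    ultimately have h: "transpose x b \<circ> g \<circ> transpose x c \<in> ?G'"
      using colour_perms_comp by (metis comp_assoc)
    show "(case a of (b, g) \<Rightarrow> (inv g x, transpose x b \<circ> g \<circ> transpose x (inv g x))) \<in> C \<times> ?G'"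
      using a c h by (simp add: c_def)
    show "(case case a of (b, g) \<Rightarrow> (inv g x, transpose x b \<circ> g \<circ> transpose x (inv g x)) of
         (c, h) \<Rightarrow> (h x, transpose x (h x) \<circ> h \<circ> transpose x c)) = a"
      using gc unfolding a(1) c_def[symmetric] by (simp add: c_def[symmetric] fun_eq_iff)
    show "(case case a of (b, g) \<Rightarrow> (inv g x, transpose x b \<circ> g \<circ> transpose x (inv g x)) of
         (c, h) \<Rightarrow> f (h \<circ> transpose x c)) = (case a of (b, g) \<Rightarrow> f (transpose x b \<circ> g))"
      unfolding a(1) by (simp add: tt)
  next
    fix a assume "a \<in> C \<times> ?G'"
    then obtain c h where a: "a = (c, h)" "c \<in> C" "h \<in> ?G'" by auto
    have h: "h permutes S" "(\<beta>(x := \<beta> b\<^sub>0)) (h x) = \<beta> b\<^sub>0"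
      using a(3) unfolding colour_perms_def by (auto simp: fun_eq_iff)
    define b where "b = h x"
    have b: "b \<in> insert x B" "b \<in> S"
      using h S(1) by (auto simp: b_def B_def permutes_in_image split: if_splits)
    let ?g0 = "transpose x b \<circ> h"
    have "transpose x b \<in> ?G'"
      using b S by (intro transpose_colour_perms) (auto simp: B_def)
    then have "?g0 \<in> ?G'" using a(3) by (intro colour_perms_comp)
    moreover have "?g0 permutes S" using calculation by (simp add: colour_perms_def)
    moreover have "?g0 x = x" by (simp add: b_def)
    ultimately have g0: "?g0 \<in> ?G" using fix_iff by blast
    have g: "?g0 \<circ> transpose x c \<in> ?G"
      by (rule colour_perms_comp[OF g0 transpose_colour_perms]) (use a(2) S(1) in \<open>auto simp: C_def\<close>)
    then have gp: "?g0 \<circ> transpose x c permutes S" by (simp add: colour_perms_def)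
    have "(?g0 \<circ> transpose x c) c = x" by (simp add: b_def)
    then have inv: "inv (?g0 \<circ> transpose x c) x = c" using gp by (metis permutes_inverses(2))
    show "(case a of (c, h) \<Rightarrow> (h x, transpose x (h x) \<circ> h \<circ> transpose x c)) \<in> insert x B \<times> ?G"
      using a b g by (simp add: b_def)
    show "(case case a of (c, h) \<Rightarrow> (h x, transpose x (h x) \<circ> h \<circ> transpose x c) of
         (b, g) \<Rightarrow> (inv g x, transpose x b \<circ> g \<circ> transpose x (inv g x))) = a"
      using inv unfolding a(1) by (simp add: b_def[symmetric] fun_eq_iff)
  qed
  then show ?thesis by (simp add: sum.cartesian_product)
qed

text \<open>The sum of the squares of the class sizes, a numerical substitute for the dominance
  order on shapes.\<close>

definition colour_pairs :: "'a set \<Rightarrow> ('a \<Rightarrow> 'c) \<Rightarrow> nat" where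
  "colour_pairs S \<beta> = card {(x, y). x \<in> S \<and> y \<in> S \<and> \<beta> x = \<beta> y}"

lemma colour_pairs_le:
  assumes "finite S"
  shows "colour_pairs S \<beta> \<le> (card S)\<^sup>2"
proof -
  have "{(x, y). x \<in> S \<and> y \<in> S \<and> \<beta> x = \<beta> y} \<subseteq> S \<times> S" by auto
  then have "colour_pairs S \<beta> \<le> card (S \<times> S)"
    unfolding colour_pairs_def using assms by (intro card_mono) auto
  then show ?thesis by (simp add: power2_eq_square card_cartesian_product)
qed

lemma colour_pairs_split:
  assumes "finite S" "x \<in> S"
  shows "colour_pairs S \<beta> = colour_pairs (S - {x}) \<beta> + 2 * card {y \<in> S - {x}. \<beta> y = \<beta> x} + 1"
proof -
  let ?A = "{y \<in> S - {x}. \<beta> y = \<beta> x}"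
  have f: "finite {(u, v). u \<in> T \<and> v \<in> T \<and> \<beta> u = \<beta> v}" if "finite T" for T
    by (rule finite_subset[of _ "T \<times> T"]) (use that in auto)
  have eq: "{(u, v). u \<in> S \<and> v \<in> S \<and> \<beta> u = \<beta> v}
      = {(u, v). u \<in> S - {x} \<and> v \<in> S - {x} \<and> \<beta> u = \<beta> v} \<union> (Pair x ` ?A \<union> ((\<lambda>y. (y, x)) ` ?A \<union> {(x, x)}))"
    using assms(2) by force
  have fA: "finite ?A" using assms(1) by simp
  have 1: "card ((\<lambda>y. (y, x)) ` ?A \<union> {(x, x)}) = card ((\<lambda>y. (y, x)) ` ?A) + 1"
    using fA by (subst card_Un_disjoint) auto
  have 2: "card (Pair x ` ?A \<union> ((\<lambda>y. (y, x)) ` ?A \<union> {(x, x)})) = card (Pair x ` ?A) + (card ((\<lambda>y. (y, x)) ` ?A) + 1)"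
    using fA by (subst card_Un_disjoint) (auto simp: 1[simplified])
  have "colour_pairs S \<beta> = colour_pairs (S - {x}) \<beta> + (card (Pair x ` ?A) + (card ((\<lambda>y. (y, x)) ` ?A) + 1))"
    unfolding colour_pairs_def eq 2[symmetric]
    by (rule card_Un_disjoint) (use assms(1) f[of "S - {x}"] in auto)
  then show ?thesis by (simp add: card_image inj_on_def)
qed

text \<open>Moving a point from a class of size a to one of size b \<ge> a changes a^2 + b^2 by 2 (b
  - a) + 2.\<close>

lemma colour_pairs_recolour:
  assumes "finite S" "x \<in> S" "\<beta> x \<noteq> d" "card {y \<in> S. \<beta> y = \<beta> x} \<le> card {y \<in> S. \<beta> y = d}"
  shows "colour_pairs S \<beta> < colour_pairs S (\<beta>(x := d))"
proof -
  have "colour_pairs (S - {x}) (\<beta>(x := d)) = colour_pairs (S - {x}) \<beta>"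
    unfolding colour_pairs_def by (intro arg_cong[of _ _ card]) auto
  moreover have "{y \<in> S - {x}. (\<beta>(x := d)) y = (\<beta>(x := d)) x} = {y \<in> S. \<beta> y = d}"
    using assms(3) by auto
  moreover have "{y \<in> S. \<beta> y = \<beta> x} = insert x {y \<in> S - {x}. \<beta> y = \<beta> x}" using assms(2) by auto
  then have "card {y \<in> S. \<beta> y = \<beta> x} = Suc (card {y \<in> S - {x}. \<beta> y = \<beta> x})"
    using assms(1) by simp
  ultimately show ?thesis
    using assms(4) colour_pairs_split[OF assms(1,2), of \<beta>] colour_pairs_split[OF assms(1,2), of "\<beta>(x := d)"]
    by simp
qed


text \<open>Both hypotheses have the group of \<open>X\<close> on the outer left. Conjugation
  extends them to two-sided translates in \<open>sym'\<close> and \<open>alt'\<close>: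
  \<open>\<rho>\<close> followed by the group of its image of \<open>X\<close> is the group of
  \<open>X\<close> followed by \<open>\<rho>\<close>.\<close>

locale symmetrizer_function = coprime_subgroup I p for I :: "'b::ring_1 set" and p :: nat +
  fixes S :: "'a set" and \<phi> :: "('a \<Rightarrow> 'a) \<Rightarrow> 'b" and k :: nat
  assumes finite_S: "finite S"
    and large: "2 * k < p"
    and sym: "X \<subseteq> S \<Longrightarrow> card X = Suc k \<Longrightarrow> \<pi> permutes S \<Longrightarrow>
          (\<Sum>\<sigma> | \<sigma> permutes X. \<phi> (\<sigma> \<circ> \<pi>)) \<in> I"
    and alt: "X \<subseteq> S \<Longrightarrow> card X = Suc k \<Longrightarrow> \<pi> permutes S \<Longrightarrow>
          (\<Sum>\<sigma> | \<sigma> permutes X. of_int (sign \<sigma>) * \<phi> (\<sigma> \<circ> \<pi>)) \<in> I"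
begin

lemma sym':
  assumes "X \<subseteq> S" "card X = Suc k" "\<pi> permutes S" "\<rho> permutes S"
  shows "(\<Sum>\<sigma> | \<sigma> permutes X. \<phi> (\<rho> \<circ> \<sigma> \<circ> \<pi>)) \<in> I"
proof -
  have "(\<Sum>\<sigma> | \<sigma> permutes X. \<phi> (\<rho> \<circ> \<sigma> \<circ> \<pi>)) = (\<Sum>\<sigma> | \<sigma> permutes \<rho> ` X. \<phi> (\<sigma> \<circ> \<rho> \<circ> \<pi>))"
    using sum_permutes_conjugate[OF permutes_bij[OF assms(4)], of "\<lambda>h. \<phi> (h \<circ> \<pi>)" X] .
  also have "\<dots> = (\<Sum>\<sigma> | \<sigma> permutes \<rho> ` X. \<phi> (\<sigma> \<circ> (\<rho> \<circ> \<pi>)))" by (simp add: comp_assoc)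
  also have "\<dots> \<in> I"
    using assms permutes_image[OF assms(4)]
    by (intro sym) (auto simp: permutes_compose card_image permutes_inj_on)
  finally show ?thesis .
qed

lemma alt':
  assumes "X \<subseteq> S" "card X = Suc k" "\<pi> permutes S" "\<rho> permutes S"
  shows "(\<Sum>\<sigma> | \<sigma> permutes X. of_int (sign \<sigma>) * \<phi> (\<rho> \<circ> \<sigma> \<circ> \<pi>)) \<in> I"
proof -
  define f where "f h = of_int (sign (h \<circ> inv \<rho>)) * \<phi> (h \<circ> \<pi>)" for h
  have "(\<Sum>\<sigma> | \<sigma> permutes X. of_int (sign \<sigma>) * \<phi> (\<rho> \<circ> \<sigma> \<circ> \<pi>)) = (\<Sum>\<sigma> | \<sigma> permutes X. f (\<rho> \<circ> \<sigma>))"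
  proof (intro sum.cong refl)
    fix \<sigma> assume "\<sigma> \<in> {\<sigma>. \<sigma> permutes X}"
    then have "\<sigma> permutes S" using assms(1) permutes_subset by auto
    then show "of_int (sign \<sigma>) * \<phi> (\<rho> \<circ> \<sigma> \<circ> \<pi>) = f (\<rho> \<circ> \<sigma>)"
      unfolding f_def by (simp add: sign_conjugate[OF assms(4) _ finite_S])
  qed
  also have "\<dots> = (\<Sum>\<sigma> | \<sigma> permutes \<rho> ` X. f (\<sigma> \<circ> \<rho>))"
    by (rule sum_permutes_conjugate) (rule permutes_bij[OF assms(4)])
  also have "\<dots> = (\<Sum>\<sigma> | \<sigma> permutes \<rho> ` X. of_int (sign \<sigma>) * \<phi> (\<sigma> \<circ> (\<rho> \<circ> \<pi>)))"
    unfolding f_def using permutes_inv_o(1)[OF assms(4)] by (simp add: comp_assoc)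
  also have "\<dots> \<in> I"
    using assms permutes_image[OF assms(4)]
    by (intro alt) (auto simp: permutes_compose card_image permutes_inj_on)
  finally show ?thesis .
qed

definition vanishes :: "('a \<Rightarrow> 'c) \<Rightarrow> bool" where
  "vanishes \<beta> \<longleftrightarrow> (\<forall>\<rho> \<pi>. \<rho> permutes S \<longrightarrow> \<pi> permutes S \<longrightarrow>
     (\<Sum>g\<in>colour_perms S \<beta>. \<phi> (\<rho> \<circ> g \<circ> \<pi>)) \<in> I)"

lemma vanishesD:
  "vanishes \<beta> \<Longrightarrow> \<rho> permutes S \<Longrightarrow> \<pi> permutes S \<Longrightarrow> (\<Sum>g\<in>colour_perms S \<beta>. \<phi> (\<rho> \<circ> g \<circ> \<pi>)) \<in> I"
  by (simp add: vanishes_def)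

text \<open>The Young subgroup contains the symmetric group of k + 1 points of one class.
  Symmetrizing over these points multiplies the sum by (k + 1)!, which is prime to \<open>p\<close>,
  and lands in \<open>I\<close>.\<close>

lemma vanishes_large_class:
  assumes c: "card {x \<in> S. \<beta> x = c} \<ge> Suc k"
  shows "vanishes \<beta>"
  unfolding vanishes_def
proof (intro allI impI)
  fix \<rho> \<pi> assume p: "\<rho> permutes S" "\<pi> permutes S"
  obtain X where X: "X \<subseteq> {x \<in> S. \<beta> x = c}" "card X = Suc k" "finite X"
    using obtain_subset_with_card_n[OF c] by metis
  let ?F = "\<Sum>g\<in>colour_perms S \<beta>. \<phi> (\<rho> \<circ> g \<circ> \<pi>)"
  have "(\<Sum>\<sigma> | \<sigma> permutes X. \<Sum>g\<in>colour_perms S \<beta>. \<phi> (\<rho> \<circ> (\<sigma> \<circ> g) \<circ> \<pi>)) = (\<Sum>\<sigma> | \<sigma> permutes X. ?F)"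
  proof (rule sum.cong[OF refl])
    fix \<sigma> assume "\<sigma> \<in> {\<sigma>. \<sigma> permutes X}"
    then have "\<sigma> \<in> colour_perms S \<beta>" using X(1) by (intro permutes_colour_perms[of _ X _ _ c]) auto
    from sum_colour_perms_absorb[OF this, of "\<lambda>h. \<phi> (\<rho> \<circ> h \<circ> \<pi>)"]
    show "(\<Sum>g\<in>colour_perms S \<beta>. \<phi> (\<rho> \<circ> (\<sigma> \<circ> g) \<circ> \<pi>)) = ?F" .
  qed
  also have "\<dots> = of_nat (fact (Suc k)) * ?F"
    using X card_permutations[OF X(2,3)] by simp
  finally have "of_nat (fact (Suc k)) * ?F = (\<Sum>g\<in>colour_perms S \<beta>. \<Sum>\<sigma> | \<sigma> permutes X. \<phi> (\<rho> \<circ> \<sigma> \<circ> (g \<circ> \<pi>)))"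
    by (subst sum.swap) (simp add: comp_assoc)
  also have "\<dots> \<in> I"
    by (rule sum_mem, rule sym') (use X p in \<open>auto simp: colour_perms_def permutes_compose\<close>)
  finally show "?F \<in> I"
  proof (rule cancel[rotated])
    show "\<not> p dvd fact (Suc k)"
      using large prime_dvd_fact_iff[OF prime_p, of "Suc k"] prime_gt_1_nat[OF prime_p] by linarith
  qed
qed

text \<open>With \<open>Q\<^sub>r\<close> the antisymmetrizer on one representative of each of the first \<open>r\<close> colour classes
  times the symmetrizer of the colouring, \<open>Q\<^sub>r\<^sub>+\<^sub>1 \<equiv> (1 + r/j) Q\<^sub>r\<close> up to larger colourings and up to
  averaging on the left, where \<open>j\<close> is the size of the next colour class.\<close>

lemma antisymmetrizer_step:
  assumes X: "X \<subseteq> S" "b\<^sub>0 \<in> S" "\<And>x. x \<in> X \<Longrightarrow> \<beta> x \<noteq> \<beta> b\<^sub>0"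
    and larger: "\<And>x. x \<in> X \<Longrightarrow> vanishes (\<beta>(x := \<beta> b\<^sub>0))"
    and small: "card X + card {b \<in> S. \<beta> b = \<beta> b\<^sub>0} < p"
    and Q: "\<And>\<rho> \<pi>. \<rho> permutes S \<Longrightarrow> \<pi> permutes S \<Longrightarrow>
       (\<Sum>\<sigma> | \<sigma> permutes insert b\<^sub>0 X. \<Sum>g\<in>colour_perms S \<beta>. of_int (sign \<sigma>) * \<phi> (\<rho> \<circ> \<sigma> \<circ> g \<circ> \<pi>)) \<in> I"
    and p: "\<rho> permutes S" "\<pi> permutes S"
  shows "(\<Sum>\<sigma> | \<sigma> permutes X. \<Sum>g\<in>colour_perms S \<beta>. of_int (sign \<sigma>) * \<phi> (\<rho> \<circ> \<sigma> \<circ> g \<circ> \<pi>)) \<in> I"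
proof -
  define B where "B = {b \<in> S. \<beta> b = \<beta> b\<^sub>0}"
  define G where "G = colour_perms S \<beta>"
  define Q where "Q = (\<Sum>\<sigma> | \<sigma> permutes X. \<Sum>g\<in>G. of_int (sign \<sigma>) * \<phi> (\<rho> \<circ> \<sigma> \<circ> g \<circ> \<pi>))"
  define Z where "Z x b = (\<Sum>\<sigma> | \<sigma> permutes X. \<Sum>g\<in>G. of_int (sign \<sigma>) * \<phi> (\<rho> \<circ> \<sigma> \<circ> transpose x b \<circ> g \<circ> \<pi>))" for x b
  have fin: "finite X" "finite B" using X(1) finite_S finite_subset by (auto simp: B_def)
  have b0: "b\<^sub>0 \<notin> X" "b\<^sub>0 \<in> B" using X by (auto simp: B_def)
  \<comment> \<open>The Young sum absorbs the transposition of \<open>b\<^sub>0\<close> and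
    \<open>b\<close>, so the hypothesis for \<open>insert b\<^sub>0 X\<close> holds with any point
    \<open>b\<close> of the class as representative. Its nontrivial cosets carry the sign of one
    transposition.\<close>
  have swapped: "Q - (\<Sum>x\<in>X. Z x b) \<in> I" if b: "b \<in> B" for b
  proof -
    define t where "t = transpose b\<^sub>0 b"
    have t: "t \<in> G" unfolding t_def G_def using b X(2) by (intro transpose_colour_perms) (auto simp: B_def)
    have tS: "t permutes S" using t by (simp add: G_def colour_perms_def)
    have bX: "b \<notin> X" using b X by (auto simp: B_def)
    have comm: "t \<circ> \<sigma> = \<sigma> \<circ> t" if "\<sigma> permutes X" for \<sigma>
    proof
      fix y
      have "\<sigma> b\<^sub>0 = b\<^sub>0" "\<sigma> b = b" using that b0 bX by (auto simp: permutes_not_in)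
      moreover have "\<sigma> y \<noteq> b\<^sub>0" if "y \<noteq> b\<^sub>0" using calculation \<open>\<sigma> permutes X\<close> that by (metis permutes_inverses(2))
      moreover have "\<sigma> y \<noteq> b" if "y \<noteq> b" using calculation \<open>\<sigma> permutes X\<close> that by (metis permutes_inverses(2))
      ultimately show "(t \<circ> \<sigma>) y = (\<sigma> \<circ> t) y" unfolding t_def by (auto simp: transpose_def)
    qed
    have 1: "(\<Sum>g\<in>G. f (\<rho> \<circ> t \<circ> \<sigma> \<circ> g \<circ> \<pi>)) = (\<Sum>g\<in>G. f (\<rho> \<circ> \<sigma> \<circ> g \<circ> \<pi>))"
      if "\<sigma> permutes X" for \<sigma> and f :: "('a \<Rightarrow> 'a) \<Rightarrow> 'b"
      using sum_colour_perms_absorb[OF t[unfolded G_def], of "\<lambda>g. f (\<rho> \<circ> \<sigma> \<circ> g \<circ> \<pi>)"] comm[OF that]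
      by (simp add: G_def comp_assoc)
    have 2: "(\<Sum>g\<in>G. f (\<rho> \<circ> t \<circ> \<sigma> \<circ> transpose b\<^sub>0 x \<circ> g \<circ> \<pi>)) = (\<Sum>g\<in>G. f (\<rho> \<circ> \<sigma> \<circ> transpose x b \<circ> g \<circ> \<pi>))"
      if "\<sigma> permutes X" "x \<in> X" for \<sigma> x and f :: "('a \<Rightarrow> 'a) \<Rightarrow> 'b"
    proof -
      have "x \<noteq> b\<^sub>0" "x \<noteq> b" using that b0 bX by auto
      then have "t \<circ> transpose b\<^sub>0 x = transpose x b \<circ> t"
        unfolding t_def by (auto simp: fun_eq_iff transpose_def)
      then have "\<rho> \<circ> t \<circ> \<sigma> \<circ> transpose b\<^sub>0 x \<circ> g \<circ> \<pi> = \<rho> \<circ> \<sigma> \<circ> transpose x b \<circ> (t \<circ> g) \<circ> \<pi>" for g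
        using comm[OF that(1)] by (metis comp_assoc)
      then show ?thesis
        using sum_colour_perms_absorb[OF t[unfolded G_def], of "\<lambda>g. f (\<rho> \<circ> \<sigma> \<circ> transpose x b \<circ> g \<circ> \<pi>)"]
        by (simp add: G_def)
    qed
    have "(\<Sum>\<sigma> | \<sigma> permutes insert b\<^sub>0 X. \<Sum>g\<in>G. of_int (sign \<sigma>) * \<phi> (\<rho> \<circ> t \<circ> \<sigma> \<circ> g \<circ> \<pi>)) \<in> I"
      unfolding G_def by (rule assms(6)) (use p tS in \<open>auto simp: permutes_compose\<close>)
    also have "(\<Sum>\<sigma> | \<sigma> permutes insert b\<^sub>0 X. \<Sum>g\<in>G. of_int (sign \<sigma>) * \<phi> (\<rho> \<circ> t \<circ> \<sigma> \<circ> g \<circ> \<pi>))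
      = (\<Sum>\<sigma> | \<sigma> permutes X. \<Sum>g\<in>G. of_int (sign \<sigma>) * \<phi> (\<rho> \<circ> t \<circ> \<sigma> \<circ> g \<circ> \<pi>))
        + (\<Sum>x\<in>X. \<Sum>\<sigma> | \<sigma> permutes X. \<Sum>g\<in>G.
             of_int (sign (\<sigma> \<circ> transpose b\<^sub>0 x)) * \<phi> (\<rho> \<circ> t \<circ> \<sigma> \<circ> transpose b\<^sub>0 x \<circ> g \<circ> \<pi>))"
      by (subst sum_permutes_insert_right[OF fin(1) b0(1)]) (simp add: fin(1) b0(1) comp_assoc)
    also have "(\<Sum>\<sigma> | \<sigma> permutes X. \<Sum>g\<in>G. of_int (sign \<sigma>) * \<phi> (\<rho> \<circ> t \<circ> \<sigma> \<circ> g \<circ> \<pi>)) = Q"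
      unfolding Q_def by (intro sum.cong refl 1) simp
    also have "(\<Sum>x\<in>X. \<Sum>\<sigma> | \<sigma> permutes X. \<Sum>g\<in>G.
             of_int (sign (\<sigma> \<circ> transpose b\<^sub>0 x)) * \<phi> (\<rho> \<circ> t \<circ> \<sigma> \<circ> transpose b\<^sub>0 x \<circ> g \<circ> \<pi>)) = (\<Sum>x\<in>X. - Z x b)"
    proof (rule sum.cong[OF refl])
      fix x assume x: "x \<in> X"
      have "of_int (sign (\<sigma> \<circ> transpose b\<^sub>0 x)) = (- of_int (sign \<sigma>) :: 'b)" if "\<sigma> permutes X" for \<sigma>
        using that fin(1) x b0(1)
        by (subst sign_compose) (auto simp: permutes_imp_permutation sign_swap_id permutation_swap_id)
      then have "(\<Sum>\<sigma> | \<sigma> permutes X. \<Sum>g\<in>G.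
             of_int (sign (\<sigma> \<circ> transpose b\<^sub>0 x)) * \<phi> (\<rho> \<circ> t \<circ> \<sigma> \<circ> transpose b\<^sub>0 x \<circ> g \<circ> \<pi>))
          = (\<Sum>\<sigma> | \<sigma> permutes X. - (\<Sum>g\<in>G. of_int (sign \<sigma>) * \<phi> (\<rho> \<circ> t \<circ> \<sigma> \<circ> transpose b\<^sub>0 x \<circ> g \<circ> \<pi>)))"
        by (intro sum.cong refl) (simp add: sum_negf)
      also have "\<dots> = - Z x b"
        unfolding Z_def sum_negf
      proof (intro arg_cong[where f = uminus], rule sum.cong[OF refl])
        fix \<sigma> assume "\<sigma> \<in> {\<sigma>. \<sigma> permutes X}"
        then show "(\<Sum>g\<in>G. of_int (sign \<sigma>) * \<phi> (\<rho> \<circ> t \<circ> \<sigma> \<circ> transpose b\<^sub>0 x \<circ> g \<circ> \<pi>))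
          = (\<Sum>g\<in>G. of_int (sign \<sigma>) * \<phi> (\<rho> \<circ> \<sigma> \<circ> transpose x b \<circ> g \<circ> \<pi>))"
          using 2[of \<sigma> x "\<lambda>h. of_int (sign \<sigma>) * \<phi> h"] x by simp
      qed
      finally show "(\<Sum>\<sigma> | \<sigma> permutes X. \<Sum>g\<in>G.
             of_int (sign (\<sigma> \<circ> transpose b\<^sub>0 x)) * \<phi> (\<rho> \<circ> t \<circ> \<sigma> \<circ> transpose b\<^sub>0 x \<circ> g \<circ> \<pi>)) = - Z x b" .
    qed
    finally show ?thesis by (simp add: sum_negf)
  qed
  \<comment> \<open>By \<open>sum_colour_perms_recolour\<close> this is a combination of translates
    of the sum for the colouring in which \<open>x\<close> has joined the class of
    \<open>b\<^sub>0\<close>.\<close>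
  have merged: "Q + (\<Sum>b\<in>B. Z x b) \<in> I" if x: "x \<in> X" for x
  proof -
    have xB: "x \<notin> B" "x \<in> S" using x X by (auto simp: B_def)
    let ?G' = "colour_perms S (\<beta>(x := \<beta> b\<^sub>0))" and ?C = "{c \<in> S. \<beta> c = \<beta> x}"
    have "Q + (\<Sum>b\<in>B. Z x b) = (\<Sum>b\<in>insert x B. Z x b)"
      using xB fin by (simp add: Q_def Z_def)
    also have "\<dots> = (\<Sum>\<sigma> | \<sigma> permutes X. of_int (sign \<sigma>) *
        (\<Sum>b\<in>insert x B. \<Sum>g\<in>G. \<phi> (\<rho> \<circ> \<sigma> \<circ> (transpose x b \<circ> g) \<circ> \<pi>)))"
      unfolding Z_def by (subst sum.swap) (simp add: sum_distrib_left comp_assoc)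
    also have "\<dots> = (\<Sum>\<sigma> | \<sigma> permutes X. of_int (sign \<sigma>) *
        (\<Sum>c\<in>?C. \<Sum>h\<in>?G'. \<phi> (\<rho> \<circ> \<sigma> \<circ> (h \<circ> transpose x c) \<circ> \<pi>)))"
      unfolding B_def G_def using xB(2) X(2) X(3)[OF x]
      by (intro sum.cong refl arg_cong2[where f = "(*)"]
          sum_colour_perms_recolour[where f = "\<lambda>g. \<phi> (\<rho> \<circ> _ \<circ> g \<circ> \<pi>)"]) auto
    also have "\<dots> \<in> I"
    proof (rule sum_mem)
      fix \<sigma> assume \<sigma>: "\<sigma> \<in> {\<sigma>. \<sigma> permutes X}"
      have "(\<Sum>c\<in>?C. \<Sum>h\<in>?G'. \<phi> (\<rho> \<circ> \<sigma> \<circ> (h \<circ> transpose x c) \<circ> \<pi>)) \<in> I"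
      proof (rule sum_mem)
        fix c assume "c \<in> ?C"
        then have "transpose x c permutes S" using xB by (simp add: permutes_swap_id)
        moreover have "\<sigma> permutes S" using \<sigma> X(1) permutes_subset by auto
        ultimately have "(\<Sum>h\<in>?G'. \<phi> (\<rho> \<circ> \<sigma> \<circ> h \<circ> (transpose x c \<circ> \<pi>))) \<in> I"
          using p by (intro vanishesD[OF larger[OF x]]) (auto simp: permutes_compose)
        then show "(\<Sum>h\<in>?G'. \<phi> (\<rho> \<circ> \<sigma> \<circ> (h \<circ> transpose x c) \<circ> \<pi>)) \<in> I" by (simp add: comp_assoc)
      qed
      then show "of_int (sign \<sigma>) * (\<Sum>c\<in>?C. \<Sum>h\<in>?G'. \<phi> (\<rho> \<circ> \<sigma> \<circ> (h \<circ> transpose x c) \<circ> \<pi>)) \<in> I"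
        by (cases \<sigma> rule: sign_cases) (auto simp: uminus_mem)
    qed
    finally show ?thesis .
  qed
  \<comment> \<open>Summed over all \<open>b\<close> and all \<open>x\<close>, the terms
    \<open>Z x b\<close> cancel, and a multiple of \<open>Q\<close> prime to \<open>p\<close>
    remains.\<close>
  have "of_nat (card X + card B) * Q = (\<Sum>b\<in>B. Q - (\<Sum>x\<in>X. Z x b)) + (\<Sum>x\<in>X. Q + (\<Sum>b\<in>B. Z x b))"
    by (simp add: sum.distrib sum_subtractf algebra_simps sum.swap[of _ B X])
  also have "\<dots> \<in> I" by (intro add_mem sum_mem swapped merged)
  finally have "of_nat (card X + card B) * Q \<in> I" .
  moreover have "0 < card B" using b0(2) fin(2) by (auto simp: card_gt_0_iff)
  then have "\<not> p dvd card X + card B" using small by (auto simp: B_def dest!: dvd_imp_le)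
  ultimately have "Q \<in> I" using cancel by blast
  then show ?thesis by (simp add: Q_def G_def)
qed

text \<open>Downward induction on the sum of squares. If every class has at most \<open>k\<close>
  points, more than \<open>k\<^sup>2\<close> points need at least \<open>k + 1\<close> classes. The
  antisymmetrizer on one representative of each of these gives an element of \<open>I\<close>, and
  \<open>antisymmetrizer_step\<close> takes the representatives away one by one.\<close>

lemma vanishes_all:
  fixes \<beta> :: "'a \<Rightarrow> 'c"
  assumes "card S > k\<^sup>2"
  shows "vanishes \<beta>"
proof (induction "(card S)\<^sup>2 - colour_pairs S \<beta>" arbitrary: \<beta> rule: less_induct)
  case less
  define size where "size c = card {x \<in> S. \<beta> x = c}" for c
  show ?case
  proof (cases "\<exists>c. size c \<ge> Suc k")
    case True
    then show ?thesis using vanishes_large_class by (auto simp: size_def)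
  next
    case False
    then have small: "size c \<le> k" for c by (simp add: not_less_eq_eq)
    have "card S = (\<Sum>c\<in>\<beta> ` S. size c)"
      using sum.image_gen[OF finite_S, of "\<lambda>_. 1 :: nat" \<beta>] by (simp add: size_def)
    also have "\<dots> \<le> card (\<beta> ` S) * k"
      using sum_bounded_above[of "\<beta> ` S" size k] small by simp
    finally have "k * k < card (\<beta> ` S) * k" using assms unfolding power2_eq_square by (rule less_le_trans[rotated])
    then have "card (\<beta> ` S) \<ge> Suc k" by simp
    then obtain K where K: "K \<subseteq> \<beta> ` S" "card K = Suc k" "finite K"
      using obtain_subset_with_card_n by metis
    obtain xs where xs: "set xs = K" "distinct xs" using finite_distinct_list[OF K(3)] by blast
    \<comment> \<open>Representatives are removed from the largest class downwards. The step
      recolours points of the earlier classes with the removed colour, and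
      \<open>colour_pairs\<close> is sure to grow because that class is at least as large.\<close>
    define cs where "cs = sort_key size xs"
    have cs: "set cs = K" "distinct cs" "sorted (map size cs)" "length cs = Suc k"
      using xs K distinct_card[of xs] by (simp_all add: cs_def)
    have "\<forall>c\<in>K. \<exists>x. x \<in> S \<and> \<beta> x = c" using K(1) by auto
    then obtain rep where rep: "\<And>c. c \<in> K \<Longrightarrow> rep c \<in> S" "\<And>c. c \<in> K \<Longrightarrow> \<beta> (rep c) = c"
      by metis
    define X where "X r = rep ` set (take r cs)" for r
    have sub: "set (take r cs) \<subseteq> K" for r using cs(1) set_take_subset by metis
    have inj: "inj_on rep K" using rep(2) by (metis inj_onI)
    have XS: "X r \<subseteq> S" for r using sub rep(1) by (auto simp: X_def)
    have card_X: "card (X r) = r" if "r \<le> Suc k" for r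
      using that cs(2,4) inj_on_subset[OF inj sub[of r]] unfolding X_def
      by (subst card_image) (auto simp: distinct_card)
    define P where "P r \<longleftrightarrow> (\<forall>\<rho> \<pi>. \<rho> permutes S \<longrightarrow> \<pi> permutes S \<longrightarrow>
       (\<Sum>\<sigma> | \<sigma> permutes X r. \<Sum>g\<in>colour_perms S \<beta>. of_int (sign \<sigma>) * \<phi> (\<rho> \<circ> \<sigma> \<circ> g \<circ> \<pi>)) \<in> I)" for r
    have "P (Suc k)"
      unfolding P_def
    proof (intro allI impI)
      fix \<rho> \<pi> assume p: "\<rho> permutes S" "\<pi> permutes S"
      have "(\<Sum>g\<in>colour_perms S \<beta>. \<Sum>\<sigma> | \<sigma> permutes X (Suc k). of_int (sign \<sigma>) * \<phi> (\<rho> \<circ> \<sigma> \<circ> (g \<circ> \<pi>))) \<in> I"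
        by (rule sum_mem, rule alt'[OF XS card_X]) (use p in \<open>auto simp: colour_perms_def permutes_compose\<close>)
      then show "(\<Sum>\<sigma> | \<sigma> permutes X (Suc k). \<Sum>g\<in>colour_perms S \<beta>. of_int (sign \<sigma>) * \<phi> (\<rho> \<circ> \<sigma> \<circ> g \<circ> \<pi>)) \<in> I"
        by (subst sum.swap) (simp add: comp_assoc)
    qed
    moreover have "P r" if r: "r < Suc k" and P: "P (Suc r)" for r
    proof -
      let ?b = "rep (cs ! r)"
      have cr: "cs ! r \<in> K" using cs(1,4) r nth_mem by metis
      have X_Suc: "X (Suc r) = insert ?b (X r)"
        using r cs(4) by (simp add: X_def take_Suc_conv_app_nth)
      have fresh: "cs ! r \<notin> set (take r cs)"
        using cs(2,4) r by (auto simp: in_set_conv_nth nth_eq_iff_index_eq)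
      have le: "size c \<le> size (cs ! r)" if "c \<in> set (take r cs)" for c
      proof -
        obtain i where "i < r" "c = cs ! i" using \<open>c \<in> set (take r cs)\<close> by (auto simp: in_set_conv_nth)
        then show ?thesis using sorted_nth_mono[OF cs(3), of i r] r cs(4) by simp
      qed
      have ne: "\<beta> x \<noteq> \<beta> ?b" and larger: "vanishes (\<beta>(x := \<beta> ?b))" if x: "x \<in> X r" for x
      proof -
        obtain c where c: "c \<in> set (take r cs)" "x = rep c" using x by (auto simp: X_def)
        then have cK: "c \<in> K" using sub by auto
        then show ne: "\<beta> x \<noteq> \<beta> ?b" using c fresh rep(2) cr by auto
        have "colour_pairs S \<beta> < colour_pairs S (\<beta>(x := \<beta> ?b))"
          using le[OF c(1)] rep cK cr c(2) ne
          by (intro colour_pairs_recolour[OF finite_S]) (auto simp: size_def)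
        then show "vanishes (\<beta>(x := \<beta> ?b))"
          using colour_pairs_le[OF finite_S, of "\<beta>(x := \<beta> ?b)"] by (intro less) simp
      qed
      have small': "card (X r) + card {b \<in> S. \<beta> b = \<beta> ?b} < p"
        using card_X[of r] r small[of "\<beta> ?b"] large by (simp add: size_def)
      have b: "?b \<in> S" using rep(1) cr by simp
      show "P r"
        unfolding P_def
      proof (intro allI impI)
        fix \<rho> \<pi> assume p: "\<rho> permutes S" "\<pi> permutes S"
        show "(\<Sum>\<sigma> | \<sigma> permutes X r. \<Sum>g\<in>colour_perms S \<beta>. of_int (sign \<sigma>) * \<phi> (\<rho> \<circ> \<sigma> \<circ> g \<circ> \<pi>)) \<in> I"
          by (rule antisymmetrizer_step[OF XS b ne larger small' _ p])
            (use P in \<open>auto simp: P_def X_Suc\<close>)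
      qed
    qed
    ultimately have "P 0" using inc_induct[of 0 "Suc k" P] by auto
    then show ?thesis by (simp add: P_def X_def vanishes_def)
  qed
qed

text \<open>The colouring \<open>id\<close> separates all points, so its Young subgroup is
  trivial.\<close>

theorem symmetrizer_function_vanishes:
  assumes "card S > k\<^sup>2" "\<pi> permutes S"
  shows "\<phi> \<pi> \<in> I"
proof -
  have "colour_perms S id = {id}" by (auto simp: colour_perms_def permutes_id)
  then show ?thesis
    using vanishesD[OF vanishes_all[OF assms(1), of id] permutes_id assms(2)] by simp
qed

end

subsection \<open>The quadratic bound\<close>

text \<open>The point \<open>0\<close> marks the place where a cyclic arrangement \<open>0 # l\<close> is cut open.\<close>

definition succs :: "nat list \<Rightarrow> (nat \<times> nat) set" where
  "succs l = set (zip (0 # l) (l @ [0]))"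

lemma succs_iff_cycle:
  assumes "distinct (0 # l)" "a \<in> set (0 # l)"
  shows "(a, b) \<in> succs l \<longleftrightarrow> cycle_of_list (0 # l) a = b"
proof -
  have rot: "map (cycle_of_list (0 # l)) (0 # l) = l @ [0]"
    using cyclic_rotation[of "0 # l" 1] assms(1) by simp
  have "zip xs (map f xs) = map (\<lambda>x. (x, f x)) xs" for f :: "nat \<Rightarrow> nat" and xs
    by (induction xs) auto
  from this[of "0 # l" "cycle_of_list (0 # l)"]
  have "set (zip (0 # l) (l @ [0])) = (\<lambda>x. (x, cycle_of_list (0 # l) x)) ` set (0 # l)"
    unfolding rot by (metis list.set_map)
  then show ?thesis unfolding succs_def using assms(2) by auto
qed

lemma sign_cycle_of_list: "distinct cs \<Longrightarrow> cs \<noteq> [] \<Longrightarrow> sign (cycle_of_list cs) = (-1) ^ (length cs - 1)"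
proof (induction cs rule: cycle_of_list.induct)
  case (1 i j cs)
  then show ?case
    by (subst cycle_of_list.simps, subst sign_compose)
      (auto simp: permutation_swap_id permutation_of_cycle sign_swap_id)
qed auto

section \<open>Gluing neighbours in cyclic arrangements\<close>

lemma succs_Cons: "succs (j # ys) = {(0, j), (j, hd (ys @ [0]))} \<union> set (zip ys (tl (ys @ [0])))"
  by (cases ys) (auto simp: succs_def)

lemma succs_front: "succs ys = {(0, hd (ys @ [0]))} \<union> set (zip ys (tl (ys @ [0])))"
  by (cases ys) (auto simp: succs_def)

lemma succs_middle:
  "succs (xs @ i # ys) = set (zip (0 # xs) (xs @ [i])) \<union> {(i, hd (ys @ [0]))} \<union> set (zip ys (tl (ys @ [0])))"
proof -
  have "zip (0 # xs @ i # ys) (xs @ i # ys @ [0]) = zip ((0 # xs) @ i # ys) ((xs @ [i]) @ ys @ [0])" by simp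
  also have "\<dots> = zip (0 # xs) (xs @ [i]) @ zip (i # ys) (ys @ [0])" by (rule zip_append) simp
  also have "zip (i # ys) (ys @ [0]) = (i, hd (ys @ [0])) # zip ys (tl (ys @ [0]))" by (cases ys) auto
  finally show ?thesis by (auto simp: succs_def)
qed

lemma succs_middle2:
  "succs (xs @ i # j # ys) = set (zip (0 # xs) (xs @ [i])) \<union> {(i, j), (j, hd (ys @ [0]))} \<union> set (zip ys (tl (ys @ [0])))"
  unfolding succs_middle by (cases ys) auto

lemma succs_split:
  assumes "distinct (0 # l)" "(i, j) \<in> succs l" "i \<noteq> 0" "j \<noteq> 0"
  obtains xs ys where "l = xs @ i # j # ys"
proof -
  have "i \<in> set l" using assms(2,3) by (auto simp: succs_def dest: set_zip_leftD)
  then obtain xs zs where l: "l = xs @ i # zs" by (meson split_list)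
  then have "j = hd (zs @ [0])" using assms(1,2,3)
    by (auto simp: succs_middle dest: set_zip_leftD)
  then obtain ys where "zs = j # ys" using assms(4) by (cases zs) auto
  then show ?thesis using that l by blast
qed

lemma succs_split_front:
  assumes "distinct (0 # l)" "(0, j) \<in> succs l" "j \<noteq> 0"
  obtains ys where "l = j # ys"
proof (cases l)
  case Nil
  then show ?thesis using assms by (simp add: succs_def)
next
  case (Cons a ys)
  then have "j = a" using assms(1,2) by (auto simp: succs_Cons dest: set_zip_leftD)
  then show ?thesis using that Cons by blast
qed

lemma succs_split_back:
  assumes "distinct (0 # l)" "(i, 0) \<in> succs l" "i \<noteq> 0"
  obtains xs where "l = xs @ [i]"
proof -
  have "i \<in> set l" using assms(2,3) by (auto simp: succs_def dest: set_zip_leftD)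
  then obtain xs zs where l: "l = xs @ i # zs" by (meson split_list)
  then have "0 = hd (zs @ [0])" using assms by (auto simp: succs_middle dest: set_zip_leftD)
  then have "zs = []" using l assms(1) by (cases zs) auto
  then show ?thesis using that l by blast
qed

text \<open>\<open>h\<close> prescribes predecessors on the cycle through \<open>0\<close>; the
  points outside \<open>Y\<close> are the starts of the blocks that can still be moved.\<close>

definition arrangements :: "nat set \<Rightarrow> nat set \<Rightarrow> (nat \<Rightarrow> nat) \<Rightarrow> nat list set" where
  "arrangements S Y h = {l \<in> permutations_of_set (S - {0}). \<forall>j\<in>Y. (h j, j) \<in> succs l}"

lemma arrangementsD:
  assumes "l \<in> arrangements S Y h"
  shows "distinct (0 # l)" "set l = S - {0}" "\<And>j. j \<in> Y \<Longrightarrow> (h j, j) \<in> succs l"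
  using assms by (auto simp: arrangements_def dest: permutations_of_setD)

text \<open>When \<open>j\<close> is glued to its predecessor \<open>i\<close>, a point that had to
  follow \<open>j\<close> has to follow \<open>i\<close>. As \<open>h\<close> is injective, no point
  other than \<open>j\<close> had to follow \<open>i\<close> before, so the conditions do not
  clash.\<close>

lemma merge_condition:
  assumes l: "succs l = M \<union> {(i, j), (j, z)} \<union> N" "succs l' = M \<union> {(i, z)} \<union> N"
    and out: "j \<notin> fst ` M" "j \<notin> fst ` N" "i \<notin> fst ` M" "i \<notin> fst ` N" "i \<noteq> j"
    and h: "j \<in> Y" "h j = i" "inj_on h Y"
  shows "(\<forall>y\<in>Y. (h y, y) \<in> succs l) \<longleftrightarrow> (\<forall>y\<in>Y - {j}. (if h y = j then i else h y, y) \<in> succs l')"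
proof -
  have "(h y, y) \<in> succs l \<longleftrightarrow> (if h y = j then i else h y, y) \<in> succs l'" if y: "y \<in> Y - {j}" for y
  proof -
    have "h y \<noteq> i" using y h by (auto dest: inj_onD)
    moreover have "(j, y) \<notin> M" "(j, y) \<notin> N" "(i, y) \<notin> M" "(i, y) \<notin> N"
      using out(1-4) by (metis fst_conv image_eqI)+
    ultimately show ?thesis using out(5) unfolding l by (cases "h y = j") simp_all
  qed
  moreover have "(h j, j) \<in> succs l" using l h by simp
  ultimately show ?thesis using h(1) by blast
qed

lemma fst_zip_subset: "fst ` set (zip xs ys) \<subseteq> set xs"
  by (auto dest: set_zip_leftD)

text \<open>Two points that are always adjacent act as one point with the concatenated label, which
  removes one point and one constraint.\<close>

lemma sum_arrangements_merge:
  assumes S: "0 \<in> S" "Y \<subseteq> S" "h ` Y \<subseteq> S" "inj_on h Y" "j \<in> Y" "j \<noteq> 0" "h j = i" "i \<noteq> 0" "i \<noteq> j"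
  shows "(\<Sum>l\<in>arrangements S Y h. \<Phi> (P @ concat (map lab l) @ Q))
       = (\<Sum>l\<in>arrangements (S - {j}) (Y - {j}) (\<lambda>y. if h y = j then i else h y).
            \<Phi> (P @ concat (map (lab(i := lab i @ lab j)) l) @ Q))"
proof -
  define ins where "ins l = takeWhile (\<lambda>y. y \<noteq> i) l @ i # j # tl (dropWhile (\<lambda>y. y \<noteq> i) l)" for l
  have iS: "i \<in> S" using S by auto
  have ins: "ins (xs @ i # ys) = xs @ i # j # ys" if "i \<notin> set xs" for xs ys
    using that by (auto simp: ins_def takeWhile_append dropWhile_append)
  have cond: "(\<forall>y\<in>Y. (h y, y) \<in> succs (xs @ i # j # ys)) \<longleftrightarrow>
      (\<forall>y\<in>Y - {j}. (if h y = j then i else h y, y) \<in> succs (xs @ i # ys))"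
    if "distinct (xs @ i # j # ys)" "0 \<notin> set (xs @ i # j # ys)" for xs ys
  proof (rule merge_condition[OF succs_middle2 succs_middle])
    have "j \<notin> set (0 # xs)" "i \<notin> set (0 # xs)" "i \<notin> set ys" "j \<notin> set ys" using that by auto
    then show "j \<notin> fst ` set (zip (0 # xs) (xs @ [i]))" "i \<notin> fst ` set (zip (0 # xs) (xs @ [i]))"
      "j \<notin> fst ` set (zip ys (tl (ys @ [0])))" "i \<notin> fst ` set (zip ys (tl (ys @ [0])))"
      by (meson fst_zip_subset subsetD)+
  qed (use S in auto)
  show ?thesis
  proof (rule sum.reindex_bij_witness[where j = "remove1 j" and i = ins])
    fix l assume l: "l \<in> arrangements S Y h"
    then obtain xs ys where xy: "l = xs @ i # j # ys"
      using succs_split[of l i j] S(5-8) arrangementsD(1)[OF l] arrangementsD(3)[OF l, of j] by blast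
    have d: "distinct (xs @ i # j # ys)" "0 \<notin> set (xs @ i # j # ys)" "set (xs @ i # j # ys) = S - {0}"
      using arrangementsD(1,2)[OF l] xy by auto
    have rm: "remove1 j l = xs @ i # ys" using d S(9) by (auto simp: xy remove1_append)
    show "ins (remove1 j l) = l" unfolding rm using ins[of xs ys] d by (simp add: xy)
    have "\<forall>y\<in>Y - {j}. (if h y = j then i else h y, y) \<in> succs (xs @ i # ys)"
      using cond[OF d(1,2)] arrangementsD(3)[OF l] xy by auto
    moreover have "xs @ i # ys \<in> permutations_of_set (S - {j} - {0})"
      using d S(9) by (auto intro!: permutations_of_setI)
    ultimately show "remove1 j l \<in> arrangements (S - {j}) (Y - {j}) (\<lambda>y. if h y = j then i else h y)"
      by (simp add: arrangements_def rm)
    show "\<Phi> (P @ concat (map (lab(i := lab i @ lab j)) (remove1 j l)) @ Q) = \<Phi> (P @ concat (map lab l) @ Q)"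
    proof -
      have "map (lab(i := lab i @ lab j)) zs = map lab zs" if "i \<notin> set zs" for zs
        using that by auto
      then show ?thesis unfolding rm using d by (simp add: xy del: fun_upd_apply) simp
    qed
  next
    fix l assume l: "l \<in> arrangements (S - {j}) (Y - {j}) (\<lambda>y. if h y = j then i else h y)"
    have dl: "distinct (0 # l)" "set l = S - {j} - {0}" using arrangementsD(1,2)[OF l] by auto
    then have "i \<in> set l" using iS S by auto
    then obtain xs ys where xy: "l = xs @ i # ys" by (meson split_list)
    have d: "distinct (xs @ i # j # ys)" "0 \<notin> set (xs @ i # j # ys)" "set (xs @ i # j # ys) = S - {0}"
      using dl S xy by auto
    have il: "ins l = xs @ i # j # ys" unfolding xy by (rule ins) (use d in simp)
    then show "remove1 j (ins l) = l" using d S(9) by (auto simp: xy remove1_append)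
    have "\<forall>y\<in>Y. (h y, y) \<in> succs (xs @ i # j # ys)"
      using cond[OF d(1,2)] arrangementsD(3)[OF l] xy by auto
    then show "ins l \<in> arrangements S Y h"
      using d by (auto simp: arrangements_def il intro!: permutations_of_setI)
  qed
qed

text \<open>A point that must follow the cut stands at the front of the word, so its label joins the
  prefix.\<close>

lemma sum_arrangements_merge_front:
  assumes S: "0 \<in> S" "Y \<subseteq> S" "h ` Y \<subseteq> S" "inj_on h Y" "j \<in> Y" "j \<noteq> 0" "h j = 0"
  shows "(\<Sum>l\<in>arrangements S Y h. \<Phi> (P @ concat (map lab l) @ Q))
       = (\<Sum>l\<in>arrangements (S - {j}) (Y - {j}) (\<lambda>y. if h y = j then 0 else h y).
            \<Phi> ((P @ lab j) @ concat (map lab l) @ Q))"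
proof -
  have cond: "(\<forall>y\<in>Y. (h y, y) \<in> succs (j # ys)) \<longleftrightarrow>
      (\<forall>y\<in>Y - {j}. (if h y = j then 0 else h y, y) \<in> succs ys)"
    if "distinct (j # ys)" "0 \<notin> set (j # ys)" for ys
  proof (rule merge_condition[where M = "{}" and z = "hd (ys @ [0])" and N = "set (zip ys (tl (ys @ [0])))"])
    have "0 \<notin> set ys" "j \<notin> set ys" using that by auto
    then show "j \<notin> fst ` set (zip ys (tl (ys @ [0])))" "0 \<notin> fst ` set (zip ys (tl (ys @ [0])))"
      by (meson fst_zip_subset subsetD)+
    show "succs (j # ys) = {} \<union> {(0, j), (j, hd (ys @ [0]))} \<union> set (zip ys (tl (ys @ [0])))"
      by (simp add: succs_Cons)
    show "succs ys = {} \<union> {(0, hd (ys @ [0]))} \<union> set (zip ys (tl (ys @ [0])))"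
      using succs_front[of ys] by simp
  qed (use S in auto)
  show ?thesis
  proof (rule sum.reindex_bij_witness[where j = tl and i = "Cons j"])
    fix l assume l: "l \<in> arrangements S Y h"
    then obtain ys where xy: "l = j # ys"
      using succs_split_front[of l j] S(5-7) arrangementsD(1)[OF l] arrangementsD(3)[OF l, of j] by metis
    have d: "distinct (j # ys)" "0 \<notin> set (j # ys)" "set (j # ys) = S - {0}"
      using arrangementsD(1,2)[OF l] xy by auto
    show "j # tl l = l" by (simp add: xy)
    have "\<forall>y\<in>Y - {j}. (if h y = j then 0 else h y, y) \<in> succs ys"
      using cond[OF d(1,2)] arrangementsD(3)[OF l] xy by auto
    moreover have "ys \<in> permutations_of_set (S - {j} - {0})"
      using d by (auto intro!: permutations_of_setI)
    ultimately show "tl l \<in> arrangements (S - {j}) (Y - {j}) (\<lambda>y. if h y = j then 0 else h y)"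
      by (simp add: arrangements_def xy)
    show "\<Phi> ((P @ lab j) @ concat (map lab (tl l)) @ Q) = \<Phi> (P @ concat (map lab l) @ Q)"
      by (simp add: xy)
  next
    fix l assume l: "l \<in> arrangements (S - {j}) (Y - {j}) (\<lambda>y. if h y = j then 0 else h y)"
    have d: "distinct (j # l)" "0 \<notin> set (j # l)" "set (j # l) = S - {0}"
      using arrangementsD(1,2)[OF l] S by auto
    have "\<forall>y\<in>Y. (h y, y) \<in> succs (j # l)"
      using cond[OF d(1,2)] arrangementsD(3)[OF l] by auto
    then show "j # l \<in> arrangements S Y h"
      using d by (auto simp: arrangements_def intro!: permutations_of_setI)
  qed simp
qed

context coprime_subgroup
begin

text \<open>Gluing preserves \<open>card (S - Y) = Suc k\<close>. If \<open>Y\<close> becomes empty,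
  the cut point is one of the k + 1 block starts, and the other k blocks appear in every order. If
  \<open>Y = {0}\<close> remains, the point before the cut is prescribed and joins the suffix, which
  again leaves k blocks.\<close>

lemma sum_arrangements_mem:
  fixes \<Phi> :: "'l list \<Rightarrow> 'b"
  assumes H: "sym_identity k \<Phi>"
    and "finite S" "0 \<in> S" "Y \<subseteq> S" "card (S - Y) = Suc k" "h ` Y \<subseteq> S" "inj_on h Y"
    and "\<And>j. j \<in> S - {0} \<Longrightarrow> lab j \<noteq> []"
  shows "(\<Sum>l\<in>arrangements S Y h. \<Phi> (P @ concat (map lab l) @ Q)) \<in> I"
  using assms(2-)
proof (induction "card S" arbitrary: S Y h lab P Q rule: less_induct)
  case less
  note S = less.prems
  consider j where "j \<in> Y" "j \<noteq> 0" | "Y = {}" | "Y = {0}" by (cases "Y \<subseteq> {0}") (auto dest: subset_singletonD)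
  then show ?case
  proof cases
    case 1
    have dec: "card (S - {j}) < card S" using 1 S(1,3) by (intro psubset_card_mono) auto
    have card: "card (S - {j} - (Y - {j})) = Suc k"
      using S(4) 1(1) by (simp add: Diff_insert2[symmetric] insert_absorb)
    have ne: "h y \<noteq> h j" if "y \<in> Y - {j}" for y
      using that S(6) 1(1) by (auto dest: inj_onD)
    have sub: "0 \<in> S - {j}" "Y - {j} \<subseteq> S - {j}" "finite (S - {j})" using 1 S by auto
    consider "h j = j" | "h j = 0" | "h j \<noteq> 0" "h j \<noteq> j" by blast
    then show ?thesis
    proof cases
      assume hj: "h j = j"
      \<comment> \<open>A point that precedes itself would be a cycle of its own, whereas an
        arrangement is a single cycle through \<open>0\<close>.\<close>
      have "arrangements S Y h = {}"
      proof (rule equals0I)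
        fix l assume l: "l \<in> arrangements S Y h"
        then obtain xs ys where "l = xs @ j # j # ys"
          using succs_split[of l j j] arrangementsD(1)[OF l] arrangementsD(3)[OF l, of j] 1 hj by metis
        then show False using arrangementsD(1)[OF l] by simp
      qed
      then show ?thesis by (simp add: zero_mem)
    next
      assume hj: "h j = 0"
      have inj: "inj_on (\<lambda>y. if h y = j then 0 else h y) (Y - {j})"
      proof (rule inj_onI)
        fix x y assume "x \<in> Y - {j}" "y \<in> Y - {j}" "(if h x = j then 0 else h x) = (if h y = j then 0 else h y)"
        then have "h x = h y" using ne[of x] ne[of y] hj by (auto split: if_splits)
        then show "x = y" using S(6) \<open>x \<in> Y - {j}\<close> \<open>y \<in> Y - {j}\<close> by (auto dest: inj_onD)
      qed
      have im: "(\<lambda>y. if h y = j then 0 else h y) ` (Y - {j}) \<subseteq> S - {j}" using S 1 by auto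
      show ?thesis
        by (subst sum_arrangements_merge_front[OF S(2,3,5,6) 1 hj], rule less.hyps[OF dec sub(3,1,2) card im inj]) (use S(7) in auto)
    next
      assume hj: "h j \<noteq> 0" "h j \<noteq> j"
      have inj: "inj_on (\<lambda>y. if h y = j then h j else h y) (Y - {j})"
      proof (rule inj_onI)
        fix x y assume "x \<in> Y - {j}" "y \<in> Y - {j}" "(if h x = j then h j else h x) = (if h y = j then h j else h y)"
        then have "h x = h y" using ne[of x] ne[of y] by (auto split: if_splits)
        then show "x = y" using S(6) \<open>x \<in> Y - {j}\<close> \<open>y \<in> Y - {j}\<close> by (auto dest: inj_onD)
      qed
      have im: "(\<lambda>y. if h y = j then h j else h y) ` (Y - {j}) \<subseteq> S - {j}" using S 1 hj by auto
      show ?thesis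
        by (subst sum_arrangements_merge[OF S(2,3,5,6) 1 refl hj], rule less.hyps[OF dec sub(3,1,2) card im inj]) (use S(7) in auto)
    qed
  next
    case 2
    then have "arrangements S Y h = permutations_of_set (S - {0})" by (simp add: arrangements_def)
    then show ?thesis using S 2 by (auto intro!: sym_identityD[OF H])
  next
    case 3
    define i where "i = h 0"
    show ?thesis
    proof (cases "i = 0")
      case True
      have "arrangements S Y h = {}"
      proof (rule equals0I)
        fix l assume l: "l \<in> arrangements S Y h"
        then have "(0, 0) \<in> succs l" using arrangementsD(3)[OF l] 3 True i_def by simp
        then have "l = []" using arrangementsD(1)[OF l]
          by (cases l) (auto simp: succs_def dest: set_zip_leftD)
        then have "S - Y = {}" using arrangementsD(2)[OF l] 3 by auto
        then show False using S(4) by (metis card.empty nat.distinct(1))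
      qed
      then show ?thesis by (simp add: zero_mem)
    next
      case False
      have iS: "i \<in> S" using S 3 by (auto simp: i_def)
      have c: "card (S - {0} - {i}) = k" using S(1,4) 3 iS False by simp
      have "(\<Sum>l\<in>arrangements S Y h. \<Phi> (P @ concat (map lab l) @ Q))
        = (\<Sum>l\<in>permutations_of_set (S - {0} - {i}). \<Phi> (P @ concat (map lab l) @ (lab i @ Q)))"
      proof (rule sum.reindex_bij_witness[where j = butlast and i = "\<lambda>l. l @ [i]"])
        fix l assume l: "l \<in> arrangements S Y h"
        then obtain xs where xs: "l = xs @ [i]"
          using succs_split_back[of l i] False 3 arrangementsD[OF l] i_def by auto
        then show "butlast l @ [i] = l" by simp
        show "butlast l \<in> permutations_of_set (S - {0} - {i})"
          using arrangementsD(1,2)[OF l] xs by (auto intro!: permutations_of_setI)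
        show "\<Phi> (P @ concat (map lab (butlast l)) @ lab i @ Q) = \<Phi> (P @ concat (map lab l) @ Q)"
          using xs by simp
      next
        fix l assume l: "l \<in> permutations_of_set (S - {0} - {i})"
        have "(i, 0) \<in> succs (l @ [i])" by (simp add: succs_middle)
        moreover have "distinct l" "set l = S - {0} - {i}" using l by (auto dest: permutations_of_setD)
        then have "l @ [i] \<in> permutations_of_set (S - {0})"
          by (intro permutations_of_setI) (use iS False in auto)
        ultimately show "l @ [i] \<in> arrangements S Y h"
          unfolding arrangements_def 3 i_def by simp
      qed simp
      also have "\<dots> \<in> I" by (rule sym_identityD[OF H]) (use S c in auto)
      finally show ?thesis .
    qed
  qed
qed


lemma cycle_of_list_inject:
  assumes "distinct (0 # l)" "distinct (0 # l')" "length l = length l'"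
    "cycle_of_list (0 # l) = cycle_of_list (0 # l')"
  shows "l = (l' :: nat list)"
proof -
  have rot: "map (cycle_of_list (0 # xs)) (0 # xs) = xs @ [0]" if "distinct (0 # xs)" for xs :: "nat list"
    using cyclic_rotation[of "0 # xs" 1] that by simp
  have step: "cycle_of_list (0 # xs) ((0 # xs) ! i) = xs ! i" if "distinct (0 # xs)" "i < length xs" for xs :: "nat list" and i
    using arg_cong[OF rot[OF that(1)], of "\<lambda>w. w ! i"] that(2) by (simp add: nth_append del: list.map)
  have "(0 # l) ! i = (0 # l') ! i" if "i \<le> length l" for i
    using that
  proof (induction i)
    case (Suc i)
    then show ?case using step[OF assms(1), of i] step[OF assms(2), of i] assms(3,4) by simp
  qed simp
  then show ?thesis using assms(3) by (metis Suc_leI list_eq_iff_nth_eq nth_Cons_Suc)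
qed

text \<open>Attach the word \<open>l\<close> to the cyclic permutation \<open>0 # l\<close>. Permuting the values of the permutation on
  \<open>k + 1\<close> points then permutes the \<open>k + 1\<close> blocks into which the points cut the cycle. All results that are
  cycles differ by even permutations, so the symmetric and the alternating sum agree up to sign.\<close>

theorem annihilates_square:
  assumes k: "2 * k < p"
  shows "annihilates k (k\<^sup>2)"
  unfolding annihilates_def
proof (intro allI impI)
  fix \<Phi> :: "nat list \<Rightarrow> 'b" and u :: "nat list"
  assume H: "sym_identity k \<Phi>" and len: "length u \<ge> k\<^sup>2"
  define m where "m = length u"
  define S where "S = {..m}"
  define lab where "lab j = [u ! (j - 1)]" for j :: nat
  define cyc where "cyc l = cycle_of_list (0 # l)" for l :: "nat list"
  define A where "A = permutations_of_set (S - {0})"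
  define \<psi> where "\<psi> l = \<Phi> (concat (map lab l))" for l
  \<comment> \<open>Zero on permutations that are not full cycles. Distinct \<open>l\<close> give
    distinct cycles, so no two words share a value.\<close>
  define \<phi> where "\<phi> \<pi> = (\<Sum>l\<in>A. if cyc l = \<pi> then \<psi> l else 0)" for \<pi>
  have S: "finite S" "0 \<in> S" "card S = Suc m" by (simp_all add: S_def)
  have A: "distinct (0 # l)" "set (0 # l) = S" "length l = m" "cyc l permutes S" if "l \<in> A" for l
  proof -
    show l: "distinct (0 # l)" "set (0 # l) = S"
      using that S(2) by (auto simp: A_def dest: permutations_of_setD)
    show "length l = m" using distinct_card[OF l(1)] l(2) S(3) by simp
    show "cyc l permutes S" using cycle_permutes[of "0 # l"] l(2) by (simp add: cyc_def)
  qed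
  have E: "(\<Sum>l | l \<in> A \<and> cyc l \<circ> inv \<pi> permutes X. \<psi> l) \<in> I"
    if X: "X \<subseteq> S" "card X = Suc k" "\<pi> permutes S" for X \<pi>
  proof -
    \<comment> \<open>That the quotient of the cycle by \<open>\<pi>\<close> fixes \<open>j\<close>
      means that \<open>inv \<pi> j\<close> precedes \<open>j\<close> on the cycle, so
      \<open>inv \<pi>\<close> prescribes the predecessors outside \<open>X\<close>.\<close>
    have "cyc l \<circ> inv \<pi> permutes X \<longleftrightarrow> (\<forall>j\<in>S - X. (inv \<pi> j, j) \<in> succs l)" if l: "l \<in> A" for l
    proof -
      have "(inv \<pi> j, j) \<in> succs l \<longleftrightarrow> (cyc l \<circ> inv \<pi>) j = j" if "j \<in> S" for j
        unfolding cyc_def comp_def using A(2)[OF l] permutes_in_image[OF permutes_inv[OF X(3)]] that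
        by (intro succs_iff_cycle[OF A(1)[OF l]]) auto
      then have eq: "(\<forall>j\<in>S - X. (inv \<pi> j, j) \<in> succs l) \<longleftrightarrow> (\<forall>j\<in>S - X. (cyc l \<circ> inv \<pi>) j = j)"
        by simp
      have perm: "cyc l \<circ> inv \<pi> permutes S" by (intro permutes_compose permutes_inv X A(4)[OF l])
      show ?thesis
        unfolding eq
      proof
        assume "cyc l \<circ> inv \<pi> permutes X"
        then show "\<forall>j\<in>S - X. (cyc l \<circ> inv \<pi>) j = j" by (metis DiffD2 permutes_not_in)
      next
        assume "\<forall>j\<in>S - X. (cyc l \<circ> inv \<pi>) j = j"
        then show "cyc l \<circ> inv \<pi> permutes X" by (intro permutes_superset[OF perm]) blast
      qed
    qed
    then have "{l. l \<in> A \<and> cyc l \<circ> inv \<pi> permutes X} = arrangements S (S - X) (inv \<pi>)"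
      unfolding arrangements_def A_def by blast
    moreover have "(\<Sum>l\<in>arrangements S (S - X) (inv \<pi>). \<Phi> ([] @ concat (map lab l) @ [])) \<in> I"
      using S X permutes_image[OF permutes_inv[OF X(3)]] permutes_inj_on[OF permutes_inv[OF X(3)]]
      by (intro sum_arrangements_mem[OF H]) (auto simp: lab_def double_diff image_mono)
    ultimately show ?thesis by (simp add: \<psi>_def)
  qed
  have collapse: "(\<Sum>\<sigma> | \<sigma> permutes X. f \<sigma> * \<phi> (\<sigma> \<circ> \<pi>)) =
      (\<Sum>l | l \<in> A \<and> cyc l \<circ> inv \<pi> permutes X. f (cyc l \<circ> inv \<pi>) * \<psi> l)"
    if X: "X \<subseteq> S" "\<pi> permutes S" for X \<pi> and f :: "(nat \<Rightarrow> nat) \<Rightarrow> 'b"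
  proof -
    have eq: "cyc l = \<sigma> \<circ> \<pi> \<longleftrightarrow> \<sigma> = cyc l \<circ> inv \<pi>" for l \<sigma>
    proof
      assume "cyc l = \<sigma> \<circ> \<pi>"
      then show "\<sigma> = cyc l \<circ> inv \<pi>" using permutes_inv_o(1)[OF X(2)] by (simp add: comp_assoc)
    next
      assume "\<sigma> = cyc l \<circ> inv \<pi>"
      then show "cyc l = \<sigma> \<circ> \<pi>" using permutes_inv_o(2)[OF X(2)] by (simp add: comp_assoc)
    qed
    have "finite {\<sigma>. \<sigma> permutes X}" using finite_subset[OF X(1) S(1)] by (rule finite_permutations)
    then have "(\<Sum>\<sigma> | \<sigma> permutes X. if \<sigma> = cyc l \<circ> inv \<pi> then f \<sigma> * \<psi> l else 0) =
      (if cyc l \<circ> inv \<pi> permutes X then f (cyc l \<circ> inv \<pi>) * \<psi> l else 0)" for l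
      using sum.delta'[of "{\<sigma>. \<sigma> permutes X}" "cyc l \<circ> inv \<pi>" "\<lambda>\<sigma>. f \<sigma> * \<psi> l"] by (simp add: eq_commute)
    moreover have "(\<Sum>\<sigma> | \<sigma> permutes X. f \<sigma> * \<phi> (\<sigma> \<circ> \<pi>)) =
        (\<Sum>l\<in>A. \<Sum>\<sigma> | \<sigma> permutes X. if \<sigma> = cyc l \<circ> inv \<pi> then f \<sigma> * \<psi> l else 0)"
      unfolding \<phi>_def eq sum_distrib_left by (subst sum.swap) (simp add: if_distrib cong: if_cong)
    ultimately show ?thesis
      by (simp add: A_def sum.inter_filter)
  qed
  interpret symmetrizer_function I p S \<phi> k
  proof
    fix X \<pi> assume X: "X \<subseteq> S" "card X = Suc k" "\<pi> permutes S"
    show "(\<Sum>\<sigma> | \<sigma> permutes X. \<phi> (\<sigma> \<circ> \<pi>)) \<in> I"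
      using collapse[OF X(1,3), of "\<lambda>_. 1"] E[OF X] by simp
    have sg: "sign (cyc l \<circ> inv \<pi>) = (-1) ^ m * sign \<pi>" if "l \<in> A" for l
    proof -
      have "permutation \<pi>" using S(1) X(3) permutes_imp_permutation by blast
      moreover have "permutation (cyc l)" unfolding cyc_def by (rule permutation_of_cycle)
      moreover have "sign (cyc l) = (-1) ^ m"
        using sign_cycle_of_list[OF A(1)[OF that]] A(3)[OF that] by (simp add: cyc_def)
      ultimately show ?thesis by (simp add: sign_compose permutation_inverse sign_inverse)
    qed
    have "(\<Sum>\<sigma> | \<sigma> permutes X. of_int (sign \<sigma>) * \<phi> (\<sigma> \<circ> \<pi>)) =
        of_int ((-1) ^ m * sign \<pi>) * (\<Sum>l | l \<in> A \<and> cyc l \<circ> inv \<pi> permutes X. \<psi> l)"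
      unfolding collapse[OF X(1,3), of "\<lambda>\<sigma>. of_int (sign \<sigma>)"] sum_distrib_left
      by (intro sum.cong refl) (simp add: sg)
    then show "(\<Sum>\<sigma> | \<sigma> permutes X. of_int (sign \<sigma>) * \<phi> (\<sigma> \<circ> \<pi>)) \<in> I"
      using E[OF X] by (cases \<pi> rule: sign_cases; cases "even m") (auto simp: uminus_mem)
  qed (rule S(1), rule k)
  define l0 where "l0 = [1..<Suc m]"
  have l0: "l0 \<in> A" by (auto simp: l0_def A_def S_def intro!: permutations_of_setI)
  have "\<phi> (cyc l0) = (\<Sum>l\<in>A. if l = l0 then \<psi> l else 0)"
    unfolding \<phi>_def
  proof (intro sum.cong refl)
    fix l assume "l \<in> A"
    then have "cyc l = cyc l0 \<longleftrightarrow> l = l0"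
      using cycle_of_list_inject[OF A(1) A(1)[OF l0], of l] A(3) l0 by (auto simp: cyc_def)
    then show "(if cyc l = cyc l0 then \<psi> l else 0) = (if l = l0 then \<psi> l else 0)" by simp
  qed
  also have "\<dots> = \<psi> l0" using l0 by (simp add: A_def)
  also have "\<psi> l0 = \<Phi> u"
  proof -
    have "map (\<lambda>j. u ! (j - 1)) l0 = u"
      by (rule nth_equalityI) (auto simp: l0_def m_def simp del: upt_Suc)
    moreover have "concat (map lab xs) = map (\<lambda>j. u ! (j - 1)) xs" for xs
      by (induction xs) (auto simp: lab_def)
    ultimately show ?thesis by (simp add: \<psi>_def)
  qed
  \<comment> \<open>The cut point makes \<open>S\<close> larger than the word by one, so length
    \<open>k\<^sup>2\<close> is already enough.\<close>
  finally show "\<Phi> u \<in> I"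
    using symmetrizer_function_vanishes[of "cyc l0"] A(4)[OF l0] S(3) len by (simp add: m_def)
qed

end

subsection \<open>Blocks of a letter\<close>

text \<open>Empty blocks between other letters and at both ends are recorded as 0, so there is
  always one block more than there are nonzero letters.\<close>

fun runs :: "nat list \<Rightarrow> nat list" where
  "runs [] = [0]"
| "runs (c # w) = (if c = 0 then Suc (hd (runs w)) # tl (runs w) else 0 # runs w)"

lemma runs_not_Nil [simp]: "runs w \<noteq> []"
  by (cases w) auto

lemma sum_list_runs: "sum_list (runs w) = count_list w 0"
proof (induction w)
  case (Cons c w)
  have "sum_list (runs w) = hd (runs w) + sum_list (tl (runs w))"
    by (cases "runs w") (use runs_not_Nil[of w] in auto)
  then show ?case using Cons by auto
qed simp

lemma length_runs: "length (runs w) = Suc (length (filter (\<lambda>c. c \<noteq> 0) w))"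
  by (induction w) auto

lemma runs_append_nonzero: "c \<noteq> 0 \<Longrightarrow> runs (u @ c # w) = runs u @ runs w"
  by (induction u) auto

lemma runs_replicate: "runs (replicate a 0) = [a]"
  by (induction a) auto

definition run_energy :: "nat list \<Rightarrow> nat" where
  "run_energy w = (\<Sum>a\<leftarrow>runs w. a\<^sup>2)"

lemma run_energy_Nil [simp]: "run_energy [] = 0"
  by (simp add: run_energy_def)

lemma run_energy_append_nonzero: "c \<noteq> 0 \<Longrightarrow> run_energy (u @ c # w) = run_energy u + run_energy w"
  by (simp add: run_energy_def runs_append_nonzero)

lemma run_energy_append_left:
  assumes "P = [] \<or> last P \<noteq> 0"
  shows "run_energy (P @ w) = run_energy P + run_energy w"
proof (cases P rule: rev_cases)
  case (snoc u c)
  then show ?thesis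
    using assms run_energy_append_nonzero[of c u w] run_energy_append_nonzero[of c u "[]"] by simp
qed simp

lemma run_energy_append_right:
  assumes "Q = [] \<or> hd Q \<noteq> 0"
  shows "run_energy (w @ Q) = run_energy w + run_energy Q"
proof (cases Q)
  case (Cons c u)
  then show ?thesis
    using assms run_energy_append_nonzero[of c w u] run_energy_append_nonzero[of c "[]" u] by simp
qed simp

lemma run_energy_append3:
  assumes "v \<noteq> []" "hd v \<noteq> 0" "last v \<noteq> 0"
  shows "run_energy (u @ v @ w) = run_energy u + run_energy v + run_energy w"
  using run_energy_append_right[of "v @ w" u] run_energy_append_left[of v w] assms by simp

lemma zeros_cases:
  obtains (zeros) a where "l = replicate a (0 :: nat)"
    | (split) a j l' where "l = replicate a 0 @ j # l'" "j \<noteq> 0"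
proof (cases "\<exists>x\<in>set l. x \<noteq> 0")
  case True
  then obtain xs j ys where "l = xs @ j # ys" "j \<noteq> 0" "\<forall>x\<in>set xs. \<not> x \<noteq> 0"
    using split_list_first_prop[of l "\<lambda>x. x \<noteq> 0"] by blast
  then show ?thesis using split[of "length xs" j ys] by (simp add: replicate_length_same)
next
  case False
  then show ?thesis using zeros[of "length l"] by (simp add: replicate_length_same)
qed

text \<open>The substituted words begin and end with nonzero letters, so no block of
  \<open>l\<close> merges with a block inside a label, and the energies add up.\<close>

lemma run_energy_substitute:
  assumes "lab 0 = [0]" "\<And>j. j \<in> set l \<Longrightarrow> j \<noteq> 0 \<Longrightarrow> lab j \<noteq> [] \<and> hd (lab j) \<noteq> 0 \<and> last (lab j) \<noteq> 0"
  shows "run_energy (concat (map lab l)) = run_energy l + (\<Sum>j\<leftarrow>l. if j = 0 then 0 else run_energy (lab j))"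
  using assms(2)
proof (induction "length l" arbitrary: l rule: less_induct)
  case less
  have z: "concat (replicate a [0]) = replicate a (0 :: nat)" for a by (induction a) auto
  show ?case
  proof (cases l rule: zeros_cases)
    case (zeros a)
    then show ?thesis by (simp add: assms(1) z sum_list_replicate)
  next
    case (split a j l')
    have "run_energy (concat (map lab l)) = run_energy (replicate a 0 @ lab j @ concat (map lab l'))"
      by (simp add: split assms(1) z)
    also have "\<dots> = run_energy (replicate a 0) + run_energy (lab j) + run_energy (concat (map lab l'))"
      using less.prems[of j] split by (intro run_energy_append3) auto
    also have "run_energy (concat (map lab l')) = run_energy l' + (\<Sum>j\<leftarrow>l'. if j = 0 then 0 else run_energy (lab j))"
      using less.prems split by (intro less.hyps) auto
    finally show ?thesis
      using split by (simp add: run_energy_append_nonzero sum_list_replicate)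
  qed
qed

text \<open>The balanced distribution of zeros among the entries of \<open>\<pi>\<close>, which has
  the least energy for its content.\<close>

definition weave :: "nat \<Rightarrow> nat list \<Rightarrow> nat list" where
  "weave e \<pi> = replicate e 0 @ concat (map (\<lambda>j. j # replicate e 0) \<pi>)"

lemma weave_Cons: "weave e (j # \<pi>) = replicate e 0 @ j # weave e \<pi>"
  by (simp add: weave_def)

lemma weave_Nil: "weave e [] = replicate e 0"
  by (simp add: weave_def)

lemma runs_weave: "0 \<notin> set \<pi> \<Longrightarrow> runs (weave e \<pi>) = replicate (Suc (length \<pi>)) e"
  by (induction \<pi>) (auto simp: weave_Cons weave_Nil runs_append_nonzero runs_replicate)

lemma filter_weave: "0 \<notin> set \<pi> \<Longrightarrow> filter (\<lambda>c. c \<noteq> 0) (weave e \<pi>) = \<pi>"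
  by (induction \<pi>) (auto simp: weave_Cons weave_Nil)

lemma mset_weave: "mset (weave e \<pi>) = replicate_mset (Suc (length \<pi>) * e) 0 + mset \<pi>"
  by (induction \<pi>) (auto simp: weave_Cons weave_Nil intro!: multiset_eqI)

lemma weave_if_runs_const:
  "set (runs l) \<subseteq> {e} \<Longrightarrow> l = weave e (filter (\<lambda>c. c \<noteq> 0) l)"
proof (induction "length l" arbitrary: l rule: less_induct)
  case less
  show ?case
  proof (cases l rule: zeros_cases)
    case (zeros a)
    then show ?thesis using less.prems by (simp add: runs_replicate weave_Nil)
  next
    case (split a j l')
    then have "a = e" "set (runs l') \<subseteq> {e}"
      using less.prems by (auto simp: runs_append_nonzero runs_replicate)
    moreover have "l' = weave e (filter (\<lambda>c. c \<noteq> 0) l')"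
      using less.hyps[of l'] split calculation by simp
    ultimately show ?thesis using split by (simp add: weave_Cons[symmetric]) (metis weave_Cons)
  qed
qed

text \<open>The excess over the constant list is the sum of the squared deviations from the mean
  \<open>e\<close>.\<close>

lemma sum_squares_const:
  fixes e :: nat
  assumes "sum_list rs = length rs * e"
  shows "length rs * e\<^sup>2 \<le> (\<Sum>a\<leftarrow>rs. a\<^sup>2)"
    and "\<not> set rs \<subseteq> {e} \<Longrightarrow> length rs * e\<^sup>2 < (\<Sum>a\<leftarrow>rs. a\<^sup>2)"
proof -
  have gen: "int (\<Sum>a\<leftarrow>rs. a\<^sup>2) + int (length rs) * (int e)\<^sup>2
      = 2 * int e * int (sum_list rs) + (\<Sum>a\<leftarrow>rs. (int a - int e)\<^sup>2)" for rs
    by (induction rs) (auto simp: power2_eq_square algebra_simps)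
  have eq: "int (\<Sum>a\<leftarrow>rs. a\<^sup>2) = int (length rs * e\<^sup>2) + (\<Sum>a\<leftarrow>rs. (int a - int e)\<^sup>2)"
    using gen[of rs] assms by (simp add: power2_eq_square algebra_simps)
  have nonneg: "(\<Sum>a\<leftarrow>rs. (int a - int e)\<^sup>2) \<ge> 0" for rs
    by (induction rs) auto
  then show "length rs * e\<^sup>2 \<le> (\<Sum>a\<leftarrow>rs. a\<^sup>2)" using eq nonneg[of rs] by linarith
  assume "\<not> set rs \<subseteq> {e}"
  then have "(\<Sum>a\<leftarrow>rs. (int a - int e)\<^sup>2) > 0"
  proof (induction rs)
    case (Cons a rs)
    show ?case
    proof (cases "a = e")
      case True
      then show ?thesis using Cons by auto
    next
      case False
      then have "(int a - int e)\<^sup>2 > 0" by simp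
      then show ?thesis using nonneg[of rs] by (simp add: add_pos_nonneg)
    qed
  qed simp
  then show "length rs * e\<^sup>2 < (\<Sum>a\<leftarrow>rs. a\<^sup>2)" using eq by linarith
qed

lemma runs_split:
  assumes "e > 0" "count_list (runs w) e \<ge> Suc m"
  shows "\<exists>P Q. w = P @ replicate e 0 @ Q \<and> (P = [] \<or> last P \<noteq> 0) \<and> (Q = [] \<or> hd Q \<noteq> 0)
    \<and> count_list (runs Q) e \<ge> m"
  using assms(2)
proof (induction "length w" arbitrary: w rule: less_induct)
  case less
  show ?case
  proof (cases w rule: zeros_cases)
    case (zeros a)
    then have "a = e" "m = 0" using less.prems by (auto simp: runs_replicate split: if_splits)
    then show ?thesis using zeros by (intro exI[of _ "[]"]) auto
  next
    case (split a j l')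
    have r: "runs w = a # runs l'" using split by (simp add: runs_append_nonzero runs_replicate)
    show ?thesis
    proof (cases "a = e")
      case True
      have "count_list (runs (j # l')) e \<ge> m" using less.prems r True split assms(1) by simp
      then show ?thesis using split True by (intro exI[of _ "[]"] exI[of _ "j # l'"]) auto
    next
      case False
      then have "count_list (runs l') e \<ge> Suc m" using less.prems r by simp
      then obtain P Q where PQ: "l' = P @ replicate e 0 @ Q" "P = [] \<or> last P \<noteq> 0"
          "Q = [] \<or> hd Q \<noteq> 0" "count_list (runs Q) e \<ge> m"
        using less.hyps[of l'] split by auto
      then show ?thesis using split by (intro exI[of _ "replicate a 0 @ j # P"] exI[of _ Q]) auto
    qed
  qed
qed

text \<open>\<open>Suc C\<close> blocks have \<open>C\<close> gaps. Blocks of other lengths stay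
  inside the gaps or the two outer parts.\<close>

lemma runs_split_many:
  assumes "e > 0" "count_list (runs w) e \<ge> Suc C"
  shows "\<exists>P vs Q. length vs = C \<and> w = P @ replicate e 0 @ concat (map (\<lambda>v. v @ replicate e 0) vs) @ Q
    \<and> (P = [] \<or> last P \<noteq> 0) \<and> (Q = [] \<or> hd Q \<noteq> 0) \<and> (\<forall>v\<in>set vs. v \<noteq> [] \<and> hd v \<noteq> 0 \<and> last v \<noteq> 0)"
  using assms(2)
proof (induction C arbitrary: w)
  case 0
  then show ?case using runs_split[OF assms(1), of 0 w] by (metis concat.simps(1) append_Nil length_0_conv list.simps(8) list.set(1) empty_iff)
next
  case (Suc C)
  obtain P Q where PQ: "w = P @ replicate e 0 @ Q" "P = [] \<or> last P \<noteq> 0"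
      "Q = [] \<or> hd Q \<noteq> 0" "count_list (runs Q) e \<ge> Suc C"
    using runs_split[OF assms(1) Suc.prems] by blast
  have "Q \<noteq> []" using PQ(4) assms(1) by auto
  obtain P' vs Q' where Q: "length vs = C" "Q = P' @ replicate e 0 @ concat (map (\<lambda>v. v @ replicate e 0) vs) @ Q'"
      "P' = [] \<or> last P' \<noteq> 0" "Q' = [] \<or> hd Q' \<noteq> 0" "\<forall>v\<in>set vs. v \<noteq> [] \<and> hd v \<noteq> 0 \<and> last v \<noteq> 0"
    using Suc.IH[OF PQ(4)] by blast
  have "P' \<noteq> []" using Q(2) PQ(3) \<open>Q \<noteq> []\<close> assms(1) by (cases e) auto
  then have "hd P' \<noteq> 0" using Q(2) PQ(3) \<open>Q \<noteq> []\<close> by simp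
  then show ?case
    using PQ Q \<open>P' \<noteq> []\<close> by (intro exI[of _ P] exI[of _ "P' # vs"] exI[of _ Q']) auto
qed

text \<open>Blocks shorter than \<open>e\<^sub>0\<close> are charged \<open>e\<^sub>0 - 1\<close>
  each, longer ones their exact length. The index i stands for the length i - 1.\<close>

lemma sum_list_le_counts:
  assumes "\<forall>a\<in>set rs. a < n" "e\<^sub>0 \<ge> 1"
  shows "sum_list rs \<le> (e\<^sub>0 - 1) * length rs + (\<Sum>i\<in>{Suc e\<^sub>0..n}. (i - 1) * count_list rs (i - 1))"
  using assms(1)
proof (induction rs)
  case (Cons a rs)
  let ?f = "\<lambda>rs. \<Sum>i\<in>{Suc e\<^sub>0..n}. (i - 1) * count_list rs (i - 1)"
  have IH: "sum_list rs \<le> (e\<^sub>0 - 1) * length rs + ?f rs" using Cons by simp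
  have mono: "?f rs \<le> ?f (a # rs)" by (intro sum_mono) simp
  show ?case
  proof (cases "a \<le> e\<^sub>0 - 1")
    case True
    then show ?thesis using IH mono by simp
  next
    case False
    then have i: "Suc a \<in> {Suc e\<^sub>0..n}" using Cons.prems assms(2) by simp
    have "?f (a # rs) = (\<Sum>i\<in>{Suc e\<^sub>0..n}. (i - 1) * count_list rs (i - 1) + (if i = Suc a then a else 0))"
      using assms(2) by (intro sum.cong refl) auto
    also have "\<dots> = ?f rs + a" using i by (simp add: sum.distrib)
    finally show ?thesis using IH by simp
  qed
qed simp


section \<open>Identities for the gaps of extremal words\<close>

lemma hd_last_concat:
  assumes "t \<noteq> []" "\<And>j. j \<in> set t \<Longrightarrow> v j \<noteq> [] \<and> hd (v j) \<noteq> (0 :: nat) \<and> last (v j) \<noteq> 0"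
  obtains m where "concat (map (\<lambda>j. v j @ replicate e 0) t) = m @ replicate e 0"
    "m \<noteq> []" "hd m \<noteq> 0" "last m \<noteq> 0"
proof -
  obtain s a where s: "t = s @ [a]" using assms(1) by (metis rev_exhaust)
  let ?m = "concat (map (\<lambda>j. v j @ replicate e 0) s) @ v a"
  have a: "v a \<noteq> []" "last (v a) \<noteq> 0" using assms(2)[of a] s by auto
  have "hd ?m \<noteq> 0"
    using assms(2) s by (cases s) (auto simp: hd_append)
  then show ?thesis using that[of ?m] s a by auto
qed

lemma concat_shift:
  "replicate e 0 @ concat (map (\<lambda>j. v j @ replicate e 0) t)
     = concat (map (\<lambda>j. replicate e 0 @ v j) t) @ replicate e 0"
  by (induction t) auto

context coprime_subgroup
begin

text \<open>Summing over the distinct orderings of a multiset gives the components of x^N without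
  the factorials of the multiplicities. Sizes above \<open>n\<close> are included since blocks and
  gaps need not add up to exactly \<open>n\<close> arguments.\<close>

definition full_identity :: "nat \<Rightarrow> (nat list \<Rightarrow> 'b) \<Rightarrow> bool" where
  "full_identity n \<Phi> \<longleftrightarrow> (\<forall>(A :: nat multiset) lab P Q. size A \<ge> n \<and> (\<forall>j\<in>#A. lab j \<noteq> []) \<longrightarrow>
     (\<Sum>l\<in>permutations_of_multiset A. \<Phi> (P @ concat (map lab l) @ Q)) \<in> I)"

lemma full_identityD:
  "full_identity n \<Phi> \<Longrightarrow> size A \<ge> n \<Longrightarrow> (\<And>j. j \<in># A \<Longrightarrow> lab j \<noteq> []) \<Longrightarrow>
    (\<Sum>l\<in>permutations_of_multiset (A :: nat multiset). \<Phi> (P @ concat (map lab l) @ Q)) \<in> I"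
  by (simp add: full_identity_def)

text \<open>Each of the words \<open>v j\<close> starts and ends with a letter different from \<open>0\<close>, so that the maximal
  blocks of \<open>0\<close> in a word \<open>0\<^sup>e v 0\<^sup>e v' 0\<^sup>e \<cdots>\<close> can be read off.\<close>

lemma balanced_sym_identity:
  fixes v :: "nat \<Rightarrow> nat list" and n e k :: nat
  assumes \<Phi>: "full_identity n \<Phi>"
    and k: "Suc k * e + k \<ge> n"
    and v: "\<And>j. j < C \<Longrightarrow> v j \<noteq> [] \<and> hd (v j) \<noteq> 0 \<and> last (v j) \<noteq> 0"
    and P: "P = [] \<or> last P \<noteq> 0" and Q: "Q = [] \<or> hd Q \<noteq> 0"
  defines "W \<equiv> \<lambda>t. P @ replicate e 0 @ concat (map (\<lambda>j. v j @ replicate e 0) t) @ Q"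
  assumes IH: "\<And>w'. mset w' = mset (W [0..<C]) \<Longrightarrow> run_energy w' > run_energy (W [0..<C]) \<Longrightarrow> \<Phi> w' \<in> I"
  shows "sym_identity k (\<lambda>t. if mset t = mset [0..<C] then \<Phi> (W t) else 0)"
proof -
  \<comment> \<open>Permuting the gaps changes neither content nor energy, as each gap begins and
    ends with a nonzero letter.\<close>
  have WC: "mset (W t) = mset (W [0..<C])" "run_energy (W t) = run_energy (W [0..<C])"
    if t: "mset t = mset [0..<C]" for t
  proof -
    have m: "mset (W t) = mset P + replicate_mset e 0 + (\<Sum>j\<in>#mset t. mset (v j) + replicate_mset e 0) + mset Q" for t
      unfolding W_def by (induction t) (auto simp: ac_simps)
    show "mset (W t) = mset (W [0..<C])" unfolding m t ..
    have en: "run_energy (W t) = run_energy P + Suc (length t) * e\<^sup>2 + (\<Sum>j\<in>#mset t. run_energy (v j)) + run_energy Q"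
      if "set t \<subseteq> {..<C}" for t
    proof -
      define lab where "lab j = (case j of 0 \<Rightarrow> [0] | Suc i \<Rightarrow> v i)" for j
      have "replicate e 0 @ concat (map (\<lambda>j. v j @ replicate e 0) t) = concat (map lab (weave e (map Suc t)))"
        by (induction t) (auto simp: weave_Cons weave_Nil lab_def concat_replicate_trivial map_replicate_const
            intro: replicate_eqI)
      then have "run_energy (W t) = run_energy P + run_energy (concat (map lab (weave e (map Suc t)))) + run_energy Q"
        unfolding W_def using run_energy_append_left[OF P] run_energy_append_right[OF Q] by (metis append.assoc add.assoc)
      also have "run_energy (concat (map lab (weave e (map Suc t)))) =
          run_energy (weave e (map Suc t)) + (\<Sum>j\<leftarrow>weave e (map Suc t). if j = 0 then 0 else run_energy (lab j))"
      proof (rule run_energy_substitute)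
        fix j assume "j \<in> set (weave e (map Suc t))" "j \<noteq> 0"
        then have "j \<in> Suc ` set t" by (auto simp: weave_def)
        then show "lab j \<noteq> [] \<and> hd (lab j) \<noteq> 0 \<and> last (lab j) \<noteq> 0"
          using that v by (auto simp: lab_def)
      qed (simp add: lab_def)
      also have "run_energy (weave e (map Suc t)) = Suc (length t) * e\<^sup>2"
        by (subst run_energy_def, subst runs_weave) (auto simp: sum_list_replicate)
      also have "(\<Sum>j\<leftarrow>weave e (map Suc t). if j = 0 then 0 else run_energy (lab j)) = (\<Sum>j\<in>#mset t. run_energy (v j))"
        by (induction t) (auto simp: weave_Cons weave_Nil lab_def sum_list_replicate)
      finally show ?thesis by simp
    qed
    have "set t = set [0..<C]" using t by (metis set_mset_mset)
    then have "set t \<subseteq> {..<C}" "set [0..<C] \<subseteq> {..<C}" by auto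
    then show "run_energy (W t) = run_energy (W [0..<C])"
      using en[of t] en[of "[0..<C]"] mset_eq_length[OF t] unfolding t by simp
  qed
  show ?thesis
    unfolding sym_identity_def
  proof (intro allI impI, elim conjE)
    fix J :: "nat set" and lab :: "nat \<Rightarrow> nat list" and p q :: "nat list"
    assume J: "finite J" "card J = k" "\<forall>j\<in>J. lab j \<noteq> []"
    let ?t = "\<lambda>l. p @ concat (map lab l) @ q"
    have mset_l: "mset l = mset_set J" if "l \<in> permutations_of_set J" for l
      using that by (metis mset_set_set permutations_of_setD)
    have ms: "mset (?t l) = mset p + (\<Sum>j\<in>#mset_set J. mset (lab j)) + mset q" if "l \<in> permutations_of_set J" for l
    proof -
      have "mset (concat (map lab l)) = (\<Sum>j\<in>#mset l. mset (lab j))" for l by (induction l) auto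
      then show ?thesis using mset_l[OF that] by (simp add: ac_simps)
    qed
    show "(\<Sum>l\<in>permutations_of_set J. if mset (?t l) = mset [0..<C] then \<Phi> (W (?t l)) else 0) \<in> I"
    \<comment> \<open>The hypothesis \<open>IH\<close> only speaks of words with the content of
      \<open>W [0..<C]\<close>, hence the truncation to rearrangements of all gaps. Content does not
      depend on the ordering of \<open>J\<close>, so the truncation keeps all terms or none.\<close>
    proof (cases "mset p + (\<Sum>j\<in>#mset_set J. mset (lab j)) + mset q = mset [0..<C]")
      case False
      have "(\<Sum>l\<in>permutations_of_set J. if mset (?t l) = mset [0..<C] then \<Phi> (W (?t l)) else 0) = 0"
      proof (rule sum.neutral, rule ballI)
        fix l assume "l \<in> permutations_of_set J"
        then have "mset (?t l) \<noteq> mset [0..<C]" using ms False by metis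
        then show "(if mset (?t l) = mset [0..<C] then \<Phi> (W (?t l)) else 0) = 0" by (rule if_not_P)
      qed
      then show ?thesis by (simp only: zero_mem)
    next
      case True
      then have t: "mset (?t l) = mset [0..<C]" if "l \<in> permutations_of_set J" for l using ms[OF that] by simp
      have setC: "set p \<subseteq> {..<C}" "set q \<subseteq> {..<C}" "\<And>j. j \<in> J \<Longrightarrow> set (lab j) \<subseteq> {..<C}"
      proof -
        obtain l where l: "l \<in> permutations_of_set J"
          using permutations_of_set_empty_iff[of J] J(1) by blast
        then have "set (?t l) = {..<C}" using arg_cong[OF t[OF l], of set_mset] by auto
        then show "set p \<subseteq> {..<C}" "set q \<subseteq> {..<C}" "\<And>j. j \<in> J \<Longrightarrow> set (lab j) \<subseteq> {..<C}"
          using permutations_of_setD(1)[OF l] by auto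
      qed
      let ?h = "\<lambda>t. concat (map (\<lambda>j. v j @ replicate e 0) t)"
      have "\<forall>j\<in>J. \<exists>m. ?h (lab j) = m @ replicate e 0 \<and> m \<noteq> [] \<and> hd m \<noteq> 0 \<and> last m \<noteq> 0"
      proof
        fix j assume j: "j \<in> J"
        show "\<exists>m. ?h (lab j) = m @ replicate e 0 \<and> m \<noteq> [] \<and> hd m \<noteq> 0 \<and> last m \<noteq> 0"
          by (rule hd_last_concat[of "lab j" v e]) (use J(3) j setC(3)[OF j] v in auto)
      qed
      then obtain core where core: "\<And>j. j \<in> J \<Longrightarrow> ?h (lab j) = core j @ replicate e 0 \<and> core j \<noteq> []
          \<and> hd (core j) \<noteq> 0 \<and> last (core j) \<noteq> 0" by metis
      \<comment> \<open>A group of gaps with its inner blocks is one argument. The k + 1 blocks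
        around the k groups enter as single copies of \<open>0\<close>, so that the linearisation
        redistributes them.\<close>
      define lab' where "lab' j = (case j of 0 \<Rightarrow> [0] | Suc i \<Rightarrow> core i)" for j
      define P1 where "P1 = P @ concat (map (\<lambda>j. replicate e 0 @ v j) p)"
      define Q1 where "Q1 = ?h q @ Q"
      have P1: "P1 = [] \<or> last P1 \<noteq> 0"
      proof (cases p rule: rev_cases)
        case (snoc p' a)
        then show ?thesis using v[of a] setC(1) by (auto simp: P1_def)
      qed (use P in \<open>simp add: P1_def\<close>)
      have Q1: "Q1 = [] \<or> hd Q1 \<noteq> 0"
      proof (cases q)
        case (Cons a q')
        then show ?thesis using v[of a] setC(2) by (auto simp: Q1_def hd_append)
      qed (use Q in \<open>simp add: Q1_def\<close>)
      define A where "A = replicate_mset (Suc k * e) 0 + mset_set (Suc ` J)"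
      have filtA: "filter_mset (\<lambda>c. c \<noteq> 0) A = mset_set (Suc ` J)"
        by (rule multiset_eqI) (auto simp: A_def count_mset_set')
      define bal where "bal = (\<lambda>l. weave e (map Suc l)) ` permutations_of_set J"
      have sub: "bal \<subseteq> permutations_of_multiset A"
      proof
        fix L assume "L \<in> bal"
        then obtain l where l: "l \<in> permutations_of_set J" "L = weave e (map Suc l)" by (auto simp: bal_def)
        have "length l = k" using l(1) J length_finite_permutations_of_set by metis
        moreover have "mset (map Suc l) = mset_set (Suc ` J)"
          using mset_l[OF l(1)] by (simp add: image_mset_mset_set)
        ultimately show "L \<in> permutations_of_multiset A"
          using l by (intro permutations_of_multisetI) (simp add: mset_weave A_def)
      qed
      have W_bal: "W (?t l) = P1 @ concat (map lab' (weave e (map Suc l))) @ Q1"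
        if l: "l \<in> permutations_of_set J" for l
      proof -
        have "replicate e 0 @ ?h (concat (map lab l)) = concat (map lab' (weave e (map Suc l)))"
          if "set l \<subseteq> J" for l
          using that
        proof (induction l)
          case Nil
          have "concat (map lab' (replicate e 0)) = replicate e 0" by (induction e) (auto simp: lab'_def)
          then show ?case by (simp add: weave_Nil)
        next
          case (Cons a l)
          have "concat (map lab' (replicate e 0)) = replicate e 0" by (induction e) (auto simp: lab'_def)
          then show ?case using Cons core[of a] by (simp add: weave_Cons lab'_def)
        qed
        moreover have "set l \<subseteq> J" using permutations_of_setD(1)[OF l] by simp
        ultimately have *: "replicate e 0 @ ?h (concat (map lab l)) = concat (map lab' (weave e (map Suc l)))"
          by blast
        have "W (?t l) = P @ (replicate e 0 @ ?h p) @ ?h (concat (map lab l)) @ Q1"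
          by (simp add: W_def Q1_def)
        also have "\<dots> = P1 @ (replicate e 0 @ ?h (concat (map lab l))) @ Q1"
          unfolding concat_shift[of e v p] P1_def by simp
        finally show ?thesis unfolding * .
      qed
      \<comment> \<open>Any other distribution of the zeros over the k + 1 places is unequal, so its
        energy is larger by \<open>sum_squares_const\<close> and \<open>IH\<close> applies.\<close>
      have key: "\<Phi> (P1 @ concat (map lab' L) @ Q1) \<in> I" if L: "L \<in> permutations_of_multiset A - bal" for L
      proof -
        have mL: "mset L = A" using L by (auto dest: permutations_of_multisetD)
        have setL: "set L \<subseteq> insert 0 (Suc ` J)"
          using arg_cong[OF mL, of set_mset] J(1) by (auto simp: A_def split: if_splits)
        obtain l where l: "l \<in> permutations_of_set J"
          using permutations_of_set_empty_iff[of J] J(1) by blast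
        let ?B = "weave e (map Suc l)"
        have B: "?B \<in> permutations_of_multiset A" using sub l by (auto simp: bal_def)
        then have mB: "mset ?B = A" by (auto dest: permutations_of_multisetD)
        have "mset (P1 @ concat (map lab' L) @ Q1) = mset (P1 @ concat (map lab' ?B) @ Q1)"
        proof -
          have "mset (concat (map lab' L)) = (\<Sum>j\<in>#mset L. mset (lab' j))" for L by (induction L) auto
          then show ?thesis using mL mB by simp
        qed
        then have 1: "mset (P1 @ concat (map lab' L) @ Q1) = mset (W [0..<C])"
          using W_bal[OF l] WC(1)[OF t[OF l]] by simp
        have en: "run_energy (P1 @ concat (map lab' L) @ Q1) = run_energy P1 + (run_energy L
            + (\<Sum>j\<in>#mset L. if j = 0 then 0 else run_energy (lab' j))) + run_energy Q1"
          if "set L \<subseteq> insert 0 (Suc ` J)" for L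
        proof -
          have "run_energy (concat (map lab' L)) = run_energy L + (\<Sum>j\<leftarrow>L. if j = 0 then 0 else run_energy (lab' j))"
            by (rule run_energy_substitute) (use that core in \<open>auto simp: lab'_def\<close>)
          moreover have "(\<Sum>j\<leftarrow>L. if j = 0 then 0 else run_energy (lab' j)) = (\<Sum>j\<in>#mset L. if j = 0 then 0 else run_energy (lab' j))"
            by (induction L) auto
          ultimately show ?thesis
            using run_energy_append_left[OF P1] run_energy_append_right[OF Q1] by simp
        qed
        have len: "length (runs L) = Suc k" and sum: "sum_list (runs L) = Suc k * e"
        proof -
          have "length (filter (\<lambda>c. c \<noteq> 0) L) = size (filter_mset (\<lambda>c. c \<noteq> 0) A)"
            using mL by (metis mset_filter size_mset)
          also have "\<dots> = size (mset_set (Suc ` J))" unfolding filtA ..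
          also have "size \<dots> = k" using J by (simp add: card_image)
          finally show "length (runs L) = Suc k" by (simp add: length_runs)
          have "count_list L 0 = count A 0" using mL by (metis count_mset)
          then show "sum_list (runs L) = Suc k * e" using J(1) by (simp add: sum_list_runs A_def)
        qed
        have "\<not> set (runs L) \<subseteq> {e}"
        proof
          assume "set (runs L) \<subseteq> {e}"
          then have Leq: "L = weave e (filter (\<lambda>c. c \<noteq> 0) L)" by (rule weave_if_runs_const)
          define \<pi> where "\<pi> = filter (\<lambda>c. c \<noteq> 0) L"
          have "mset \<pi> = mset_set (Suc ` J)"
            using mL filtA by (simp add: \<pi>_def mset_filter)
          then have "set \<pi> = Suc ` J" "distinct \<pi>"
            using J(1) mset_eq_mset_set_imp_distinct by (metis finite_imageI finite_set_mset_mset_set set_mset_mset)+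
          then have "\<pi> = map Suc (map (\<lambda>c. c - 1) \<pi>)" "map (\<lambda>c. c - 1) \<pi> \<in> permutations_of_set J"
          proof -
            show *: "\<pi> = map Suc (map (\<lambda>c. c - 1) \<pi>)"
              using \<open>set \<pi> = Suc ` J\<close> by (auto intro!: map_idI[symmetric])
            have "distinct (map (\<lambda>c. c - 1) \<pi>)" using \<open>distinct \<pi>\<close> * by (metis distinct_map)
            then show "map (\<lambda>c. c - 1) \<pi> \<in> permutations_of_set J"
              using \<open>set \<pi> = Suc ` J\<close> by (intro permutations_of_setI) (auto simp: image_image)
          qed
          then have "L \<in> bal" using Leq unfolding bal_def \<pi>_def[symmetric] by (metis imageI)
          then show False using L by simp
        qed
        then have "Suc k * e\<^sup>2 < run_energy L"
          using sum_squares_const(2)[of "runs L" e] len sum by (simp add: run_energy_def)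
        moreover have "run_energy ?B = Suc k * e\<^sup>2"
        proof -
          have "length l = k" using l J length_finite_permutations_of_set by metis
          then show ?thesis by (subst run_energy_def, subst runs_weave) (auto simp: sum_list_replicate)
        qed
        moreover have "set ?B \<subseteq> insert 0 (Suc ` J)" using permutations_of_setD(1)[OF l] by (auto simp: weave_def)
        ultimately have "run_energy (P1 @ concat (map lab' ?B) @ Q1) < run_energy (P1 @ concat (map lab' L) @ Q1)"
          using en[OF setL] en[of ?B] mL mB by simp
        then have "run_energy (W [0..<C]) < run_energy (P1 @ concat (map lab' L) @ Q1)"
          using W_bal[OF l] WC(2)[OF t[OF l]] by simp
        then show ?thesis using IH 1 by blast
      qed
      have total: "(\<Sum>L\<in>permutations_of_multiset A. \<Phi> (P1 @ concat (map lab' L) @ Q1)) \<in> I"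
      proof (rule full_identityD[OF \<Phi>])
        show "n \<le> size A" using k J by (simp add: A_def card_image)
        fix j assume "j \<in># A"
        then show "lab' j \<noteq> []" using core J(1) by (auto simp: A_def lab'_def split: if_splits)
      qed
      have "(\<Sum>L\<in>permutations_of_multiset A. \<Phi> (P1 @ concat (map lab' L) @ Q1))
          = (\<Sum>L\<in>permutations_of_multiset A - bal. \<Phi> (P1 @ concat (map lab' L) @ Q1))
            + (\<Sum>L\<in>bal. \<Phi> (P1 @ concat (map lab' L) @ Q1))"
        by (rule sum.subset_diff[OF sub]) simp
      moreover have "(\<Sum>L\<in>permutations_of_multiset A - bal. \<Phi> (P1 @ concat (map lab' L) @ Q1)) \<in> I"
        by (rule sum_mem) (rule key)
      ultimately have "(\<Sum>L\<in>bal. \<Phi> (P1 @ concat (map lab' L) @ Q1)) \<in> I"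
        using total add_mem_cancel[of "\<Sum>L\<in>permutations_of_multiset A - bal. \<Phi> (P1 @ concat (map lab' L) @ Q1)"
            "\<Sum>L\<in>bal. \<Phi> (P1 @ concat (map lab' L) @ Q1)"] by argo
      also have "(\<Sum>L\<in>bal. \<Phi> (P1 @ concat (map lab' L) @ Q1)) = (\<Sum>l\<in>permutations_of_set J. \<Phi> (W (?t l)))"
        unfolding bal_def
      proof (subst sum.reindex)
        show "inj_on (\<lambda>l. weave e (map Suc l)) (permutations_of_set J)"
        proof (rule inj_onI)
          fix l l' :: "nat list" assume "weave e (map Suc l) = weave e (map Suc l')"
          then have "map Suc l = map Suc l'"
            using filter_weave[of "map Suc l" e] filter_weave[of "map Suc l'" e] by simp
          then show "l = l'" by simp
        qed
      qed (simp add: W_bal)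
      finally show ?thesis using t by simp
    qed
  qed
qed


lemma annihilatesD:
  fixes \<Psi> :: "nat list \<Rightarrow> 'b"
  shows "sym_identity k \<Psi> \<Longrightarrow> annihilates k c \<Longrightarrow> length u \<ge> c \<Longrightarrow> \<Psi> u \<in> I"
  by (simp add: annihilates_def)

text \<open>Downward induction on the sum of squares of the lengths of the blocks of \<open>0\<close>. If more than \<open>c (n div i)\<close>
  blocks have length \<open>i - 1\<close>, then modulo words of larger energy the gaps between these blocks satisfy the
  identity of degree \<open>n div i\<close>: linearise \<open>x\<^sup>n\<close> at \<open>n div i\<close> gaps and at the copies of \<open>0\<close> around them.\<close>

theorem letter_degree:
  assumes \<Phi>: "full_identity n \<Phi>" and e0: "e\<^sub>0 \<ge> 1"
    and ann: "\<And>i. e\<^sub>0 < i \<Longrightarrow> i \<le> n \<Longrightarrow> annihilates (n div i) (c (n div i))"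
    and deg: "(e\<^sub>0 - 1) * Suc (length (filter (\<lambda>a. a \<noteq> 0) w)) + (\<Sum>i\<in>{Suc e\<^sub>0..n}. (i - 1) * c (n div i))
      < count_list w 0"
  shows "\<Phi> w \<in> I"
  using deg
proof (induction "(count_list w 0)\<^sup>2 - run_energy w" arbitrary: w rule: less_induct)
  case less
  have bound: "run_energy w \<le> (count_list w 0)\<^sup>2" for w
  proof -
    have "(\<Sum>a\<leftarrow>rs. a\<^sup>2) \<le> (sum_list rs)\<^sup>2" for rs :: "nat list"
      by (induction rs) (auto simp: power2_sum)
    then show ?thesis by (simp add: run_energy_def flip: sum_list_runs)
  qed
  have IH: "\<Phi> w' \<in> I" if m: "mset w' = mset w" and e: "run_energy w' > run_energy w" for w'
  proof (rule less.hyps)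
    have c: "count_list w' 0 = count_list w 0" using m by (metis count_mset)
    show "(count_list w' 0)\<^sup>2 - run_energy w' < (count_list w 0)\<^sup>2 - run_energy w"
      using c e bound[of w'] by simp
    have "length (filter (\<lambda>a. a \<noteq> 0) w') = length (filter (\<lambda>a. a \<noteq> 0) w)"
      using m by (metis mset_filter size_mset)
    then show "(e\<^sub>0 - 1) * Suc (length (filter (\<lambda>a. a \<noteq> 0) w')) + (\<Sum>i\<in>{Suc e\<^sub>0..n}. (i - 1) * c (n div i))
      < count_list w' 0" using less.prems c by simp
  qed
  consider a where "a \<in> set (runs w)" "a \<ge> n" | i where "i \<in> {Suc e\<^sub>0..n}" "count_list (runs w) (i - 1) > c (n div i)"
    | "\<forall>a\<in>set (runs w). a < n" "\<forall>i\<in>{Suc e\<^sub>0..n}. count_list (runs w) (i - 1) \<le> c (n div i)"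
    by (meson not_le)
  then show ?case
  proof cases
    case 1
    have "\<exists>P Q. w = P @ replicate a 0 @ Q"
    proof (cases "a = 0")
      case False
      have "count_list (runs w) a \<noteq> 0" using 1(1) by (simp add: count_list_0_iff)
      then show ?thesis using runs_split[of a 0 w] False by auto
    qed auto
    then obtain P Q where w: "w = P @ replicate a 0 @ Q" by blast
    \<comment> \<open>A block of length at least \<open>n\<close> is a power: a multiset with a
      single repeated entry has only one ordering.\<close>
    have "(\<Sum>l\<in>permutations_of_multiset (replicate_mset a 0). \<Phi> (P @ concat (map (\<lambda>j. [j]) l) @ Q)) \<in> I"
      using 1(2) by (intro full_identityD[OF \<Phi>]) auto
    moreover have "permutations_of_multiset (replicate_mset a 0) = {replicate a (0 :: nat)}"
    proof -
      have "l = replicate a 0" if "mset l = replicate_mset a (0 :: nat)" for l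
        using that by (metis count_list_eq_length_filter in_replicate_mset mset_eq_length replicate_eqI
            set_mset_mset size_replicate_mset size_mset)
      then show ?thesis by (auto simp: permutations_of_multiset_def)
    qed
    ultimately show ?thesis by (simp add: w)
  next
    case 2
    define k e C where "k = n div i" and "e = i - 1" and "C = c k"
    have i: "i > 0" "i = Suc e" "e > 0" using 2(1) e0 by (auto simp: e_def)
    \<comment> \<open>From (k + 1) i > n: the k gaps and the k + 1 blocks of length i - 1 provide (k
      + 1) i - 1 arguments.\<close>
    have k: "n \<le> Suc k * e + k"
    proof -
      have "n < Suc k * i" using i(1) dividend_less_div_times[of i n] by (simp add: k_def)
      then show ?thesis by (simp add: i(2))
    qed
    obtain P vs Q where w: "length vs = C" "w = P @ replicate e 0 @ concat (map (\<lambda>v. v @ replicate e 0) vs) @ Q"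
      "P = [] \<or> last P \<noteq> 0" "Q = [] \<or> hd Q \<noteq> 0" "\<forall>v\<in>set vs. v \<noteq> [] \<and> hd v \<noteq> 0 \<and> last v \<noteq> 0"
      using runs_split_many[OF i(3), of C w] 2(2) by (auto simp: C_def k_def e_def)
    let ?W = "\<lambda>t. P @ replicate e 0 @ concat (map (\<lambda>j. vs ! j @ replicate e 0) t) @ Q"
    have "map (\<lambda>j. vs ! j @ replicate e 0) [0..<C] = map (\<lambda>v. v @ replicate e 0) vs"
      using w(1) by (intro nth_equalityI) auto
    then have W: "?W [0..<C] = w" using w(2) by simp
    have "sym_identity k (\<lambda>t. if mset t = mset [0..<C] then \<Phi> (?W t) else 0)"
    proof (rule balanced_sym_identity[OF \<Phi> k _ w(3,4)])
      fix w' assume "mset w' = mset (?W [0..<C])" "run_energy (?W [0..<C]) < run_energy w'"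
      then show "\<Phi> w' \<in> I" using IH unfolding W by blast
    qed (use w(1,5) in auto)
    moreover have "annihilates k C" using ann[of i] 2(1) by (auto simp: k_def C_def)
    ultimately have "(if mset [0..<C] = mset [0..<C] then \<Phi> (?W [0..<C]) else 0) \<in> I"
      by (rule annihilatesD) simp
    then show ?thesis using W by simp
  next
    case 3
    have "count_list w 0 \<le> (e\<^sub>0 - 1) * length (runs w) + (\<Sum>i\<in>{Suc e\<^sub>0..n}. (i - 1) * count_list (runs w) (i - 1))"
      using sum_list_le_counts[OF 3(1) e0] by (simp add: sum_list_runs)
    also have "\<dots> \<le> (e\<^sub>0 - 1) * Suc (length (filter (\<lambda>a. a \<noteq> 0) w)) + (\<Sum>i\<in>{Suc e\<^sub>0..n}. (i - 1) * c (n div i))"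
      using 3(2) by (intro add_mono sum_mono mult_le_mono) (auto simp: length_runs)
    finally show ?thesis using less.prems by simp
  qed
qed

end

subsection \<open>The nil ideal of the free algebra\<close>

lemma poly_mapping_expand:
  fixes f :: "'k \<Rightarrow>\<^sub>0 'a::comm_monoid_add"
  shows "f = (\<Sum>k\<in>Poly_Mapping.keys f. Poly_Mapping.single k (Poly_Mapping.lookup f k))"
proof (rule poly_mapping_eqI)
  fix j
  have "Poly_Mapping.lookup (\<Sum>k\<in>A. Poly_Mapping.single k (Poly_Mapping.lookup f k)) j
      = (\<Sum>k\<in>A. if k = j then Poly_Mapping.lookup f k else 0)" for A
    by (induction A rule: infinite_finite_induct) (auto simp: lookup_add lookup_single when_def)
  then show "Poly_Mapping.lookup f j
      = Poly_Mapping.lookup (\<Sum>k\<in>Poly_Mapping.keys f. Poly_Mapping.single k (Poly_Mapping.lookup f k)) j"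
    by (simp add: in_keys_iff)
qed

abbreviation const :: "'a::field \<Rightarrow> (nat fword \<Rightarrow>\<^sub>0 'a)" where
  "const \<equiv> Poly_Mapping.single 0"

definition mon :: "nat list \<Rightarrow> (nat fword \<Rightarrow>\<^sub>0 'a::field)" where
  "mon w = Poly_Mapping.single (Word w) 1"

lemma mon_Nil: "mon [] = 1"
  by (simp add: mon_def zero_fword_def[symmetric])

lemma mon_append: "mon (u @ v) = mon u * mon v"
  by (simp add: mon_def mult_single plus_fword_def)

lemma mon_eq_prod_list: "mon w = prod_list (map (\<lambda>a. mon [a]) w)"
proof (induction w)
  case (Cons a w)
  then show ?case by (simp add: mon_append[of "[a]" w, simplified])
qed (simp add: mon_Nil)

lemma const_mult_commute: "const c * f = f * const c"
proof -
  have "const c * Poly_Mapping.single k b = Poly_Mapping.single k b * const c" for k b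
    by (simp add: mult_single mult.commute)
  then show ?thesis
    by (subst (1 2) poly_mapping_expand[of f]) (simp add: sum_distrib_left sum_distrib_right)
qed

lemma const_mult: "const (a * b) = const a * const b"
  by (simp add: mult_single)

lemma const_sum: "const (sum f A) = (\<Sum>x\<in>A. const (f x))"
  by (induction A rule: infinite_finite_induct) (simp_all add: single_add)

lemma free_alg_mon: "set w \<subseteq> {1..d} \<Longrightarrow> w \<noteq> [] \<Longrightarrow> mon w \<in> free_alg d"
  by (simp add: free_alg_def free_semigroup_def mon_def)

lemma free_alg_0: "0 \<in> free_alg d"
  by (simp add: free_alg_def)

lemma free_alg_sum: "(\<And>x. x \<in> A \<Longrightarrow> f x \<in> free_alg d) \<Longrightarrow> sum f A \<in> free_alg d"
  by (induction A rule: infinite_finite_induct) (auto simp: free_alg_0 free_alg_add)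

lemma free_alg_expand:
  assumes "f \<in> free_alg d"
  shows "f = (\<Sum>k\<in>Poly_Mapping.keys f. const (Poly_Mapping.lookup f k) * mon (letters k))"
    and "k \<in> Poly_Mapping.keys f \<Longrightarrow> letters k \<noteq> [] \<and> set (letters k) \<subseteq> {1..d}"
proof -
  show "f = (\<Sum>k\<in>Poly_Mapping.keys f. const (Poly_Mapping.lookup f k) * mon (letters k))"
    by (subst poly_mapping_expand) (simp add: mon_def mult_single)
qed (use assms in \<open>auto simp: free_alg_def free_semigroup_def\<close>)

section \<open>Polarisation over an infinite field\<close>

lemma sum_power_lists:
  fixes G :: "'b \<Rightarrow> 'c::semiring_1"
  assumes "finite K"
  shows "(\<Sum>j\<in>K. G j) ^ N = (\<Sum>l | set l \<subseteq> K \<and> length l = N. prod_list (map G l))"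
proof (induction N)
  case 0
  have "{l. set l \<subseteq> K \<and> length l = 0} = {[]}" by auto
  then show ?case by simp
next
  case (Suc N)
  have "(\<Sum>j\<in>K. G j) ^ Suc N = (\<Sum>(j, l)\<in>K \<times> {l. set l \<subseteq> K \<and> length l = N}. G j * prod_list (map G l))"
    by (simp add: Suc sum_product sum.cartesian_product)
  also have "\<dots> = (\<Sum>l | set l \<subseteq> K \<and> length l = Suc N. prod_list (map G l))"
    by (rule sum.reindex_bij_witness[where i = "\<lambda>l. (hd l, tl l)" and j = "\<lambda>(j, l). j # l"])
      (auto simp: length_Suc_conv)
  finally show ?case .
qed

lemma prod_list_scale_letter:
  "prod_list (map (G(j := const t * G j)) l) = const (t ^ count_list l j) * prod_list (map G l)"
proof (induction l)
  case (Cons a l)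
  have "G a * (const c * f) = const c * (G a * f)" for c f
    by (metis const_mult_commute mult.assoc)
  then show ?case using Cons by (auto simp: const_mult mult.assoc)
qed simp

context
  fixes n d :: nat and I :: "(nat fword \<Rightarrow>\<^sub>0 'a::field) set"
  assumes n: "n > 0"
  defines "I \<equiv> nil_ideal n d"
begin

lemma nil_ideal_0: "0 \<in> I"
  and nil_ideal_add: "f \<in> I \<Longrightarrow> g \<in> I \<Longrightarrow> f + g \<in> I"
  and nil_ideal_scale: "f \<in> I \<Longrightarrow> const c * f \<in> I"
  and nil_ideal_left: "a \<in> free_alg d \<Longrightarrow> f \<in> I \<Longrightarrow> a * f \<in> I"
  and nil_ideal_right: "a \<in> free_alg d \<Longrightarrow> f \<in> I \<Longrightarrow> f * a \<in> I"
  and nil_ideal_subset: "I \<subseteq> free_alg d"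
  using alg_ideal_nil_ideal[OF n, of d, where 'a = 'a] unfolding I_def alg_ideal_def by blast+

lemma nil_ideal_diff: "f \<in> I \<Longrightarrow> g \<in> I \<Longrightarrow> f - g \<in> I"
  using nil_ideal_add[of f "- g"] nil_ideal_uminus[OF n, of g d] by (simp add: I_def)

lemma nil_ideal_sum: "(\<And>x. x \<in> A \<Longrightarrow> f x \<in> I) \<Longrightarrow> sum f A \<in> I"
  by (induction A rule: infinite_finite_induct) (auto simp: nil_ideal_0 nil_ideal_add)

lemma nil_ideal_power:
  assumes "f \<in> free_alg d" "N \<ge> n"
  shows "f ^ N \<in> I"
proof -
  have base: "f ^ n \<in> I"
    unfolding I_def nil_ideal_def by (rule hull_inc) (use assms(1) in auto)
  show ?thesis
  proof (cases "N = n")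
    case False
    then have "f ^ N = f ^ n * f ^ (N - n)" "N - n > 0"
      using assms(2) by (simp_all flip: power_add)
    then show ?thesis using nil_ideal_right[OF free_alg_power base] assms(1) by simp
  qed (use base in simp)
qed

lemma nil_ideal_coprime_subgroup:
  assumes "CHAR('a) > 0"
  shows "coprime_subgroup I (CHAR('a))"
proof
  show "prime CHAR('a)" using assms by (rule prime_CHAR_semidom)
  fix q and f :: "nat fword \<Rightarrow>\<^sub>0 'a"
  assume q: "\<not> CHAR('a) dvd q" "of_nat q * f \<in> I"
  then have "(of_nat q :: 'a) \<noteq> 0" by (simp add: of_nat_eq_0_iff_char_dvd)
  then have "const (inverse (of_nat q)) * (of_nat q * f) = f"
    by (simp add: mult.assoc[symmetric] of_nat_single[symmetric] mult_single flip: single_of_nat)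
  then show "f \<in> I" using nil_ideal_scale[OF q(2), of "inverse (of_nat q)"] by simp
qed (use nil_ideal_0 nil_ideal_diff in auto)

text \<open>By induction on the degree: the difference quotient at a point \<open>s\<close> has smaller degree.\<close>

lemma nil_ideal_coefficients:
  assumes "infinite T" "\<And>t. t \<in> T \<Longrightarrow> (\<Sum>m\<le>N. const (t ^ m) * W m) \<in> I" "m \<le> N"
  shows "W m \<in> I"
  using assms
proof (induction N arbitrary: T W m)
  case 0
  from 0(1) obtain t where "t \<in> T" by fastforce
  then show ?case using 0(2)[of t] 0(3) by simp
next
  case (Suc N)
  obtain s where s: "s \<in> T" using Suc.prems(1) by fastforce
  define U where "U j = (\<Sum>i\<in>{j<..Suc N}. const (s ^ (i - 1 - j)) * W i)" for j
  have "(\<Sum>j\<le>N. const (t ^ j) * U j) \<in> I" if t: "t \<in> T - {s}" for t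
  proof -
    have "(\<Sum>j\<le>N. const (t ^ j) * U j) = (\<Sum>j\<le>N. \<Sum>i\<in>{j<..Suc N}. const (t ^ j * s ^ (i - 1 - j)) * W i)"
      by (simp add: U_def sum_distrib_left const_mult mult.assoc)
    also have "\<dots> = (\<Sum>i\<le>Suc N. \<Sum>j<i. const (t ^ j * s ^ (i - 1 - j)) * W i)"
      by (simp add: sum.Sigma del: sum.atMost_Suc) (rule sum.reindex_bij_witness[where i = "\<lambda>(i, j). (j, i)" and j = "\<lambda>(j, i). (i, j)"], auto)
    finally have "const (t - s) * (\<Sum>j\<le>N. const (t ^ j) * U j) =
        (\<Sum>i\<le>Suc N. const ((t - s) * (\<Sum>j<i. t ^ j * s ^ (i - 1 - j))) * W i)"
      by (simp add: sum_distrib_left sum_distrib_right const_mult mult.assoc const_sum del: sum.atMost_Suc)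
    also have "\<dots> = (\<Sum>i\<le>Suc N. const (t ^ i - s ^ i) * W i)"
    proof (intro sum.cong refl)
      fix i
      have "t ^ i - s ^ i = (t - s) * (\<Sum>j<i. t ^ j * s ^ (i - 1 - j))"
      proof (cases i)
        case (Suc i')
        then show ?thesis using diff_power_eq_sum[of t i' s] by (simp only: diff_Suc_1)
      qed simp
      then show "const ((t - s) * (\<Sum>j<i. t ^ j * s ^ (i - 1 - j))) * W i = const (t ^ i - s ^ i) * W i"
        by simp
    qed
    also have "\<dots> = (\<Sum>i\<le>Suc N. const (t ^ i) * W i) - (\<Sum>i\<le>Suc N. const (s ^ i) * W i)"
      by (simp only: single_diff left_diff_distrib sum_subtractf)
    also have "\<dots> \<in> I" using Suc.prems(2) s t by (intro nil_ideal_diff) auto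
    finally have "const (inverse (t - s)) * (const (t - s) * (\<Sum>j\<le>N. const (t ^ j) * U j)) \<in> I"
      by (rule nil_ideal_scale)
    moreover have "const (inverse (t - s)) * const (t - s) = 1"
      using t by (simp flip: const_mult)
    ultimately show ?thesis by (simp add: mult.assoc[symmetric])
  qed
  then have U: "U j \<in> I" if "j \<le> N" for j
    using Suc.IH[of "T - {s}" U j] Suc.prems(1) that by auto
  have W_Suc: "W (Suc i) \<in> I" if "i \<le> N" for i
  proof (cases "i = N")
    case True
    moreover have "{N<..Suc N} = {Suc N}" by auto
    ultimately show ?thesis using U[of N] by (simp add: U_def)
  next
    case False
    have "{i<..Suc N} = insert (Suc i) {Suc i<..Suc N}" using that by auto
    then have "U i = W (Suc i) + (\<Sum>k\<in>{Suc i<..Suc N}. const (s ^ (k - 1 - i)) * W k)"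
      by (simp add: U_def)
    also have "(\<Sum>k\<in>{Suc i<..Suc N}. const (s ^ (k - 1 - i)) * W k) = const s * U (Suc i)"
      unfolding U_def sum_distrib_left
    proof (intro sum.cong refl)
      fix k assume "k \<in> {Suc i<..Suc N}"
      then have "k - 1 - i = Suc (k - 1 - Suc i)" by auto
      then show "const (s ^ (k - 1 - i)) * W k = const s * (const (s ^ (k - 1 - Suc i)) * W k)"
        by (simp only: power_Suc const_mult mult.assoc)
    qed
    finally have "W (Suc i) = U i - const s * U (Suc i)" by simp
    then show ?thesis using U[of i] U[of "Suc i"] that False
      by (auto intro!: nil_ideal_diff nil_ideal_scale)
  qed
  show ?case
  proof (cases m)
    case 0
    have "(\<Sum>i\<le>Suc N. const (s ^ i) * W i) = W 0 + (\<Sum>i\<le>N. const (s ^ Suc i) * W (Suc i))"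
      by (subst sum.atMost_Suc_shift) simp
    moreover have "(\<Sum>i\<le>N. const (s ^ Suc i) * W (Suc i)) \<in> I"
      by (intro nil_ideal_sum nil_ideal_scale W_Suc) simp
    ultimately have "W 0 \<in> I"
      using nil_ideal_diff[OF Suc.prems(2)[OF s], of "\<Sum>i\<le>N. const (s ^ Suc i) * W (Suc i)"]
      by (simp only: add_diff_cancel_right')
    then show ?thesis using 0 by simp
  qed (use W_Suc Suc.prems(3) in auto)
qed

text \<open>Multiplying \<open>G j\<close> by a scalar t multiplies a product by t to the number of
  occurrences of \<open>j\<close>. Over an infinite field \<open>nil_ideal_coefficients\<close>
  isolates every power of t, and the multiplicities are fixed for one letter of \<open>M\<close>
  after another.\<close>

lemma polarization:
  assumes inf: "infinite (UNIV :: 'a set)" and K: "finite K" "M \<subseteq> K" and N: "N \<ge> n"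
    and G: "\<And>j. j \<in> K \<Longrightarrow> G j \<in> free_alg d"
  shows "(\<Sum>l | set l \<subseteq> K \<and> length l = N \<and> (\<forall>j\<in>M. count_list l j = c j). prod_list (map G l)) \<in> I"
  using finite_subset[OF K(2,1)] K(2) G
proof (induction M arbitrary: G rule: finite_induct)
  case empty
  then show ?case
    using nil_ideal_power[OF free_alg_sum[of K G d] N] sum_power_lists[OF K(1), of G N] by auto
next
  case (insert j M)
  define L where "L = {l. set l \<subseteq> K \<and> length l = N \<and> (\<forall>j\<in>M. count_list l j = c j)}"
  define W where "W m = (\<Sum>l | l \<in> L \<and> count_list l j = m. prod_list (map G l))" for m
  have fin: "finite L" unfolding L_def
    by (rule finite_subset[OF _ finite_lists_length_eq[OF K(1), of N]]) auto
  have "(\<Sum>m\<le>N. const (t ^ m) * W m) \<in> I" for t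
  proof -
    have "(\<Sum>m\<le>N. const (t ^ m) * W m) =
        (\<Sum>m\<le>N. \<Sum>l | l \<in> L \<and> count_list l j = m. const (t ^ count_list l j) * prod_list (map G l))"
      by (simp add: W_def sum_distrib_left)
    also have "\<dots> = (\<Sum>l\<in>L. const (t ^ count_list l j) * prod_list (map G l))"
      by (rule sum.group[OF fin]) (auto simp: L_def intro: count_le_length)
    also have "\<dots> = (\<Sum>l\<in>L. prod_list (map (G(j := const t * G j)) l))"
      by (simp add: prod_list_scale_letter)
    also have "\<dots> \<in> I"
      unfolding L_def using insert.prems by (intro insert.IH) (auto intro: free_alg_scale)
    finally show ?thesis .
  qed
  then have "W m \<in> I" if "m \<le> N" for m
    using nil_ideal_coefficients[OF inf, where N = N and W = W and m = m] that by blast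
  moreover have "W m = 0" if "m > N" for m
  proof -
    have "count_list l j \<noteq> m" if "l \<in> L" for l
      using \<open>m > N\<close> that count_le_length[of l j] by (auto simp: L_def)
    then have "{l. l \<in> L \<and> count_list l j = m} = {}" by blast
    then show ?thesis unfolding W_def by (simp only: sum.empty)
  qed
  ultimately have "W (c j) \<in> I" using nil_ideal_0 by (metis not_le)
  moreover have "{l. l \<in> L \<and> count_list l j = c j} =
      {l. set l \<subseteq> K \<and> length l = N \<and> (\<forall>i\<in>insert j M. count_list l i = c i)}"
    by (auto simp: L_def)
  ultimately show ?case unfolding W_def by simp
qed

lemma free_alg_prod_list:
  "l \<noteq> [] \<Longrightarrow> (\<And>a. a \<in> set l \<Longrightarrow> g a \<in> free_alg d) \<Longrightarrow> prod_list (map g l) \<in> free_alg d"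
proof (induction l)
  case (Cons a l)
  then show ?case by (cases l) (auto intro: free_alg_mult)
qed simp

text \<open>The empty product 1 lies outside \<open>free_alg d\<close>, so empty \<open>P\<close>
  and \<open>Q\<close> are separate cases.\<close>

lemma nil_ideal_sandwich:
  assumes "\<And>a. g a \<in> free_alg d" "f \<in> I"
  shows "prod_list (map g P) * f * prod_list (map g Q) \<in> I"
proof -
  have "prod_list (map g P) * f \<in> I"
    using nil_ideal_left[OF free_alg_prod_list[of P g]] assms by (cases "P = []") auto
  then show ?thesis
    using nil_ideal_right[OF free_alg_prod_list[of Q g]] assms by (cases "Q = []") auto
qed

text \<open>Orderings of a multiset are the lists with prescribed multiplicities, so
  \<open>polarization\<close> applies. Letters may stand for arbitrary elements \<open>g a\<close>,
  which is what allows blocks of an element f later.\<close>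

lemma nil_ideal_full_identity:
  assumes inf: "infinite (UNIV :: 'a set)" and p: "CHAR('a) > 0"
    and g: "\<And>a. g a \<in> free_alg d"
  shows "coprime_subgroup.full_identity I n (\<lambda>w. prod_list (map g w))"
proof -
  interpret coprime_subgroup I "CHAR('a)" using p by (rule nil_ideal_coprime_subgroup)
  show ?thesis
    unfolding full_identity_def
  proof (intro allI impI, elim conjE)
    fix A :: "nat multiset" and lab :: "nat \<Rightarrow> nat list" and P Q :: "nat list"
    assume A: "n \<le> size A" "\<forall>j\<in>#A. lab j \<noteq> []"
    define G where "G j = prod_list (map g (lab j))" for j
    have "permutations_of_multiset A =
        {l. set l \<subseteq> set_mset A \<and> length l = size A \<and> (\<forall>j\<in>set_mset A. count_list l j = count A j)}"
    proof (intro set_eqI iffI)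
      fix l assume "l \<in> {l. set l \<subseteq> set_mset A \<and> length l = size A \<and> (\<forall>j\<in>set_mset A. count_list l j = count A j)}"
      then have l: "set l \<subseteq> set_mset A" "\<forall>j\<in>set_mset A. count_list l j = count A j" by auto
      have "count (mset l) j = count A j" for j
      proof (cases "j \<in># A")
        case False
        then have "j \<notin> set l" using l(1) by blast
        then show ?thesis using False by (simp add: count_eq_zero_iff count_mset count_list_0_iff)
      qed (use l(2) in \<open>simp add: count_mset\<close>)
      then show "l \<in> permutations_of_multiset A" by (intro permutations_of_multisetI multiset_eqI)
    qed (auto simp: permutations_of_multiset_def count_mset)
    then have "(\<Sum>l\<in>permutations_of_multiset A. prod_list (map G l)) \<in> I"
      using A g by (auto intro!: polarization[OF inf] free_alg_prod_list simp: G_def)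
    then have "prod_list (map g P) * (\<Sum>l\<in>permutations_of_multiset A. prod_list (map G l)) * prod_list (map g Q) \<in> I"
      using g by (intro nil_ideal_sandwich)
    moreover have "prod_list (map g (concat (map lab l))) = prod_list (map G l)" for l
      by (induction l) (auto simp: G_def)
    ultimately show "(\<Sum>l\<in>permutations_of_multiset A. prod_list (map g (P @ concat (map lab l) @ Q))) \<in> I"
      by (simp add: sum_distrib_left sum_distrib_right mult.assoc)
  qed
qed

text \<open>The factors are expanded from the left into words collected in \<open>u\<close>. Each
  contributes at least one letter, because the algebra has no unit.\<close>

lemma nil_ideal_products:
  assumes "\<And>w. set w \<subseteq> {1..d} \<Longrightarrow> length w = c \<Longrightarrow> mon w \<in> I"
    and "length fs = c" "set fs \<subseteq> free_alg d"
  shows "prod_list fs \<in> I"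
proof -
  have long: "mon w \<in> I" if "set w \<subseteq> {1..d}" "length w \<ge> c" for w
  proof -
    have "mon w = mon (take c w) * (mon (drop c w) :: nat fword \<Rightarrow>\<^sub>0 'a)" by (simp flip: mon_append)
    moreover have "mon (take c w) \<in> I"
      using that set_take_subset[of c w] by (intro assms(1)) auto
    moreover have "drop c w = [] \<or> (mon (drop c w) :: nat fword \<Rightarrow>\<^sub>0 'a) \<in> free_alg d"
      using that set_drop_subset[of c w] free_alg_mon by (metis subset_trans)
    ultimately show ?thesis using nil_ideal_right by (cases "drop c w = []") (simp_all add: mon_Nil)
  qed
  have "mon u * prod_list fs \<in> I"
    if "set fs \<subseteq> free_alg d" "set u \<subseteq> {1..d}" "length u + length fs \<ge> c" for u fs
    using that
  proof (induction fs arbitrary: u)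
    case Nil
    then show ?case using long by simp
  next
    case (Cons f fs)
    have f: "f \<in> free_alg d" using Cons.prems by simp
    have "mon u * prod_list (f # fs) = (\<Sum>k\<in>Poly_Mapping.keys f.
        const (Poly_Mapping.lookup f k) * (mon (u @ letters k) * prod_list fs))"
    proof -
      have "mon u * (const c * v) = const c * (mon u * v)" for c and v :: "nat fword \<Rightarrow>\<^sub>0 'a"
        by (metis const_mult_commute mult.assoc)
      then show ?thesis
        by (subst free_alg_expand(1)[OF f]) (simp add: sum_distrib_left sum_distrib_right mult.assoc mon_append)
    qed
    also have "\<dots> \<in> I"
    proof (intro nil_ideal_sum nil_ideal_scale Cons.IH)
      fix k assume "k \<in> Poly_Mapping.keys f"
      then have "letters k \<noteq> []" "set (letters k) \<subseteq> {1..d}" using free_alg_expand(2)[OF f] by auto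
      then show "set (u @ letters k) \<subseteq> {1..d}" "c \<le> length (u @ letters k) + length fs"
        using Cons.prems by (cases "letters k"; auto)+
    qed (use Cons.prems in auto)
    finally show ?case .
  qed
  from this[of fs "[]"] assms(2,3) show ?thesis by (simp add: mon_Nil)
qed

lemma nilpotency_degree_le:
  assumes "c > 0" "\<And>w. set w \<subseteq> {1..d} \<Longrightarrow> length w = c \<Longrightarrow> mon w \<in> I"
  shows "nilpotency_degree TYPE('a) n d \<le> enat c"
proof -
  let ?cl = "\<lambda>f :: nat fword \<Rightarrow>\<^sub>0 'a. nil_rel n d `` {f}"
  have foldl: "foldl (nil_mult n d) (?cl f) (map ?cl fs) = ?cl (f * prod_list fs)"
    if "f \<in> free_alg d" "set fs \<subseteq> free_alg d" for f fs
    using that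
    by (induction fs arbitrary: f) (auto simp: nil_mult_class[OF n] free_alg_mult mult.assoc)
  have "foldl (nil_mult n d) (hd as) (tl as) = nil_zero n d"
    if as: "length as = c" "set as \<subseteq> (nil_alg n d :: (nat fword \<Rightarrow>\<^sub>0 'a) set set)" for as
  proof -
    have "\<forall>X\<in>set as. \<exists>f. f \<in> free_alg d \<and> X = ?cl f"
      using as(2) unfolding nil_alg_def quotient_def by auto
    then obtain r where r: "\<And>X. X \<in> set as \<Longrightarrow> r X \<in> free_alg d \<and> X = ?cl (r X)" by metis
    obtain X Xs where X: "as = X # Xs" using as(1) assms(1) by (cases as) auto
    have "map ?cl (map r Xs) = Xs" using r X by (simp add: comp_def map_idI)
    moreover have "X = ?cl (r X)" using r[of X] X by simp
    ultimately have "foldl (nil_mult n d) (hd as) (tl as) = ?cl (r X * prod_list (map r Xs))"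
      using foldl[of "r X" "map r Xs"] r X by auto
    moreover have "prod_list (map r as) \<in> I"
      by (rule nil_ideal_products[OF assms(2)]) (use as r in auto)
    then have "r X * prod_list (map r Xs) \<in> I" by (simp add: X)
    moreover have "?cl f = ?cl 0" if "f \<in> I" for f
      using that nil_ideal_subset free_alg_0 I_def
      by (intro equiv_class_eq[OF equiv_nil_rel[OF n]]) (auto simp: nil_rel_def)
    ultimately show ?thesis by (simp add: nil_zero_def)
  qed
  then show ?thesis
    unfolding nilpotency_degree_def using assms(1) by (intro Inf_lower imageI) blast
qed

end

subsection \<open>Products of eight letters in nil index three\<close>

definition anticomm :: "'r::ring_1 \<Rightarrow> 'r \<Rightarrow> 'r" where
  "anticomm x y = x * y + y * x"

text \<open>The full linearisation of the cube, as \<open>anticomm\<close> is that of the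
  square.\<close>

definition sym3 :: "'r::ring_1 \<Rightarrow> 'r \<Rightarrow> 'r \<Rightarrow> 'r" where
  "sym3 x y z = x * y * z + x * z * y + y * x * z + y * z * x + z * x * y + z * y * x"

lemma numeral_mult_expand:
  fixes z :: "'r::ring_1"
  shows "2 * z = z + z" "3 * z = z + z + z" "4 * z = z + z + z + z" "5 * z = z + z + z + z + z"
    "6 * z = z + z + z + z + z + z"
  by (simp_all only: numeral_Bit0 numeral_Bit1 numeral_One distrib_right mult_1_left add.assoc)

context coprime_subgroup
begin

lemma cancel2: "p > 3 \<Longrightarrow> 2 * a \<in> I \<Longrightarrow> a \<in> I"
  using cancel[of 2 a] nat_dvd_not_less[of 2 p] by simp

lemma cancel3: "p > 3 \<Longrightarrow> 3 * a \<in> I \<Longrightarrow> a \<in> I"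
  using cancel[of 3 a] nat_dvd_not_less[of 3 p] by simp

lemma cancel6: "p > 3 \<Longrightarrow> 6 * a \<in> I \<Longrightarrow> a \<in> I"
  using cancel2[of "3 * a"] cancel3[of a] by (simp add: mult.assoc[symmetric])

lemma numeral_mult_mem: "a \<in> I \<Longrightarrow> numeral k * a \<in> I"
proof -
  have "of_nat m * a \<in> I" if "a \<in> I" for m
    using that by (induction m) (auto simp: zero_mem distrib_right intro: add_mem)
  then show "a \<in> I \<Longrightarrow> numeral k * a \<in> I" by (metis of_nat_numeral)
qed

text \<open>Used to work inside a product with fixed outer factors. The preimage need not be closed
  under multiplication.\<close>

lemma preimage_mult: "coprime_subgroup {v. a * v * b \<in> I} p"
proof
  show "prime p" by (rule prime_p)
  fix q v
  assume q: "\<not> p dvd q" "of_nat q * v \<in> {v. a * v * b \<in> I}"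
  have "a * (of_nat q * v) * b = of_nat q * (a * v * b)"
    by (metis mult.assoc mult_of_nat_commute)
  then show "v \<in> {v. a * v * b \<in> I}" using q cancel by simp
qed (auto simp: zero_mem right_diff_distrib left_diff_distrib intro: diff_mem)

text \<open>Higman's identity in index 3. The general derivation would symmetrise an argument of
  degree 3; this combination only has arguments of degrees (1,1,1), (1,1,2) and (1,2,2), which keeps
  the list of cubes short.\<close>

lemma square_sandwich_mem:
  assumes p: "p > 3"
    and right: "\<And>a v. a \<in> V \<Longrightarrow> v \<in> I \<Longrightarrow> v * a \<in> I" and left: "\<And>a v. a \<in> V \<Longrightarrow> v \<in> I \<Longrightarrow> a * v \<in> I"
    and T3: "\<And>a b c. a \<in> V \<Longrightarrow> b \<in> V \<Longrightarrow> c \<in> V \<Longrightarrow> sym3 a b c \<in> I"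
    and T4: "\<And>a b c e. a \<in> V \<Longrightarrow> b \<in> V \<Longrightarrow> c \<in> V \<Longrightarrow> e \<in> V \<Longrightarrow> sym3 a b (c * e) \<in> I"
    and T5: "\<And>a b c e f. a \<in> V \<Longrightarrow> b \<in> V \<Longrightarrow> c \<in> V \<Longrightarrow> e \<in> V \<Longrightarrow> f \<in> V \<Longrightarrow> sym3 a (b * c) (e * f) \<in> I"
    and V: "x \<in> V" "y \<in> V" "z \<in> V"
  shows "x * x * z * y * y \<in> I"
proof -
  have c: "sym3 a b c = sym3 b a c" "sym3 a b c = sym3 a c b" for a b c :: 'b
    by (simp_all add: sym3_def algebra_simps)
  have "6 * (x * x * z * y * y) = 2 * (sym3 x (y * y) z * x) - 2 * sym3 x (y * y) (z * x)
      - x * (z * sym3 x y y) + sym3 x x (z * y) * y + 2 * (sym3 x x z * y * y) - z * sym3 (x * x) y y"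
    by (simp add: sym3_def numeral_mult_expand algebra_simps)
  also have "\<dots> \<in> I"
  proof (intro add_mem diff_mem numeral_mult_mem)
    show "sym3 x (y * y) z * x \<in> I" using right T4[of x z y y] V c(2)[of x z] by simp
    show "sym3 x (y * y) (z * x) \<in> I" using T5 V by simp
    show "x * (z * sym3 x y y) \<in> I" using left T3 V by simp
    show "sym3 x x (z * y) * y \<in> I" using right T4 V by simp
    show "sym3 x x z * y * y \<in> I" using right T3 V by simp
    show "z * sym3 (x * x) y y \<in> I" using left T4[of y y x x] V c(1)[of "x * x" y y] c(2)[of y "x * x" y] by simp
  qed
  finally show ?thesis by (rule cancel6[OF p])
qed

text \<open>The hypotheses are memberships in degree 5 rather than closure properties, because
  \<open>I\<close> will be a preimage as in \<open>preimage_mult\<close>. Given that products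
  starting with an anticommutator vanish, the same is shown for anticommutators in the other
  positions.\<close>

lemma five_letters_mem:
  assumes p: "p > 3" and add: "\<And>a b. a \<in> V \<Longrightarrow> b \<in> V \<Longrightarrow> a + b \<in> V"
    and T3: "\<And>a b c e f. a \<in> V \<Longrightarrow> b \<in> V \<Longrightarrow> c \<in> V \<Longrightarrow> e \<in> V \<Longrightarrow> f \<in> V \<Longrightarrow> a * b * sym3 c e f \<in> I"
    and T4: "\<And>a b c e f. a \<in> V \<Longrightarrow> b \<in> V \<Longrightarrow> c \<in> V \<Longrightarrow> e \<in> V \<Longrightarrow> f \<in> V \<Longrightarrow> sym3 a b (c * e) * f \<in> I"
    and T3': "\<And>a b c e f. a \<in> V \<Longrightarrow> b \<in> V \<Longrightarrow> c \<in> V \<Longrightarrow> e \<in> V \<Longrightarrow> f \<in> V \<Longrightarrow> a * sym3 b c e * f \<in> I"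
    and T4': "\<And>a b c e f. a \<in> V \<Longrightarrow> b \<in> V \<Longrightarrow> c \<in> V \<Longrightarrow> e \<in> V \<Longrightarrow> f \<in> V \<Longrightarrow> a * sym3 b c (e * f) \<in> I"
    and T5: "\<And>a b c e f. a \<in> V \<Longrightarrow> b \<in> V \<Longrightarrow> c \<in> V \<Longrightarrow> e \<in> V \<Longrightarrow> f \<in> V \<Longrightarrow> sym3 a (b * c) (e * f) \<in> I"
    and S: "\<And>a b c e f. a \<in> V \<Longrightarrow> b \<in> V \<Longrightarrow> c \<in> V \<Longrightarrow> e \<in> V \<Longrightarrow> f \<in> V \<Longrightarrow> anticomm a b * c * e * f \<in> I"
    and V: "a \<in> V" "b \<in> V" "c \<in> V" "e \<in> V" "f \<in> V"
  shows "a * b * c * e * f \<in> I"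
proof -
  note defs = sym3_def anticomm_def
  \<comment> \<open>Up to division by 2, \<open>S1\<close> to \<open>D\<close> reduce the words with
    first letter \<open>u\<close> and two letters \<open>x\<close> to multiples of
    \<open>u * v * x * x * w\<close>; \<open>A\<close> then kills this word.\<close>
  have S1: "u * v * x * x * w - u * x * v * x * w \<in> I" if "u \<in> V" "v \<in> V" "x \<in> V" "w \<in> V" for u v x w
  proof (rule cancel2[OF p])
    have "2 * (u * v * x * x * w - u * x * v * x * w) = sym3 x x (u * v) * w - anticomm x x * u * v * w
        - 2 * (anticomm x u * v * x * w)"
      by (simp add: defs numeral_mult_expand algebra_simps)
    also have "\<dots> \<in> I" by (intro diff_mem numeral_mult_mem T4 S that)
    finally show "2 * (u * v * x * x * w - u * x * v * x * w) \<in> I" .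
  qed
  have S2: "u * x * x * v * w + 2 * (u * v * x * x * w) \<in> I" if "u \<in> V" "v \<in> V" "x \<in> V" "w \<in> V" for u v x w
  proof (rule cancel2[OF p])
    have "2 * (u * x * x * v * w + 2 * (u * v * x * x * w)) = u * sym3 x x v * w
        + 2 * (u * v * x * x * w - u * x * v * x * w)"
      by (simp add: defs numeral_mult_expand algebra_simps)
    also have "\<dots> \<in> I" by (intro add_mem numeral_mult_mem T3' S1 that)
    finally show "2 * (u * x * x * v * w + 2 * (u * v * x * x * w)) \<in> I" .
  qed
  have F: "u * v * x * w * x + u * v * w * x * x + u * v * x * x * w \<in> I"
    if "u \<in> V" "v \<in> V" "x \<in> V" "w \<in> V" for u v x w
  proof (rule cancel2[OF p])
    have "2 * (u * v * x * w * x + u * v * w * x * x + u * v * x * x * w) = u * v * sym3 x x w"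
      by (simp add: defs numeral_mult_expand algebra_simps)
    also have "\<dots> \<in> I" by (intro T3 that)
    finally show "2 * (u * v * x * w * x + u * v * w * x * x + u * v * x * x * w) \<in> I" .
  qed
  have G: "u * x * v * w * x + u * v * w * x * x - 2 * (u * v * x * x * w) \<in> I"
    if "u \<in> V" "v \<in> V" "x \<in> V" "w \<in> V" for u v x w
  proof (rule cancel2[OF p])
    have "2 * (u * x * v * w * x + u * v * w * x * x - 2 * (u * v * x * x * w)) = u * sym3 x x (v * w)
        - 2 * (u * x * x * v * w + 2 * (u * v * x * x * w))"
      by (simp add: defs numeral_mult_expand algebra_simps)
    also have "\<dots> \<in> I" by (intro diff_mem numeral_mult_mem T4' S2 that)
    finally show "2 * (u * x * v * w * x + u * v * w * x * x - 2 * (u * v * x * x * w)) \<in> I" .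
  qed
  have E: "u * v * w * x * x - u * w * v * x * x - 3 * (u * v * x * x * w) \<in> I"
    if "u \<in> V" "v \<in> V" "x \<in> V" "w \<in> V" for u v x w
  proof -
    have "u * v * w * x * x - u * w * v * x * x - 3 * (u * v * x * x * w) =
        sym3 w x (u * v) * x - anticomm w x * u * v * x - anticomm w u * v * x * x - anticomm x u * v * w * x
        + (u * x * v * w * x + u * v * w * x * x - 2 * (u * v * x * x * w))
        - (u * v * x * w * x + u * v * w * x * x + u * v * x * x * w)"
      by (simp add: defs numeral_mult_expand algebra_simps)
    also have "\<dots> \<in> I" by (intro diff_mem add_mem T4 S F G that)
    finally show ?thesis .
  qed
  have swap: "u * v * x * x * w + u * w * x * x * v \<in> I"
    if "u \<in> V" "v \<in> V" "x \<in> V" "w \<in> V" for u v x w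
  proof (rule cancel3[OF p])
    have "3 * (u * v * x * x * w + u * w * x * x * v) =
       - ((u * v * w * x * x - u * w * v * x * x - 3 * (u * v * x * x * w))
          + (u * w * v * x * x - u * v * w * x * x - 3 * (u * w * x * x * v)))"
      by (simp add: algebra_simps)
    also have "\<dots> \<in> I" by (intro uminus_mem add_mem E that)
    finally show "3 * (u * v * x * x * w + u * w * x * x * v) \<in> I" .
  qed
  have D: "2 * (u * v * w * x * x) - 3 * (u * v * x * x * w) \<in> I"
    if "u \<in> V" "v \<in> V" "x \<in> V" "w \<in> V" for u v x w
  proof -
    have "2 * (u * v * w * x * x) - 3 * (u * v * x * x * w) =
       (u * w * x * v * x + u * w * v * x * x + u * w * x * x * v)
       + (u * x * w * v * x + u * w * v * x * x - 2 * (u * w * x * x * v))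
       + (u * x * v * w * x + u * v * w * x * x - 2 * (u * v * x * x * w))
       + (u * v * x * w * x + u * v * w * x * x + u * v * x * x * w)
       + (u * v * x * x * w + u * w * x * x * v) - u * sym3 w x v * x
       + (u * v * w * x * x - u * w * v * x * x - 3 * (u * v * x * x * w))"
      by (simp add: defs numeral_mult_expand algebra_simps)
    also have "\<dots> \<in> I" by (intro diff_mem add_mem T3' F G E swap that)
    finally show ?thesis .
  qed
  have A: "u * v * x * x * w \<in> I" if "u \<in> V" "v \<in> V" "x \<in> V" "w \<in> V" for u v x w
  proof (rule cancel2[OF p])
    have "2 * (u * v * x * x * w) = anticomm x x * u * v * w
       + 2 * (anticomm x v * w * x * u + (v * w * x * x * u - v * x * w * x * u)
          + anticomm x u * x * v * w - (u * x * x * v * w + 2 * (u * v * x * x * w))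
          + anticomm x u * v * w * x - (u * x * v * w * x + u * v * w * x * x - 2 * (u * v * x * x * w))
          + (v * w * x * u * x + v * w * u * x * x + v * w * x * x * u))
       + (2 * (u * v * w * x * x) - 3 * (u * v * x * x * w))
       - (2 * (v * w * u * x * x) - 3 * (v * w * x * x * u))
       - 5 * (v * w * x * x * u + v * u * x * x * w - anticomm v u * x * x * w)
       - 2 * sym3 x (x * u) (v * w)"
      by (simp add: defs numeral_mult_expand algebra_simps)
    also have "\<dots> \<in> I"
      by (intro diff_mem add_mem numeral_mult_mem S S1 S2 F G D swap T5 that)
    finally show "2 * (u * v * x * x * w) \<in> I" .
  qed
  have B: "u * x * x * v * w \<in> I" if "u \<in> V" "v \<in> V" "x \<in> V" "w \<in> V" for u v x w
  proof -
    have "u * x * x * v * w = (u * x * x * v * w + 2 * (u * v * x * x * w)) - 2 * (u * v * x * x * w)" by simp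
    also have "\<dots> \<in> I" by (intro diff_mem numeral_mult_mem S2 A that)
    finally show ?thesis .
  qed
  have C: "u * v * w * x * x \<in> I" if "u \<in> V" "v \<in> V" "x \<in> V" "w \<in> V" for u v x w
  proof (rule cancel2[OF p])
    have "2 * (u * v * w * x * x) = (2 * (u * v * w * x * x) - 3 * (u * v * x * x * w)) + 3 * (u * v * x * x * w)" by simp
    also have "\<dots> \<in> I" by (intro add_mem numeral_mult_mem D A that)
    finally show "2 * (u * v * w * x * x) \<in> I" .
  qed
  have polar: "q (anticomm x y) \<in> I"
    if "x \<in> V" "y \<in> V" "\<And>x. x \<in> V \<Longrightarrow> q (x * x) \<in> I" "\<And>g h. q (g + h) = q g + q h" for q x y
  proof -
    have "q ((x + y) * (x + y)) = q (x * x) + q (y * y) + q (anticomm x y)"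
      by (simp add: defs that(4) algebra_simps)
    moreover have "q ((x + y) * (x + y)) \<in> I" "q (x * x) + q (y * y) \<in> I"
      using that add by (auto intro: add_mem)
    ultimately show ?thesis by (metis add_mem_cancel)
  qed
  have S2': "u * anticomm x y * v * w \<in> I" if "u \<in> V" "v \<in> V" "x \<in> V" "y \<in> V" "w \<in> V" for u v x y w
    using polar[of x y "\<lambda>g. u * g * v * w"] B that by (simp add: algebra_simps)
  have S3': "u * v * anticomm x y * w \<in> I" if "u \<in> V" "v \<in> V" "x \<in> V" "y \<in> V" "w \<in> V" for u v x y w
    using polar[of x y "\<lambda>g. u * v * g * w"] A that by (simp add: algebra_simps)
  have S4': "u * v * w * anticomm x y \<in> I" if "u \<in> V" "v \<in> V" "x \<in> V" "y \<in> V" "w \<in> V" for u v x y w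
    using polar[of x y "\<lambda>g. u * v * w * g"] C that by (simp add: algebra_simps)
  show ?thesis
  proof (rule cancel6[OF p])
    \<comment> \<open>Exchanging neighbours now only changes the sign. The factors
      \<open>a * b\<close> and \<open>c * e\<close> have even degree, so all six products in the
      symmetrised sum equal \<open>a * b * c * e * f\<close>; the bracket records the
      exchanges.\<close>
    have "6 * (a * b * c * e * f) = sym3 (a * b) (c * e) f
      - (a * b * anticomm f c * e - a * b * c * anticomm f e
        + c * anticomm e a * b * f - anticomm c a * e * b * f + a * c * anticomm e b * f - a * anticomm c b * e * f
        + c * e * anticomm f a * b - c * anticomm e a * f * b + anticomm c a * e * f * b - a * c * e * anticomm f b
        + a * c * anticomm e b * f - a * anticomm c b * e * f
        + anticomm f a * b * c * e - a * anticomm f b * c * e + a * b * anticomm f c * e - a * b * c * anticomm f e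
        + anticomm f c * e * a * b - c * anticomm f e * a * b + c * e * anticomm f a * b - c * anticomm e a * f * b
        + anticomm c a * e * f * b - a * c * e * anticomm f b + a * c * anticomm e b * f - a * anticomm c b * e * f)"
      by (simp add: defs numeral_mult_expand algebra_simps)
    also have "sym3 (a * b) (c * e) f = sym3 f (a * b) (c * e)" by (simp add: defs numeral_mult_expand algebra_simps)
    also have "sym3 f (a * b) (c * e)
      - (a * b * anticomm f c * e - a * b * c * anticomm f e
        + c * anticomm e a * b * f - anticomm c a * e * b * f + a * c * anticomm e b * f - a * anticomm c b * e * f
        + c * e * anticomm f a * b - c * anticomm e a * f * b + anticomm c a * e * f * b - a * c * e * anticomm f b
        + a * c * anticomm e b * f - a * anticomm c b * e * f
        + anticomm f a * b * c * e - a * anticomm f b * c * e + a * b * anticomm f c * e - a * b * c * anticomm f e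
        + anticomm f c * e * a * b - c * anticomm f e * a * b + c * e * anticomm f a * b - c * anticomm e a * f * b
        + anticomm c a * e * f * b - a * c * e * anticomm f b + a * c * anticomm e b * f - a * anticomm c b * e * f) \<in> I"
      by (intro diff_mem add_mem T5 S S2' S3' S4' V)
    finally show "6 * (a * b * c * e * f) \<in> I" .
  qed
qed

text \<open>Both squares in \<open>square_sandwich_mem\<close> are polarised, which uses that
  \<open>V\<close> is closed under addition.\<close>

lemma anticomm_sandwich_mem:
  assumes p: "p > 3" and add: "\<And>a b. a \<in> V \<Longrightarrow> b \<in> V \<Longrightarrow> a + b \<in> V"
    and right: "\<And>a v. a \<in> V \<Longrightarrow> v \<in> I \<Longrightarrow> v * a \<in> I" and left: "\<And>a v. a \<in> V \<Longrightarrow> v \<in> I \<Longrightarrow> a * v \<in> I"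
    and T3: "\<And>a b c. a \<in> V \<Longrightarrow> b \<in> V \<Longrightarrow> c \<in> V \<Longrightarrow> sym3 a b c \<in> I"
    and T4: "\<And>a b c e. a \<in> V \<Longrightarrow> b \<in> V \<Longrightarrow> c \<in> V \<Longrightarrow> e \<in> V \<Longrightarrow> sym3 a b (c * e) \<in> I"
    and T5: "\<And>a b c e f. a \<in> V \<Longrightarrow> b \<in> V \<Longrightarrow> c \<in> V \<Longrightarrow> e \<in> V \<Longrightarrow> f \<in> V \<Longrightarrow> sym3 a (b * c) (e * f) \<in> I"
    and V: "x \<in> V" "x' \<in> V" "z \<in> V" "y \<in> V" "y' \<in> V"
  shows "anticomm x x' * z * anticomm y y' \<in> I"
proof -
  have sq: "x * x * z * y * y \<in> I" if "x \<in> V" "y \<in> V" "z \<in> V" for x y z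
    by (rule square_sandwich_mem[OF p right left T3 T4 T5]) (use that in auto)
  have 1: "anticomm x x' * z * y * y \<in> I" if "y \<in> V" for y
  proof -
    have "anticomm x x' * z * y * y = (x + x') * (x + x') * z * y * y - x * x * z * y * y - x' * x' * z * y * y"
      by (simp add: anticomm_def algebra_simps)
    then show ?thesis using sq add V that by (simp add: diff_mem)
  qed
  have "anticomm x x' * z * anticomm y y' =
      anticomm x x' * z * (y + y') * (y + y') - anticomm x x' * z * y * y - anticomm x x' * z * y' * y'"
    by (simp add: anticomm_def algebra_simps)
  then show ?thesis using 1 add V by (simp add: diff_mem)
qed

text \<open>Modulo the symmetrised products, \<open>V\<^sup>5\<close> lies in \<open>s V\<^sup>3\<close> with \<open>s\<close> the span of the anticommutators,
  hence \<open>V\<^sup>8 = V\<^sup>5 V\<^sup>3 = s V V\<^sup>5\<close> lies in \<open>s V s V\<^sup>3 = 0\<close>.\<close>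

theorem eight_letters_mem:
  assumes p: "p > 3" and add: "\<And>a b. a \<in> V \<Longrightarrow> b \<in> V \<Longrightarrow> a + b \<in> V"
    and right: "\<And>a v. a \<in> V \<Longrightarrow> v \<in> I \<Longrightarrow> v * a \<in> I" and left: "\<And>a v. a \<in> V \<Longrightarrow> v \<in> I \<Longrightarrow> a * v \<in> I"
    and T3: "\<And>a b c. a \<in> V \<Longrightarrow> b \<in> V \<Longrightarrow> c \<in> V \<Longrightarrow> sym3 a b c \<in> I"
    and T4: "\<And>a b c e. a \<in> V \<Longrightarrow> b \<in> V \<Longrightarrow> c \<in> V \<Longrightarrow> e \<in> V \<Longrightarrow> sym3 a b (c * e) \<in> I"
    and T5: "\<And>a b c e f. a \<in> V \<Longrightarrow> b \<in> V \<Longrightarrow> c \<in> V \<Longrightarrow> e \<in> V \<Longrightarrow> f \<in> V \<Longrightarrow> sym3 a (b * c) (e * f) \<in> I"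
    and V: "a\<^sub>1 \<in> V" "a\<^sub>2 \<in> V" "a\<^sub>3 \<in> V" "a\<^sub>4 \<in> V" "a\<^sub>5 \<in> V" "a\<^sub>6 \<in> V" "a\<^sub>7 \<in> V" "a\<^sub>8 \<in> V"
  shows "a\<^sub>1 * a\<^sub>2 * a\<^sub>3 * a\<^sub>4 * a\<^sub>5 * a\<^sub>6 * a\<^sub>7 * a\<^sub>8 \<in> I"
proof -
  have tail: "anticomm x y * z * (a * b * c * e * f) \<in> I"
    if V: "x \<in> V" "y \<in> V" "z \<in> V" "a \<in> V" "b \<in> V" "c \<in> V" "e \<in> V" "f \<in> V" for x y z a b c e f
  proof -
    interpret Z: coprime_subgroup "{v. anticomm x y * z * v * 1 \<in> I}" p by (rule preimage_mult)
    have l: "anticomm x y * z * v \<in> I" if "v \<in> I" for v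
      using left V that by (simp add: anticomm_def distrib_right mult.assoc add_mem)
    have "a * b * c * e * f \<in> {v. anticomm x y * z * v * 1 \<in> I}"
    proof (rule Z.five_letters_mem[OF p add])
      fix a b c e f assume *: "a \<in> V" "b \<in> V" "c \<in> V" "e \<in> V" "f \<in> V"
      have "anticomm x y * z * anticomm a b \<in> I"
        by (rule anticomm_sandwich_mem[OF p add right left T3 T4 T5]) (use V * in auto)
      then have "anticomm x y * z * anticomm a b * c * e * f \<in> I" using right * by simp
      then show "anticomm a b * c * e * f \<in> {v. anticomm x y * z * v * 1 \<in> I}" by (simp add: mult.assoc)
      show "a * b * sym3 c e f \<in> {v. anticomm x y * z * v * 1 \<in> I}"
        using l[of "a * (b * sym3 c e f)"] left T3 * by (simp add: mult.assoc)
      show "sym3 a b (c * e) * f \<in> {v. anticomm x y * z * v * 1 \<in> I}"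
        using l[of "sym3 a b (c * e) * f"] right T4 * by simp
      show "a * sym3 b c e * f \<in> {v. anticomm x y * z * v * 1 \<in> I}"
        using l[of "a * sym3 b c e * f"] left right T3 * by simp
      show "a * sym3 b c (e * f) \<in> {v. anticomm x y * z * v * 1 \<in> I}"
        using l[of "a * sym3 b c (e * f)"] left T4 * by simp
      show "sym3 a (b * c) (e * f) \<in> {v. anticomm x y * z * v * 1 \<in> I}"
        using l[of "sym3 a (b * c) (e * f)"] T5 * by simp
    qed (use V in auto)
    then show ?thesis by simp
  qed
  interpret Z: coprime_subgroup "{v. 1 * v * (a\<^sub>6 * a\<^sub>7 * a\<^sub>8) \<in> I}" p by (rule preimage_mult)
  have r: "v * (a\<^sub>6 * a\<^sub>7 * a\<^sub>8) \<in> I" if "v \<in> I" for v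
    using right[OF V(8) right[OF V(7) right[OF V(6) that]]] by (simp add: mult.assoc)
  have "a\<^sub>1 * a\<^sub>2 * a\<^sub>3 * a\<^sub>4 * a\<^sub>5 \<in> {v. 1 * v * (a\<^sub>6 * a\<^sub>7 * a\<^sub>8) \<in> I}"
  proof (rule Z.five_letters_mem[OF p add])
    fix a b c e f assume *: "a \<in> V" "b \<in> V" "c \<in> V" "e \<in> V" "f \<in> V"
    show "anticomm a b * c * e * f \<in> {v. 1 * v * (a\<^sub>6 * a\<^sub>7 * a\<^sub>8) \<in> I}"
      using tail[of a b c e f a\<^sub>6 a\<^sub>7 a\<^sub>8] V * by (simp add: mult.assoc)
    show "a * b * sym3 c e f \<in> {v. 1 * v * (a\<^sub>6 * a\<^sub>7 * a\<^sub>8) \<in> I}"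
      using r[of "a * (b * sym3 c e f)"] left T3 * by (simp add: mult.assoc)
    show "sym3 a b (c * e) * f \<in> {v. 1 * v * (a\<^sub>6 * a\<^sub>7 * a\<^sub>8) \<in> I}"
      using r[of "sym3 a b (c * e) * f"] right T4 * by simp
    show "a * sym3 b c e * f \<in> {v. 1 * v * (a\<^sub>6 * a\<^sub>7 * a\<^sub>8) \<in> I}"
      using r[of "a * sym3 b c e * f"] left right T3 * by simp
    show "a * sym3 b c (e * f) \<in> {v. 1 * v * (a\<^sub>6 * a\<^sub>7 * a\<^sub>8) \<in> I}"
      using r[of "a * sym3 b c (e * f)"] left T4 * by simp
    show "sym3 a (b * c) (e * f) \<in> {v. 1 * v * (a\<^sub>6 * a\<^sub>7 * a\<^sub>8) \<in> I}"
      using r[of "sym3 a (b * c) (e * f)"] T5 * by simp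
  qed (use V in auto)
  then show ?thesis by (simp add: mult.assoc)
qed

end

subsection \<open>Spans of cubes\<close>

text \<open>The outer factors are words, possibly empty, so that a product of elements can be
  expanded term by term into words in letters and cubes.\<close>

inductive_set cube_span :: "(nat fword \<Rightarrow>\<^sub>0 'a::field) set \<Rightarrow> nat \<Rightarrow> (nat fword \<Rightarrow>\<^sub>0 'a) set"
  for L d where
  zero: "0 \<in> cube_span L d"
| step: "z \<in> cube_span L d \<Longrightarrow> f \<in> L \<Longrightarrow> set u \<subseteq> {1..d} \<Longrightarrow> set v \<subseteq> {1..d} \<Longrightarrow>
    z + const c * (mon u * f ^ 3 * mon v) \<in> cube_span L d"

lemma cube_span_add: "y \<in> cube_span L d \<Longrightarrow> z \<in> cube_span L d \<Longrightarrow> z + y \<in> cube_span L d"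
proof (induction y rule: cube_span.induct)
  case (step y f u v c)
  then show ?case using cube_span.step[of "z + y" L d f u v c] by (simp add: add.assoc)
qed simp

lemma cube_span_scale: "z \<in> cube_span L d \<Longrightarrow> const b * z \<in> cube_span L d"
proof (induction z rule: cube_span.induct)
  case (step z f u v c)
  have "const b * (z + const c * (mon u * f ^ 3 * mon v)) = const b * z + const (b * c) * (mon u * f ^ 3 * mon v)"
    by (simp add: distrib_left const_mult mult.assoc del: mult_single)
  then show ?case using cube_span.step[OF step.IH step.hyps(2-4), of "b * c"] by simp
qed (simp add: cube_span.zero)

lemma cube_span_mon_left: "z \<in> cube_span L d \<Longrightarrow> set w \<subseteq> {1..d} \<Longrightarrow> mon w * z \<in> cube_span L d"
proof (induction z rule: cube_span.induct)
  case (step z f u v c)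
  have "mon w * (const c * x) = const c * (mon w * x)" for x :: "nat fword \<Rightarrow>\<^sub>0 'a"
    by (metis const_mult_commute mult.assoc)
  then have "mon w * (z + const c * (mon u * f ^ 3 * mon v)) = mon w * z + const c * (mon (w @ u) * f ^ 3 * mon v)"
    by (simp add: distrib_left mon_append mult.assoc)
  then show ?case
    using cube_span.step[OF step.IH[OF step.prems] step.hyps(2) _ step.hyps(4), of "w @ u" c] step by simp
qed (simp add: cube_span.zero)

lemma cube_span_mon_right: "z \<in> cube_span L d \<Longrightarrow> set w \<subseteq> {1..d} \<Longrightarrow> z * mon w \<in> cube_span L d"
proof (induction z rule: cube_span.induct)
  case (step z f u v c)
  have "(z + const c * (mon u * f ^ 3 * mon v)) * mon w = z * mon w + const c * (mon u * f ^ 3 * mon (v @ w))"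
    by (simp add: distrib_right mon_append mult.assoc)
  then show ?case
    using cube_span.step[OF step.IH[OF step.prems] step.hyps(2,3), of "v @ w" c] step by simp
qed (simp add: cube_span.zero)

lemma cube_span_cube: "f \<in> L \<Longrightarrow> f ^ 3 \<in> cube_span L d"
  using cube_span.step[OF cube_span.zero, of f L "[]" d "[]" 1] by (simp add: mon_Nil)

lemma cube_span_coprime_subgroup:
  fixes L :: "(nat fword \<Rightarrow>\<^sub>0 'a::field) set"
  assumes "CHAR('a) > 0"
  shows "coprime_subgroup (cube_span L d) (CHAR('a))"
proof
  show "prime CHAR('a)" using assms by (rule prime_CHAR_semidom)
  fix q and f :: "nat fword \<Rightarrow>\<^sub>0 'a"
  assume q: "\<not> CHAR('a) dvd q" "of_nat q * f \<in> cube_span L d"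
  then have "(of_nat q :: 'a) \<noteq> 0" by (simp add: of_nat_eq_0_iff_char_dvd)
  then have "const (inverse (of_nat q)) * (of_nat q * f) = f"
    by (simp add: mult.assoc[symmetric] of_nat_single[symmetric] mult_single flip: single_of_nat)
  then show "f \<in> cube_span L d" using cube_span_scale[OF q(2), of "inverse (of_nat q)"] by simp
next
  fix a b assume ab: "a \<in> cube_span L d" "b \<in> cube_span L d"
  have "a + const (-1) * b \<in> cube_span L d" by (intro cube_span_add cube_span_scale ab)
  then show "a - b \<in> cube_span L d" by (simp add: single_uminus)
qed (rule cube_span.zero)

section \<open>Symmetrised products from finitely many cubes\<close>

lemma sym3_add:
  "sym3 (a + a') b c = sym3 a b c + sym3 a' b c"
  "sym3 a (b + b') c = sym3 a b c + sym3 a b' c"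
  "sym3 a b (c + c') = sym3 a b c + sym3 a b c'"
  by (simp_all add: sym3_def algebra_simps)

definition sum_diffs :: "'r::ab_group_add set \<Rightarrow> 'r set \<Rightarrow> 'r set" where
  "sum_diffs P U = (\<lambda>(x, u). x + u) ` (P \<times> U) \<union> (\<lambda>(x, u). x - u) ` (P \<times> U)"

text \<open>The values of a quadratic map at these points determine its polarisation on
  \<open>X\<close>.\<close>

definition polar :: "'r::comm_monoid_add set \<Rightarrow> 'r set" where
  "polar X = X \<union> (\<lambda>S. \<Sum>x\<in>S. x) ` {S. S \<subseteq> X \<and> card S = 2}"

lemma card_sum_diffs:
  assumes "finite P" "finite U"
  shows "finite (sum_diffs P U)" "card (sum_diffs P U) \<le> 2 * card P * card U"
proof -
  have "card (sum_diffs P U) \<le> card ((\<lambda>(x, u). x + u) ` (P \<times> U)) + card ((\<lambda>(x, u). x - u) ` (P \<times> U))"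
    unfolding sum_diffs_def by (rule card_Un_le)
  also have "\<dots> \<le> card (P \<times> U) + card (P \<times> U)"
    using assms by (intro add_mono card_image_le) auto
  finally show "card (sum_diffs P U) \<le> 2 * card P * card U" by (simp add: card_cartesian_product)
qed (use assms in \<open>simp add: sum_diffs_def\<close>)

lemma card_polar:
  assumes "finite X" "card X \<le> m"
  shows "finite (polar X)" "2 * card (polar X) \<le> m * (m + 1)"
proof -
  have fin: "finite {S. S \<subseteq> X \<and> card S = 2}" using assms(1) by simp
  then show "finite (polar X)" using assms(1) by (simp add: polar_def)
  have "card (polar X) \<le> card X + card ((\<lambda>S. \<Sum>x\<in>S. x) ` {S. S \<subseteq> X \<and> card S = 2})"
    unfolding polar_def by (rule card_Un_le)
  also have "\<dots> \<le> card X + (card X choose 2)"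
    using n_subsets[OF assms(1), of 2] card_image_le[OF fin, of "\<lambda>S. \<Sum>x\<in>S. x"] by simp
  finally have "2 * card (polar X) \<le> 2 * card X + 2 * (card X choose 2)" by linarith
  also have "\<dots> = card X * (card X + 1)"
    by (cases "card X") (simp_all add: choose_two)
  also have "\<dots> \<le> m * (m + 1)" using assms(2) by (intro mult_mono) auto
  finally show "2 * card (polar X) \<le> m * (m + 1)" .
qed

lemma polar_add: "x \<in> X \<Longrightarrow> y \<in> X \<Longrightarrow> x \<noteq> y \<Longrightarrow> x + y \<in> polar X"
  unfolding polar_def by (rule UnI2, rule image_eqI[of _ _ "{x, y}"]) auto

text \<open>(x + u)^3 - (x - u)^3 - 2 u^3 is twice the part that is linear in u and quadratic in x.
  Only x is then polarised, so sums of two elements are taken in \<open>X\<close> but not in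
  \<open>U\<close>.\<close>

lemma (in coprime_subgroup) sym3_mem_of_cubes:
  assumes p: "p > 3" and cube: "\<And>f. f \<in> sum_diffs (polar X) U \<union> U \<Longrightarrow> f ^ 3 \<in> I"
    and "x \<in> X" "y \<in> X" "u \<in> U"
  shows "sym3 x y u \<in> I"
proof -
  have lin: "x * x * u + x * u * x + u * x * x \<in> I" if "x \<in> polar X" for x
  proof (rule cancel2[OF p])
    have "x + u \<in> sum_diffs (polar X) U" "x - u \<in> sum_diffs (polar X) U"
      using that assms(5) unfolding sum_diffs_def by force+
    then have "(x + u) ^ 3 \<in> I" "(x - u) ^ 3 \<in> I" "u ^ 3 \<in> I" using cube assms(5) by auto
    moreover have "2 * (x * x * u + x * u * x + u * x * x) = (x + u) ^ 3 - (x - u) ^ 3 - 2 * u ^ 3"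
      by (simp add: numeral_mult_expand power3_eq_cube algebra_simps)
    ultimately show "2 * (x * x * u + x * u * x + u * x * x) \<in> I"
      by (simp add: diff_mem numeral_mult_mem)
  qed
  have X: "x \<in> polar X" "y \<in> polar X" using assms by (auto simp: polar_def)
  show ?thesis
  proof (cases "x = y")
    case True
    have "sym3 x y u = 2 * (x * x * u + x * u * x + u * x * x)"
      using True by (simp add: sym3_def numeral_mult_expand algebra_simps)
    then show ?thesis using numeral_mult_mem[OF lin[OF X(1)]] by metis
  next
    case False
    have "sym3 x y u = ((x + y) * (x + y) * u + (x + y) * u * (x + y) + u * (x + y) * (x + y))
        - (x * x * u + x * u * x + u * x * x) - (y * y * u + y * u * y + u * y * y)"
      by (simp add: sym3_def algebra_simps)
    then show ?thesis using lin X polar_add[OF assms(3,4) False] by (metis diff_mem)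
  qed
qed

text \<open>\<open>eight_letters_mem\<close> polarises inside a set closed under addition, whereas
  only finitely many cubes are available. Additivity of \<open>sym3\<close> carries the relations
  from letters to these sums.\<close>

inductive_set letter_sums :: "nat \<Rightarrow> (nat fword \<Rightarrow>\<^sub>0 'a::field) set" for d where
  letter: "i \<in> {1..d} \<Longrightarrow> mon [i] \<in> letter_sums d"
| add: "a \<in> letter_sums d \<Longrightarrow> b \<in> letter_sums d \<Longrightarrow> a + b \<in> letter_sums d"

lemma letter_sums_additive:
  assumes "\<And>i. i \<in> {1..d} \<Longrightarrow> q (mon [i]) \<in> I" "\<And>a b. q (a + b) = q a + q b"
    and "\<And>a b. a \<in> I \<Longrightarrow> b \<in> I \<Longrightarrow> a + b \<in> I" and "a \<in> letter_sums d"
  shows "q a \<in> I"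
  using assms(4) by (induction a rule: letter_sums.induct) (simp_all add: assms)

definition words :: "nat \<Rightarrow> nat \<Rightarrow> (nat fword \<Rightarrow>\<^sub>0 'a::field) set" where
  "words d k = mon ` {w. set w \<subseteq> {1..d} \<and> length w = k}"

lemma card_words: "finite (words d k)" "card (words d k) \<le> d ^ k"
proof -
  have fin: "finite {w. set w \<subseteq> {1..d} \<and> length w = k}" by (rule finite_lists_length_eq) simp
  then show "finite (words d k)" by (simp add: words_def)
  show "card (words d k) \<le> d ^ k"
    using card_image_le[OF fin, of mon] card_lists_length_eq[of "{1..d}" k] by (simp add: words_def)
qed

lemma words_1: "i \<in> {1..d} \<Longrightarrow> mon [i] \<in> words d 1"
  and words_2: "i \<in> {1..d} \<Longrightarrow> j \<in> {1..d} \<Longrightarrow> mon [i] * mon [j] \<in> words d 2"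
  by (auto simp: words_def simp flip: mon_append)

text \<open>The elements whose cubes are used to express all words of length 8.\<close>

definition cube_roots :: "nat \<Rightarrow> (nat fword \<Rightarrow>\<^sub>0 'a::field) set" where
  "cube_roots d = (let U = words d 1 \<union> words d 2 in
     (sum_diffs (polar (words d 1)) U \<union> U) \<union> (sum_diffs (polar (words d 2)) (words d 1) \<union> words d 1))"

lemma card_cube_roots:
  "finite (cube_roots d :: (nat fword \<Rightarrow>\<^sub>0 'a::field) set)"
  "card (cube_roots d :: (nat fword \<Rightarrow>\<^sub>0 'a) set) \<le> d\<^sup>2 * (d + 1)\<^sup>2 + d * (d + 1) + d ^ 3 * (d\<^sup>2 + 1)"
proof -
  define U :: "(nat fword \<Rightarrow>\<^sub>0 'a::field) set" where "U = words d 1 \<union> words d 2"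
  define X :: "(nat fword \<Rightarrow>\<^sub>0 'a::field) set" where "X = words d 1"
  define W :: "(nat fword \<Rightarrow>\<^sub>0 'a::field) set" where "W = words d 2"
  have X: "finite X" "card X \<le> d" using card_words[of d 1] by (simp_all add: X_def)
  have W: "finite W" "card W \<le> d\<^sup>2" using card_words[of d 2] by (simp_all add: W_def)
  have U: "finite U" "card U \<le> d * (d + 1)"
    using X W card_Un_le[of X W] by (simp_all add: U_def X_def W_def power2_eq_square)
  note PX = card_polar[OF X] and PW = card_polar[OF W]
  have eq: "cube_roots d = (sum_diffs (polar X) U \<union> U) \<union> sum_diffs (polar W) X"
    unfolding cube_roots_def Let_def U_def X_def W_def by blast
  show "finite (cube_roots d :: (nat fword \<Rightarrow>\<^sub>0 'a) set)"
    unfolding eq by (intro finite_UnI card_sum_diffs(1) PX(1) PW(1) X(1) U(1))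
  have "card (cube_roots d :: (nat fword \<Rightarrow>\<^sub>0 'a) set) \<le> card (sum_diffs (polar X) U) + card U + card (sum_diffs (polar W) X)"
    unfolding eq by (meson card_Un_le add_mono le_refl order_trans)
  also have "\<dots> \<le> 2 * card (polar X) * card U + card U + 2 * card (polar W) * card X"
    by (intro add_mono card_sum_diffs(2) PX(1) PW(1) X(1) U(1) le_refl)
  also have "\<dots> \<le> (d * (d + 1)) * (d * (d + 1)) + d * (d + 1) + (d\<^sup>2 * (d\<^sup>2 + 1)) * d"
    by (intro add_mono mult_mono PX(2) PW(2) X(2) U(2)) auto
  also have "\<dots> = d\<^sup>2 * (d + 1)\<^sup>2 + d * (d + 1) + d ^ 3 * (d\<^sup>2 + 1)"
    by (simp add: power2_eq_square power3_eq_cube algebra_simps)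
  finally show "card (cube_roots d :: (nat fword \<Rightarrow>\<^sub>0 'a) set) \<le> d\<^sup>2 * (d + 1)\<^sup>2 + d * (d + 1) + d ^ 3 * (d\<^sup>2 + 1)" .
qed

lemma words_free_alg: "k > 0 \<Longrightarrow> words d k \<subseteq> free_alg d"
  unfolding words_def by (auto intro!: free_alg_mon)

lemma cube_roots_free_alg: "cube_roots d \<subseteq> free_alg d"
proof -
  have "polar X \<subseteq> free_alg d" if "X \<subseteq> free_alg d" for X :: "(nat fword \<Rightarrow>\<^sub>0 'a) set"
    using that unfolding polar_def by (auto intro!: free_alg_sum)
  moreover have "sum_diffs P U \<subseteq> free_alg d"
    if "P \<subseteq> free_alg d" "U \<subseteq> free_alg d" for P U :: "(nat fword \<Rightarrow>\<^sub>0 'a) set"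
    using that unfolding sum_diffs_def by (auto intro!: free_alg_add free_alg_diff)
  ultimately show ?thesis
    unfolding cube_roots_def Let_def by (intro Un_least words_free_alg) (simp_all add: words_free_alg)
qed

text \<open>For \<open>T3\<close> and \<open>T4\<close> two letters are polarised and the third
  argument has degree 1 or 2; for \<open>T5\<close> the two words of degree 2 are polarised. One
  argument after another is then extended to sums of letters.\<close>

theorem eight_letters_cube_span:
  assumes p: "CHAR('a::field) > 3" and w: "set w \<subseteq> {1..d}" "length w = 8"
  shows "(mon w :: nat fword \<Rightarrow>\<^sub>0 'a) \<in> cube_span (cube_roots d) d"
proof -
  define Z where "Z = (cube_span (cube_roots d) d :: (nat fword \<Rightarrow>\<^sub>0 'a) set)"
  interpret coprime_subgroup Z "CHAR('a)"
    unfolding Z_def using p by (intro cube_span_coprime_subgroup) simp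
  have cube: "f ^ 3 \<in> Z" if "f \<in> cube_roots d" for f
    unfolding Z_def using that by (rule cube_span_cube)
  have sym: "sym3 v w u \<in> Z" if "v \<in> words d 1" "w \<in> words d 1" "u \<in> words d 1 \<union> words d 2" for u v w
    using that by (intro sym3_mem_of_cubes[OF p, of "words d 1" "words d 1 \<union> words d 2"] cube)
      (auto simp: cube_roots_def Let_def)
  have sym': "sym3 v w u \<in> Z" if "v \<in> words d 2" "w \<in> words d 2" "u \<in> words d 1" for u v w
    using that by (intro sym3_mem_of_cubes[OF p, of "words d 2" "words d 1"] cube)
      (auto simp: cube_roots_def Let_def)
  have T3: "sym3 a b c \<in> Z" if "a \<in> letter_sums d" "b \<in> letter_sums d" "c \<in> letter_sums d" for a b c
  proof -
    have 1: "sym3 (mon [i]) (mon [j]) c \<in> Z" if "i \<in> {1..d}" "j \<in> {1..d}" for i j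
      by (rule letter_sums_additive[OF _ _ add_mem \<open>c \<in> letter_sums d\<close>, where q = "sym3 (mon [i]) (mon [j])"])
        (assumption | rule sym words_1 words_2 UnI1 that | simp add: sym3_add distrib_left distrib_right)+
    have 2: "sym3 (mon [i]) b c \<in> Z" if "i \<in> {1..d}" for i
      by (rule letter_sums_additive[OF _ _ add_mem \<open>b \<in> letter_sums d\<close>, where q = "\<lambda>b. sym3 (mon [i]) b c"])
        (assumption | rule 1 that | simp add: sym3_add distrib_left distrib_right)+
    show ?thesis
      by (rule letter_sums_additive[OF _ _ add_mem \<open>a \<in> letter_sums d\<close>, where q = "\<lambda>a. sym3 a b c"])
        (assumption | rule 2 that | simp add: sym3_add distrib_left distrib_right)+
  qed
  have T4: "sym3 a b (c * e) \<in> Z"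
    if "a \<in> letter_sums d" "b \<in> letter_sums d" "c \<in> letter_sums d" "e \<in> letter_sums d" for a b c e
  proof -
    have 1: "sym3 (mon [i]) (mon [j]) (mon [k] * e) \<in> Z" if "i \<in> {1..d}" "j \<in> {1..d}" "k \<in> {1..d}" for i j k
      by (rule letter_sums_additive[OF _ _ add_mem \<open>e \<in> letter_sums d\<close>, where q = "\<lambda>e. sym3 (mon [i]) (mon [j]) (mon [k] * e)"])
        (assumption | rule sym words_1 words_2 UnI2 that | simp add: sym3_add distrib_left distrib_right)+
    have 2: "sym3 (mon [i]) (mon [j]) (c * e) \<in> Z" if "i \<in> {1..d}" "j \<in> {1..d}" for i j
      by (rule letter_sums_additive[OF _ _ add_mem \<open>c \<in> letter_sums d\<close>, where q = "\<lambda>c. sym3 (mon [i]) (mon [j]) (c * e)"])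
        (assumption | rule 1 that | simp add: sym3_add distrib_left distrib_right)+
    have 3: "sym3 (mon [i]) b (c * e) \<in> Z" if "i \<in> {1..d}" for i
      by (rule letter_sums_additive[OF _ _ add_mem \<open>b \<in> letter_sums d\<close>, where q = "\<lambda>b. sym3 (mon [i]) b (c * e)"])
        (assumption | rule 2 that | simp add: sym3_add distrib_left distrib_right)+
    show ?thesis
      by (rule letter_sums_additive[OF _ _ add_mem \<open>a \<in> letter_sums d\<close>, where q = "\<lambda>a. sym3 a b (c * e)"])
        (assumption | rule 3 that | simp add: sym3_add distrib_left distrib_right)+
  qed
  have T5: "sym3 a (b * c) (e * f) \<in> Z"
    if "a \<in> letter_sums d" "b \<in> letter_sums d" "c \<in> letter_sums d" "e \<in> letter_sums d" "f \<in> letter_sums d"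
    for a b c e f
  proof -
    have 0: "sym3 (mon [i]) (mon [j] * mon [k]) (mon [l] * mon [m]) \<in> Z"
      if "i \<in> {1..d}" "j \<in> {1..d}" "k \<in> {1..d}" "l \<in> {1..d}" "m \<in> {1..d}" for i j k l m
    proof -
      have "sym3 (mon [i]) (mon [j] * mon [k]) (mon [l] * mon [m]) = sym3 (mon [j] * mon [k]) (mon [l] * mon [m]) (mon [i])"
        by (simp add: sym3_def algebra_simps)
      then show ?thesis using sym' that words_1 words_2 by metis
    qed
    have 1: "sym3 (mon [i]) (mon [j] * mon [k]) (mon [l] * f) \<in> Z"
      if "i \<in> {1..d}" "j \<in> {1..d}" "k \<in> {1..d}" "l \<in> {1..d}" for i j k l
      by (rule letter_sums_additive[OF _ _ add_mem \<open>f \<in> letter_sums d\<close>, where q = "\<lambda>f. sym3 (mon [i]) (mon [j] * mon [k]) (mon [l] * f)"])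
        (assumption | rule 0 that | simp add: sym3_add distrib_left distrib_right)+
    have 2: "sym3 (mon [i]) (mon [j] * mon [k]) (e * f) \<in> Z" if "i \<in> {1..d}" "j \<in> {1..d}" "k \<in> {1..d}" for i j k
      by (rule letter_sums_additive[OF _ _ add_mem \<open>e \<in> letter_sums d\<close>, where q = "\<lambda>e. sym3 (mon [i]) (mon [j] * mon [k]) (e * f)"])
        (assumption | rule 1 that | simp add: sym3_add distrib_left distrib_right)+
    have 3: "sym3 (mon [i]) (mon [j] * c) (e * f) \<in> Z" if "i \<in> {1..d}" "j \<in> {1..d}" for i j
      by (rule letter_sums_additive[OF _ _ add_mem \<open>c \<in> letter_sums d\<close>, where q = "\<lambda>c. sym3 (mon [i]) (mon [j] * c) (e * f)"])
        (assumption | rule 2 that | simp add: sym3_add distrib_left distrib_right)+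
    have 4: "sym3 (mon [i]) (b * c) (e * f) \<in> Z" if "i \<in> {1..d}" for i
      by (rule letter_sums_additive[OF _ _ add_mem \<open>b \<in> letter_sums d\<close>, where q = "\<lambda>b. sym3 (mon [i]) (b * c) (e * f)"])
        (assumption | rule 3 that | simp add: sym3_add distrib_left distrib_right)+
    show ?thesis
      by (rule letter_sums_additive[OF _ _ add_mem \<open>a \<in> letter_sums d\<close>, where q = "\<lambda>a. sym3 a (b * c) (e * f)"])
        (assumption | rule 4 that | simp add: sym3_add distrib_left distrib_right)+
  qed
  have left: "a * v \<in> Z" if "a \<in> letter_sums d" "v \<in> Z" for a v
    using that(1)
  proof (induction a rule: letter_sums.induct)
    case (letter i)
    then show ?case using cube_span_mon_left[of v _ d "[i]"] that(2) by (simp add: Z_def)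
  qed (simp add: distrib_right add_mem)
  have right: "v * a \<in> Z" if "a \<in> letter_sums d" "v \<in> Z" for a v
    using that(1)
  proof (induction a rule: letter_sums.induct)
    case (letter i)
    then show ?case using cube_span_mon_right[of v _ d "[i]"] that(2) by (simp add: Z_def)
  qed (simp add: distrib_left add_mem)
  obtain a\<^sub>1 a\<^sub>2 a\<^sub>3 a\<^sub>4 a\<^sub>5 a\<^sub>6 a\<^sub>7 a\<^sub>8 where eq: "w = [a\<^sub>1, a\<^sub>2, a\<^sub>3, a\<^sub>4, a\<^sub>5, a\<^sub>6, a\<^sub>7, a\<^sub>8]"
    using w(2) by (auto simp: eval_nat_numeral length_Suc_conv)
  have letter: "(mon [i] :: nat fword \<Rightarrow>\<^sub>0 'a) \<in> letter_sums d" if "i \<in> set w" for i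
    using that w(1) by (intro letter_sums.letter) blast
  have "mon [a\<^sub>1] * mon [a\<^sub>2] * mon [a\<^sub>3] * mon [a\<^sub>4] * mon [a\<^sub>5] * mon [a\<^sub>6] * mon [a\<^sub>7] * mon [a\<^sub>8] \<in> Z"
    by (rule eight_letters_mem[OF p letter_sums.add right left T3 T4 T5]; (rule letter, simp add: eq)?)
  then show ?thesis unfolding Z_def by (simp add: eq flip: mon_append)
qed

subsection \<open>Bounds for the nilpotency degree\<close>

lemma split_at_occurrences:
  assumes "count_list s a = Suc m"
  shows "\<exists>u gs v. s = u @ concat (map (\<lambda>g. a # g) gs) @ a # v \<and> length gs = m"
  using assms
proof (induction m arbitrary: s)
  case 0
  then have "a \<in> set s" by (metis count_list_0_iff nat.simps(3))
  then obtain u v where "s = u @ a # v" by (meson split_list)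
  then show ?case by (intro exI[of _ u] exI[of _ "[]"] exI[of _ v]) simp
next
  case (Suc m)
  then have "a \<in> set s" by (metis count_list_0_iff nat.simps(3))
  then obtain u v where s: "s = u @ a # v" "a \<notin> set u" by (meson split_list_first)
  then have "count_list v a = Suc m" using Suc.prems by simp
  then obtain u' gs v' where v: "v = u' @ concat (map (\<lambda>g. a # g) gs) @ a # v'" "length gs = m"
    using Suc.IH by blast
  then show ?case using s by (intro exI[of _ u] exI[of _ "u' # gs"] exI[of _ v']) simp
qed

context
  fixes n d :: nat and I :: "(nat fword \<Rightarrow>\<^sub>0 'a::field) set"
  assumes n: "n > 0" and inf: "infinite (UNIV :: 'a set)" and char: "CHAR('a) > 0" "n < 2 * CHAR('a)"
  defines "I \<equiv> nil_ideal n d"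
begin

interpretation coprime_subgroup I "CHAR('a)"
  unfolding I_def by (rule nil_ideal_coprime_subgroup[OF n char(1)])

text \<open>The letter \<open>0\<close> is outside the alphabet, so \<open>x\<close> is renamed to
  \<open>0\<close> and its blocks are counted. With \<open>e\<^sub>0 = 1\<close> all degrees
  \<open>n div i\<close>, i \<ge> 2, are below \<open>p\<close>.\<close>

lemma nil_ideal_letter:
  assumes "set w \<subseteq> {1..d}" "x \<in> {1..d}"
    and "count_list w x > (\<Sum>i=2..n. (i - 1) * (2 ^ (n div i) - 1))"
  shows "(mon w :: nat fword \<Rightarrow>\<^sub>0 'a) \<in> I"
proof -
  define g :: "nat \<Rightarrow> (nat fword \<Rightarrow>\<^sub>0 'a)" where "g a = mon [if a \<in> {1..d} then a else x]" for a
  define w' where "w' = map (\<lambda>a. if a = x then 0 else a) w"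
  have full: "full_identity n (\<lambda>w. prod_list (map g w))"
    unfolding I_def using assms(2)
    by (intro nil_ideal_full_identity[OF n inf char(1)]) (auto simp: g_def intro!: free_alg_mon)
  have count: "count_list w' 0 = count_list w x"
    unfolding w'_def using assms(1) by (induction w) auto
  have "prod_list (map g w') \<in> I"
  proof (rule letter_degree[OF full, where e\<^sub>0 = 1 and c = "\<lambda>k. 2 ^ k - 1"])
    fix i assume i: "1 < i" "i \<le> n"
    have "2 * (n div i) \<le> i * (n div i)" using i by (intro mult_right_mono) auto
    also have "\<dots> \<le> n" by simp
    finally show "annihilates (n div i) (2 ^ (n div i) - 1)"
      using char by (intro annihilates_higman) linarith
  qed (use assms(3) count in \<open>simp_all add: numeral_2_eq_2\<close>)
  moreover have "prod_list (map g w') = mon w"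
    unfolding w'_def using assms(1)
  proof (induction w)
    case (Cons a w)
    then show ?case using assms(2) by (auto simp: g_def mon_append[of "[a]" w, simplified])
  qed (simp add: mon_Nil)
  ultimately show ?thesis by simp
qed

text \<open>Since every block of \<open>f\<close> has length at least 3, \<open>letter_degree\<close> only needs the degrees \<open>n div i \<le> n div 4\<close>,
  for which \<open>annihilates_square\<close> is available.\<close>

lemma nil_ideal_cubes:
  assumes f: "f \<in> free_alg d" and hs: "\<And>h. h \<in> set hs \<Longrightarrow> h \<in> free_alg d \<or> h = 1"
    and len: "length hs \<ge> (\<Sum>i=4..n. (i - 1) * (n div i)\<^sup>2)"
  shows "prod_list (map (\<lambda>h. f ^ 3 * h) hs) * f ^ 3 \<in> I"
proof -
  define g where "g a = (if a \<noteq> 0 \<and> a \<le> length hs \<and> hs ! (a - 1) \<in> free_alg d then hs ! (a - 1) else f)" for a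
  \<comment> \<open>\<open>0\<close> stands for \<open>f\<close> and \<open>Suc j\<close> for the
    factor \<open>hs ! j\<close>. A factor 1 becomes the empty word, as only elements of
    \<open>free_alg d\<close> may be substituted for letters.\<close>
  define F where "F j = [0, 0, 0] @ (if hs ! j \<in> free_alg d then [Suc j] else [])" for j
  define w where "w js = concat (map F js) @ [0, 0, 0]" for js
  have full: "full_identity n (\<lambda>w. prod_list (map g w))"
    unfolding I_def using f
    by (intro nil_ideal_full_identity[OF n inf char(1)]) (auto simp: g_def)
  have count: "count_list (w js) 0 = 3 * length js + 3" for js
    unfolding w_def F_def by (induction js) auto
  have nonzero: "length (filter (\<lambda>a. a \<noteq> 0) (w js)) \<le> length js" for js
    unfolding w_def F_def by (induction js) auto
  have "prod_list (map g (w [0..<length hs])) \<in> I"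
  proof (rule letter_degree[OF full, where e\<^sub>0 = 3 and c = power2])
    fix i assume i: "3 < i" "i \<le> n"
    have "4 * (n div i) \<le> i * (n div i)" using i by (intro mult_right_mono) auto
    also have "\<dots> \<le> n" by simp
    finally show "annihilates (n div i) ((n div i)\<^sup>2)"
      using char by (intro annihilates_square) linarith
  next
    \<comment> \<open>With m = \<open>length hs\<close> there are 3 (m + 1) zeros. Even after
      rearrangement, blocks of length at most 2 account for at most 2 (m + 1) of them; the other m +
      1 exceed the sum over i.\<close>
    have "(3 - 1) * Suc (length (filter (\<lambda>a. a \<noteq> 0) (w [0..<length hs])))
        \<le> 2 * Suc (length hs)" using nonzero[of "[0..<length hs]"] by simp
    then show "(3 - 1) * Suc (length (filter (\<lambda>a. a \<noteq> 0) (w [0..<length hs])))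
        + (\<Sum>i\<in>{Suc 3..n}. (i - 1) * (n div i)\<^sup>2) < count_list (w [0..<length hs]) 0"
      using len count[of "[0..<length hs]"] by simp
  qed simp
  moreover have "prod_list (map g (w js)) = prod_list (map (\<lambda>j. f ^ 3 * hs ! j) js) * f ^ 3"
    if "set js \<subseteq> {..<length hs}" for js
    using that
  proof (induction js)
    case Nil
    then show ?case by (simp add: w_def g_def power3_eq_cube mult.assoc)
  next
    case (Cons j js)
    then have "hs ! j \<in> set hs" by simp
    then have "prod_list (map g (F j)) = f ^ 3 * hs ! j"
      using hs[of "hs ! j"] Cons.prems by (auto simp: F_def g_def power3_eq_cube mult.assoc)
    then show ?case using Cons by (simp add: w_def mult.assoc)
  qed
  moreover have "map (\<lambda>j. f ^ 3 * hs ! j) [0..<length hs] = map (\<lambda>h. f ^ 3 * h) hs"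
    by (intro nth_equalityI) auto
  ultimately show ?thesis by (metis atLeast_upt lessThan_iff subsetI)
qed

text \<open>Expanding every factor leaves one cube per factor. By pigeonhole some element of
  \<open>L\<close> has more than \<open>B\<close> cubes in the word, hence at least \<open>B\<close>
  factors between consecutive ones, and \<open>nil_ideal_cubes\<close> applies.\<close>

lemma nil_ideal_cube_products:
  fixes L :: "(nat fword \<Rightarrow>\<^sub>0 'a) set"
  defines "B \<equiv> (\<Sum>i=4..n. (i - 1) * (n div i)\<^sup>2)"
  assumes L: "finite L" "L \<subseteq> free_alg d"
    and zs: "set zs \<subseteq> cube_span L d" "length zs > card L * B"
  shows "prod_list zs \<in> I"
proof -
  \<comment> \<open>In this mixed alphabet the cubes remain symbols, so that their occurrences can
    be counted.\<close>
  define G :: "nat + (nat fword \<Rightarrow>\<^sub>0 'a) \<Rightarrow> (nat fword \<Rightarrow>\<^sub>0 'a)"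
    where "G = case_sum (\<lambda>i. mon [i]) (\<lambda>f. f ^ 3)"
  define A where "A = Inl ` {1..d} \<union> Inr ` L"
  have G: "G a \<in> free_alg d" if "a \<in> A" for a
    using that L(2) by (auto simp: A_def G_def intro!: free_alg_mon free_alg_power)
  have G_prod: "prod_list (map G s) \<in> free_alg d \<or> prod_list (map G s) = 1" if "set s \<subseteq> A" for s
    using free_alg_prod_list[where l = s and g = G and d = d] G that by (cases "s = []") auto
  have Inl: "prod_list (map G (map Inl u)) = mon u" for u
    by (subst mon_eq_prod_list) (simp add: G_def comp_def)
  have mixed: "prod_list (map G s) \<in> I"
    if s: "set s \<subseteq> A" "length (filter (\<lambda>a. a \<in> Inr ` L) s) > card L * B" for s
  proof -
    have "length (filter (\<lambda>a. a \<in> Inr ` L) s) = (\<Sum>f\<in>L. count_list s (Inr f))"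
    proof (induction s)
      case (Cons a s)
      have "(\<Sum>f\<in>L. if a = Inr f then 1 else 0 :: nat) = (if a \<in> Inr ` L then 1 else 0)"
      proof (cases "a \<in> Inr ` L")
        case True
        then obtain f where "a = Inr f" "f \<in> L" by auto
        then show ?thesis using L(1) by simp
      qed (auto intro!: sum.neutral)
      moreover have "(\<Sum>f\<in>L. count_list (a # s) (Inr f))
          = (\<Sum>f\<in>L. count_list s (Inr f)) + (\<Sum>f\<in>L. if a = Inr f then 1 else 0)"
        unfolding sum.distrib[symmetric] by (intro sum.cong) auto
      ultimately show ?case using Cons by simp
    qed simp
    then have "\<exists>f\<in>L. count_list s (Inr f) > B"
      using s(2) sum_bounded_above[of L "\<lambda>f. count_list s (Inr f)" B] by (force simp: not_less)
    then obtain f where "f \<in> L" "count_list s (Inr f) > B" by blast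
    then obtain m where f: "f \<in> L" "count_list s (Inr f) = Suc m" "B \<le> m"
      using less_imp_Suc_add[of B "count_list s (Inr f)"] by auto
    then obtain u gs v where gs: "s = u @ concat (map (\<lambda>g. Inr f # g) gs) @ Inr f # v" "length gs = m"
      using split_at_occurrences[OF f(2)] by blast
    define hs where "hs = map (\<lambda>g. prod_list (map G g)) gs"
    have sub: "set u \<subseteq> A" "set v \<subseteq> A" "\<And>g. g \<in> set gs \<Longrightarrow> set g \<subseteq> A"
      using s(1) gs(1) by (auto split: if_splits)
    have "prod_list (map (\<lambda>h. f ^ 3 * h) hs) * f ^ 3 \<in> I"
    proof (rule nil_ideal_cubes)
      show "f \<in> free_alg d" using f L(2) by blast
      show "h \<in> free_alg d \<or> h = 1" if "h \<in> set hs" for h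
      proof -
        obtain g where "g \<in> set gs" "h = prod_list (map G g)" using \<open>h \<in> set hs\<close> by (auto simp: hs_def)
        then show ?thesis using G_prod[OF sub(3)] by simp
      qed
    qed (use f(3) gs(2) in \<open>simp add: B_def hs_def\<close>)
    moreover have "prod_list (map G (concat (map (\<lambda>g. Inr f # g) gs))) = prod_list (map (\<lambda>h. f ^ 3 * h) hs)"
      unfolding hs_def by (induction gs) (simp_all add: G_def mult.assoc)
    ultimately have *: "prod_list (map G (concat (map (\<lambda>g. Inr f # g) gs))) * f ^ 3 \<in> I" by simp
    have "prod_list (map G u) * (prod_list (map G (concat (map (\<lambda>g. Inr f # g) gs))) * f ^ 3) \<in> I"
      using G_prod[OF sub(1)] nil_ideal_left[OF n, of _ d] * unfolding I_def by auto
    then have "prod_list (map G u) * (prod_list (map G (concat (map (\<lambda>g. Inr f # g) gs))) * f ^ 3) * prod_list (map G v) \<in> I"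
      using G_prod[OF sub(2)] nil_ideal_right[OF n, of _ d] unfolding I_def by auto
    then show ?thesis by (simp add: gs(1) G_def mult.assoc)
  qed
  have "prod_list (map G s) * prod_list zs \<in> I"
    if "set s \<subseteq> A" "set zs \<subseteq> cube_span L d"
      "length (filter (\<lambda>a. a \<in> Inr ` L) s) + length zs > card L * B" for s zs
    using that
  proof (induction zs arbitrary: s)
    case Nil
    then show ?case using mixed by simp
  next
    case (Cons z zs)
    have "z \<in> cube_span L d" using Cons.prems by simp
    then have "prod_list (map G s) * (z * prod_list zs) \<in> I"
    proof (induction z rule: cube_span.induct)
      case (step z f u v c)
      let ?s = "s @ map Inl u @ [Inr f] @ map Inl v"
      have "prod_list (map G ?s) * prod_list zs \<in> I"
        using step.hyps Cons.prems by (intro Cons.IH) (auto simp: A_def)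
      moreover have "prod_list (map G ?s) = prod_list (map G s) * (mon u * f ^ 3 * mon v)"
        using Inl[of u] Inl[of v] by (simp add: G_def mult.assoc)
      ultimately have "const c * (prod_list (map G s) * (mon u * f ^ 3 * mon v) * prod_list zs) \<in> I"
        unfolding I_def by (intro nil_ideal_scale[OF n]) simp
      moreover have "prod_list (map G s) * ((z + const c * (mon u * f ^ 3 * mon v)) * prod_list zs)
          = prod_list (map G s) * (z * prod_list zs)
            + const c * (prod_list (map G s) * (mon u * f ^ 3 * mon v) * prod_list zs)"
      proof -
        have "x * (const c * y) = const c * (x * y)" for x y :: "nat fword \<Rightarrow>\<^sub>0 'a"
          by (metis const_mult_commute mult.assoc)
        then show ?thesis by (simp add: distrib_left distrib_right mult.assoc)
      qed
      ultimately show ?case using step.IH by (simp add: add_mem)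
    qed (simp add: zero_mem)
    then show ?case by simp
  qed
  from this[of "[]" zs] zs show ?thesis by simp
qed

theorem nilpotency_degree_le_higman:
  "nilpotency_degree TYPE('a) n d \<le> enat (d * (\<Sum>i=2..n. (i - 1) * (2 ^ (n div i) - 1)) + 1)"
proof (rule nilpotency_degree_le[OF n])
  let ?B = "\<Sum>i=2..n. (i - 1) * (2 ^ (n div i) - 1) :: nat"
  fix w assume w: "set w \<subseteq> {1..d}" "length w = d * ?B + 1"
  have "\<exists>x\<in>{1..d}. count_list w x > ?B"
  proof (rule ccontr)
    assume "\<not> ?thesis"
    then have "(\<Sum>x\<in>{1..d}. count_list w x) \<le> d * ?B"
      using sum_bounded_above[of "{1..d}" "count_list w" ?B] by (simp add: not_less)
    moreover have "(\<Sum>x\<in>{1..d}. count_list w x) = length w"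
      using w(1) sum_count_set[of w "{1..d}"] by simp
    ultimately show False using w(2) by simp
  qed
  then show "(mon w :: nat fword \<Rightarrow>\<^sub>0 'a) \<in> nil_ideal n d"
    using nil_ideal_letter[OF w(1)] unfolding I_def by blast
qed simp

theorem nilpotency_degree_le_cubes:
  assumes "CHAR('a) > 3"
  shows "nilpotency_degree TYPE('a) n d
    \<le> enat (8 * ((d\<^sup>2 * (d + 1)\<^sup>2 + d * (d + 1) + d ^ 3 * (d\<^sup>2 + 1)) * (\<Sum>i=4..n. (i - 1) * (n div i)\<^sup>2) + 1))"
proof (rule nilpotency_degree_le[OF n])
  let ?L = "cube_roots d :: (nat fword \<Rightarrow>\<^sub>0 'a) set"
  let ?B = "\<Sum>i=4..n. (i - 1) * (n div i)\<^sup>2"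
  let ?K = "d\<^sup>2 * (d + 1)\<^sup>2 + d * (d + 1) + d ^ 3 * (d\<^sup>2 + 1)"
  have blocks: "\<exists>zs. mon w = prod_list zs \<and> length zs = m \<and> set zs \<subseteq> cube_span ?L d"
    if "set w \<subseteq> {1..d}" "length w = 8 * m" for w m
    using that
  proof (induction m arbitrary: w)
    case (Suc m)
    then obtain zs where zs: "mon (drop 8 w) = prod_list zs" "length zs = m" "set zs \<subseteq> cube_span ?L d"
      using set_drop_subset[of 8 w] by (metis (no_types, lifting) diff_mult_distrib2 diff_Suc_1 length_drop
        mult_Suc_right add_diff_cancel_left' subset_trans)
    have "set (take 8 w) \<subseteq> {1..d}" "length (take 8 w) = 8" using Suc.prems set_take_subset[of 8 w] by auto
    then have "mon (take 8 w) \<in> cube_span ?L d" by (rule eight_letters_cube_span[OF assms])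
    moreover have "mon w = mon (take 8 w) * (mon (drop 8 w) :: nat fword \<Rightarrow>\<^sub>0 'a)" by (simp flip: mon_append)
    ultimately show ?case using zs by (intro exI[of _ "mon (take 8 w) # zs"]) simp
  qed (simp add: mon_Nil)
  fix w assume w: "set w \<subseteq> {1..d}" "length w = 8 * (?K * ?B + 1)"
  then obtain zs where zs: "(mon w :: nat fword \<Rightarrow>\<^sub>0 'a) = prod_list zs" "length zs = ?K * ?B + 1"
      "set zs \<subseteq> cube_span ?L d" using blocks[OF w] by blast
  have "card ?L * ?B \<le> ?K * ?B" using card_cube_roots(2) by (rule mult_right_mono) simp
  then have "card ?L * ?B < length zs" using zs(2) by linarith
  then have "prod_list zs \<in> I"
    by (rule nil_ideal_cube_products[OF card_cube_roots(1) cube_roots_free_alg zs(3)])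
  then show "(mon w :: nat fword \<Rightarrow>\<^sub>0 'a) \<in> nil_ideal n d" by (simp add: zs(1) I_def)
qed simp

end

subsection \<open>Numerical estimates\<close>

lemma powr_log_swap:
  fixes x y :: real
  assumes "x > 0" "y > 0"
  shows "x powr log 2 y = y powr log 2 x"
  using assms by (simp add: powr_def log_def)

lemma pow_le_powr_log:
  fixes m t :: real
  assumes "t \<ge> 1" "m \<ge> 2 ^ e"
  shows "t ^ e \<le> m powr log 2 t"
proof -
  have "t ^ e = (2 powr real e) powr log 2 t"
    using assms(1) by (subst powr_powr, subst mult.commute, subst powr_powr[symmetric]) (simp add: powr_realpow)
  also have "\<dots> \<le> m powr log 2 t" using assms by (intro powr_mono2) (simp_all add: powr_realpow)
  finally show ?thesis .
qed

text \<open>\<open>t powr log 2 m\<close> equals \<open>m powr log 2 t\<close>, and splitting off 32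
  = 2^5 from t gives the factor m^5. The exponent 5 matches the degree in d of the number of
  cubes.\<close>

lemma powr_log_ge:
  fixes m t :: real
  assumes "t \<ge> 32" "m \<ge> 2 ^ e"
  shows "m ^ 5 * (t / 32) ^ e \<le> t powr log 2 m"
proof -
  have m: "m > 0" using assms(2) by (smt (verit) zero_less_power)
  have "log 2 (32::real) = 5" using log_pow_cancel[of 2 5] by simp
  then have "log 2 t = 5 + log 2 (t / 32)" using assms(1) by (simp add: log_divide)
  then have "m ^ 5 * m powr log 2 (t / 32) = m powr log 2 t"
    using m by (simp add: powr_add powr_realpow[of m 5, simplified])
  moreover have "(t / 32) ^ e \<le> m powr log 2 (t / 32)" using assms by (intro pow_le_powr_log) auto
  ultimately have "m ^ 5 * (t / 32) ^ e \<le> m powr log 2 t"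
    using m by (metis mult_left_mono zero_le_power less_imp_le)
  then show ?thesis using powr_log_swap[of t m] assms(1) m by simp
qed

lemma sum_numeral_interval:
  "sum f {numeral k..numeral l :: nat} =
    (if numeral k \<le> (numeral l :: nat) then f (numeral k) + sum f {Suc (numeral k)..numeral l} else 0)"
  by (simp add: sum.atLeast_Suc_atMost)

text \<open>For n \<ge> 4 and m = 3d + 2 the power equals n^3 times
  \<open>(m / 8) powr log 2 n\<close>, which is at least n^3 (m / 8)^2 \<ge> n^3 d / 2. This reduces
  the claim to d = 2, where m = 8. At n = 42 the term i = 2 alone is 2^21 - 1, and twice this
  exceeds 42^4.\<close>

lemma higman_bound:
  fixes n d :: nat
  assumes "2 \<le> n" "n < 42" "2 \<le> d"
  shows "real (d * (\<Sum>i=2..n. (i - 1) * (2 ^ (n div i) - 1)) + 1) < real n * real n powr log 2 (3 * real d + 2)"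
proof -
  define B :: nat where "B = (\<Sum>i=2..n. (i - 1) * (2 ^ (n div i) - 1))"
  define m where "m = 3 * real d + 2"
  have m: "m \<ge> 8" using assms(3) by (simp add: m_def)
  show ?thesis
  proof (cases "n \<le> 3")
    case True
    have "m = 2 powr log 2 m" using m by simp
    also have "\<dots> \<le> real n powr log 2 m" using m assms(1) by (intro powr_mono2) auto
    finally have "real n * m \<le> real n * real n powr log 2 m" by (intro mult_left_mono) auto
    moreover have "n = 2 \<or> n = 3" using True assms(1) by linarith
    then have "real (d * B + 1) < real n * m"
      using assms(3) by (auto simp: B_def m_def sum_numeral_interval)
    ultimately show ?thesis unfolding B_def m_def by linarith
  next
    case False
    have ev: "\<forall>n\<in>set [4..<42::nat]. 2 * (\<Sum>i=2..n. (i - 1) * (2 ^ (n div i) - 1)) + 1 < n ^ 4"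
      by (simp add: sum_numeral_interval)
    have "n \<in> set [4..<42]" unfolding set_upt using False assms(2) by simp
    then have B: "2 * B + 1 < n ^ 4" unfolding B_def by (rule bspec[OF ev])
    have "real d / 2 \<le> (m / 8) ^ 2"
    proof -
      have "0 \<le> (9 * real d - 2) * (real d - 2)" using assms(3) by (intro mult_nonneg_nonneg) auto
      then show ?thesis by (simp add: m_def power2_eq_square field_simps)
    qed
    also have "\<dots> = (m / 8) powr log 2 4" using m log_pow_cancel[of 2 2] by (simp add: powr_realpow)
    also have "\<dots> \<le> (m / 8) powr log 2 n" using m False by (intro powr_mono) auto
    finally have "real n ^ 3 * (real d / 2) \<le> real n ^ 3 * (m / 8) powr log 2 n" by (intro mult_left_mono) auto
    also have "real n ^ 3 = 8 powr log 2 n"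
      using powr_log_swap[of 8 "real n"] log_pow_cancel[of 2 3] False by (simp add: powr_realpow)
    also have "8 powr log 2 n * (m / 8) powr log 2 n = real n powr log 2 m"
      using m False powr_mult[of 8 "m / 8" "log 2 n"] powr_log_swap[of m "real n"] by simp
    finally have "real n * (8 powr log 2 n * (real d / 2)) \<le> real n * real n powr log 2 m" by (intro mult_left_mono) auto
    have "2 * (d * B + 1) \<le> d * (2 * B + 1)" using assms(3) by (simp add: algebra_simps)
    also have "\<dots> < d * n ^ 4" using B assms(3) by (intro mult_strict_left_mono) auto
    finally have "real (2 * (d * B + 1)) < real (d * n ^ 4)" by (simp only: of_nat_less_iff)
    then have "real (d * B + 1) < real n * (real n ^ 3 * (real d / 2))"
      by (simp add: power_numeral_reduce algebra_simps)
    then show ?thesis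
      using \<open>real n * (8 powr log 2 n * (real d / 2)) \<le> real n * real n powr log 2 m\<close> \<open>real n ^ 3 = 8 powr log 2 n\<close>
      unfolding B_def m_def by simp
  qed
qed

text \<open>The sum of (i - 1) / i^2 grows like log n, so from 42 on its increments stay below 1/18.
  For n = 42 it is about 2.23, and 18 is the largest integer c for which it is at most 42 /
  c.\<close>

lemma sum_div_squares_le:
  fixes n :: nat
  assumes "n \<ge> 42"
  shows "18 * (\<Sum>i=4..n. (i - 1) * (n div i)\<^sup>2) \<le> n ^ 3"
proof -
  have base: "(\<Sum>i=4..42. real (i - 1) / real i ^ 2) \<le> 42 / 18"
  proof -
    \<comment> \<open>Rounding up to multiples of 1/10000 moves the evaluation to natural numbers;
      23333 is 10000 * 42 / 18 rounded down.\<close>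
    have "(\<Sum>i=4..42. real (i - 1) / real i ^ 2) \<le> (\<Sum>i=4..42. real ((i - 1) * 10000 div i\<^sup>2 + 1) / 10000)"
    proof (rule sum_mono)
      fix i :: nat assume "i \<in> {4..42}"
      have "(i - 1) * 10000 < ((i - 1) * 10000 div i\<^sup>2 + 1) * i\<^sup>2"
        using \<open>i \<in> {4..42}\<close> dividend_less_div_times[of "i\<^sup>2" "(i - 1) * 10000"] by simp
      then have "real ((i - 1) * 10000) < real (((i - 1) * 10000 div i\<^sup>2 + 1) * i\<^sup>2)" by (simp only: of_nat_less_iff)
      then have "real (i - 1) * 10000 < real ((i - 1) * 10000 div i\<^sup>2 + 1) * real i ^ 2"
        by (simp only: of_nat_mult of_nat_power of_nat_numeral)
      then show "real (i - 1) / real i ^ 2 \<le> real ((i - 1) * 10000 div i\<^sup>2 + 1) / 10000"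
        using \<open>i \<in> {4..42}\<close> by (simp add: divide_simps)
    qed
    also have "\<dots> = real (\<Sum>i=4..42. (i - 1) * 10000 div i\<^sup>2 + 1) / 10000"
      by (simp add: sum_divide_distrib)
    also have "(\<Sum>i=4..42. (i - 1) * 10000 div i\<^sup>2 + 1) \<le> (23333 :: nat)" by (simp add: sum_numeral_interval)
    finally show ?thesis by simp
  qed
  have S: "(\<Sum>i=4..n. real (i - 1) / real i ^ 2) \<le> real n / 18"
    using assms
  proof (induction n rule: nat_induct_at_least)
    case (Suc n)
    have "real n / (real n + 1)\<^sup>2 \<le> 1 / (real n + 1)" by (simp add: divide_simps power2_eq_square)
    also have "\<dots> \<le> 1 / 18" using Suc.hyps by (simp add: divide_simps)
    finally have le: "real n / (real n + 1)\<^sup>2 \<le> 1 / 18" .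
    have "(\<Sum>i=4..Suc n. real (i - 1) / real i ^ 2) = (\<Sum>i=4..n. real (i - 1) / real i ^ 2) + real n / (real n + 1)\<^sup>2"
      using Suc.hyps by (simp add: add.commute)
    moreover have "real (Suc n) / 18 = real n / 18 + 1 / 18" by simp
    ultimately show ?case using le Suc.IH by linarith
  qed (use base in simp)
  have "real (\<Sum>i=4..n. (i - 1) * (n div i)\<^sup>2) = (\<Sum>i=4..n. real (i - 1) * real (n div i) ^ 2)" by simp
  also have "\<dots> \<le> (\<Sum>i=4..n. real (i - 1) * (real n / real i) ^ 2)"
    by (intro sum_mono mult_left_mono power_mono of_nat_div_le_of_nat) auto
  also have "\<dots> = real n ^ 2 * (\<Sum>i=4..n. real (i - 1) / real i ^ 2)"
    by (simp add: sum_distrib_left power_divide mult.commute)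
  also have "\<dots> \<le> real n ^ 2 * (real n / 18)" using S by (intro mult_left_mono) auto
  finally have "real (18 * (\<Sum>i=4..n. (i - 1) * (n div i)\<^sup>2)) \<le> real (n ^ 3)"
    by (simp add: power2_eq_square power3_eq_cube)
  then show ?thesis by (simp only: of_nat_le_iff)
qed

text \<open>The left side is at most (8K + 1) n^3 / 18, and \<open>powr_log_ge\<close> with exponent
  e + 2 bounds the right side below by n m^5 (n / 32)^(e + 2). Cancelling n^3 and using n \<ge> 42
  leaves a condition on d alone. In each range of d the exponent e is the largest one that the
  smallest d permits.\<close>

lemma cubes_bound:
  fixes n d :: nat
  assumes n: "n \<ge> 42" and d: "d \<ge> 2"
  shows "real (8 * ((d\<^sup>2 * (d + 1)\<^sup>2 + d * (d + 1) + d ^ 3 * (d\<^sup>2 + 1)) * (\<Sum>i=4..n. (i - 1) * (n div i)\<^sup>2) + 1))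
    < real n * real n powr log 2 (3 * real d + 2)"
proof -
  define B :: nat where "B = (\<Sum>i=4..n. (i - 1) * (n div i)\<^sup>2)"
  define K where "K = d\<^sup>2 * (d + 1)\<^sup>2 + d * (d + 1) + d ^ 3 * (d\<^sup>2 + 1)"
  define m where "m = 3 * d + 2"
  have bound: "real (8 * (K * B + 1)) < real n * real n powr log 2 (real m)"
    if e: "2 ^ Suc (Suc e) \<le> m" "(8 * K + 1) * 32 ^ Suc (Suc e) < 18 * 42 ^ e * m ^ 5" for e
  proof -
    have "(42::nat) ^ 3 \<le> n ^ 3" using n by (intro power_mono) auto
    have "18 * (8 * (K * B + 1)) \<le> 8 * K * (18 * B) + 144" by simp
    also have "\<dots> \<le> 8 * K * n ^ 3 + n ^ 3"
      using \<open>42 ^ 3 \<le> n ^ 3\<close> sum_div_squares_le[OF n] by (intro add_mono mult_left_mono) (simp_all add: B_def)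
    finally have "18 * (8 * (K * B + 1)) * 32 ^ Suc (Suc e) \<le> (8 * K * n ^ 3 + n ^ 3) * 32 ^ Suc (Suc e)"
      by (rule mult_right_mono) simp
    also have "\<dots> = ((8 * K + 1) * 32 ^ Suc (Suc e)) * n ^ 3" by (simp add: algebra_simps)
    also have "\<dots> < 18 * 42 ^ e * m ^ 5 * n ^ 3" using e(2) n by (intro mult_strict_right_mono) auto
    also have "\<dots> \<le> 18 * n ^ e * m ^ 5 * n ^ 3" using n by (intro mult_right_mono mult_left_mono power_mono) auto
    also have "\<dots> = 18 * (n * (m ^ 5 * n ^ Suc (Suc e)))" by (simp add: power3_eq_cube ac_simps)
    finally have "8 * (K * B + 1) * 32 ^ Suc (Suc e) < n * (m ^ 5 * n ^ Suc (Suc e))" by linarith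
    then have "real (8 * (K * B + 1) * 32 ^ Suc (Suc e)) < real (n * (m ^ 5 * n ^ Suc (Suc e)))"
      by (simp only: of_nat_less_iff)
    then have "real (8 * (K * B + 1)) * 32 ^ Suc (Suc e) < real n * (real m ^ 5 * real n ^ Suc (Suc e))"
      by (simp only: of_nat_mult of_nat_power of_nat_numeral)
    then have "real (8 * (K * B + 1)) < real n * (real m ^ 5 * real n ^ Suc (Suc e)) / 32 ^ Suc (Suc e)"
      by (subst less_divide_eq) simp
    also have "\<dots> = real n * (real m ^ 5 * (real n / 32) ^ Suc (Suc e))" unfolding power_divide by simp
    also have "\<dots> \<le> real n * real n powr log 2 (real m)"
    proof (intro mult_left_mono powr_log_ge)
      have "real (2 ^ Suc (Suc e)) \<le> real m" using e(1) by (simp only: of_nat_le_iff)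
      then show "2 ^ Suc (Suc e) \<le> real m" by simp
    qed (use n in auto)
    finally show ?thesis .
  qed
  have "real (8 * (K * B + 1)) < real n * real n powr log 2 (real m)"
  proof (cases "d \<ge> 10")
    case True
    \<comment> \<open>Holds coefficient by coefficient as polynomials in d; the leading ones are 8 *
      32^5 < 18 * 42^3 * 3^5.\<close>
    have "(8 * K + 1) * 32 ^ 5 < 18 * 42 ^ 3 * m ^ 5"
      unfolding K_def m_def by (simp add: power_numeral_reduce algebra_simps)
    then show ?thesis using True bound[of 3] by (simp add: m_def)
  next
    case False
    then consider "d \<in> {2, 3, 4}" | "d \<in> {5, 6, 7, 8, 9}" using d by force
    then show ?thesis
    proof cases
      case 1
      then show ?thesis using bound[of 1] by (auto simp: m_def K_def)
    next
      case 2
      then show ?thesis using bound[of 2] by (auto simp: m_def K_def)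
    qed
  qed
  then show ?thesis by (simp add: K_def B_def m_def add.commute)
qed

theorem corollary3p1:
  fixes n d :: nat
  assumes "n \<ge> 2" and "d \<ge> 2"
    and "infinite (UNIV :: 'a::field set)"
    and "real CHAR('a) > real n / 2"
  shows "ereal_of_enat (nilpotency_degree TYPE('a) n d)
           < ereal (real n powr (log 2 (3 * real d + 2) + 1))"
proof -
  have p: "n < 2 * CHAR('a)" using assms(4) by linarith
  then have n: "n > 0" "CHAR('a) > 0" using assms(1) by auto
  have "\<exists>c. nilpotency_degree TYPE('a) n d \<le> enat c \<and> real c < real n * real n powr log 2 (3 * real d + 2)"
  proof (cases "n < 42")
    case True
    then show ?thesis
      using nilpotency_degree_le_higman[OF n(1) assms(3) n(2) p] higman_bound assms(1,2) by blast
  next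
    case False
    then have "CHAR('a) > 3" "n \<ge> 42" using p by auto
    then show ?thesis
      using nilpotency_degree_le_cubes[OF n(1) assms(3) n(2) p] cubes_bound assms(2) by blast
  qed
  then obtain c where c: "nilpotency_degree TYPE('a) n d \<le> enat c"
    "real c < real n * real n powr log 2 (3 * real d + 2)" by blast
  have "ereal_of_enat (nilpotency_degree TYPE('a) n d) \<le> ereal_of_enat (enat c)"
    using c(1) by (simp only: ereal_of_enat_le_iff)
  also have "\<dots> < ereal (real n powr (log 2 (3 * real d + 2) + 1))"
    using c(2) n(1) by (simp add: powr_add mult.commute)
  finally show ?thesis .
qed

end
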